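(* Let $(K_1,\nu_1)$ and $(K_2,\nu_2)$ be finitely ramified complete valued fields of mixed characteristic, with residue characteristic $p$, and with absolute ramification indices $e_{\nu_1}(p)$ and $e_{\nu_2}(p)$. Let $n>e_{\nu_2}(p)\,(1+e_{\nu_1}(p)^2)$ be an integer. The following are equivalent: (1) $K_1\cong K_2$; (2) $R_n(K_1)\cong R_n(K_2)$; (3) $\mathcal H_n(K_1)\cong\mathcal H_n(K_2)$ over $\mathcal H_n(\{p\})$, i.e. there is an isomorphism of valued hyperfields $\mathcal H_n(K_1)\to\mathcal H_n(K_2)$ sending $[p]_n$ to $[p]_n$.
   Context: Let $(K,\nu)$ be a valued field of mixed characteristic $(0,p)$ with valuation ring $R$, maximal ideal $\mathfrak m$ and value group $\Gamma$. It is (absolutely) finitely ramified if the set $\{\gamma\in\Gamma:0<\gamma\le\nu(p)\}$ is finite; its cardinality $e_\nu(p)$ is the absolute ramification index. Let $\pi$ be a uniformizer (an element of least positive value). For $n\ge1$ put $\mathfrak m^n=\{x\in K:\nu(x)>\nu(\pi^{n-1})\}$. The $n$-th residue ring is $R_n(K)=R/\mathfrak m^n$. The $n$-th valued hyperfield is $\mathcal H_n(K)=K/(1+\mathfrak m^n)$, the set of classes $[x]_n=x(1+\mathfrak m^n)$, with $[x]_n[y]_n=[xy]_n$, multivalued addition $[x]_n+[y]_n=\{[x'+y']_n: x'\in[x]_n,\ y'\in[y]_n\}$ and valuation $\nu([x]_n)=\nu(x)$. A homomorphism of valued hyperfields is a map $f$ with $f(0)=0$, $f(1)=1$, $f(\alpha\beta)=f(\alpha)f(\beta)$,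 $f(\alpha+\beta)\subseteq f(\alpha)+f(\beta)$, and $\nu_1(\alpha)\le\nu_1(\beta)\Leftrightarrow\nu_2(f(\alpha))\le\nu_2(f(\beta))$; an isomorphism is a bijective homomorphism whose inverse is a homomorphism. In (1) the isomorphism is one of valued fields, i.e. a field isomorphism $f$ with $\nu_1(a)<\nu_1(b)\Leftrightarrow\nu_2(f(a))<\nu_2(f(b))$; in (2) it is a ring isomorphism.
   Formalization: "Complete valued field" is taken to include that the value group is archimedean (rank one); for higher rank the claim fails, e.g. Q_p and Q_p((t)) with the composite rank-two valuation have the same residue rings R_n but are not isomorphic. *)

theory Defs
  imports
    "HOL-Algebra.QuotRing"
    "HOL-Computational_Algebra.Primes"
    "HOL-Library.Extended"
begin

text \<open>Valuations are written additively. They take values in an arbitrary linearly ordered abelian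
  group with a top element \<open>Pinf\<close> adjoined; the bottom element \<open>Minf\<close> of the type is never a value.\<close>

locale valued_field = field K for K (structure) +
  fixes \<nu> :: "'a \<Rightarrow> 'g::linordered_ab_group_add extended"
  assumes val_not_Minf: "x \<in> carrier K \<Longrightarrow> \<nu> x \<noteq> Minf"
    and val_eq_Pinf_iff: "x \<in> carrier K \<Longrightarrow> \<nu> x = Pinf \<longleftrightarrow> x = \<zero>"
    and val_mult: "\<lbrakk>x \<in> carrier K; y \<in> carrier K\<rbrakk> \<Longrightarrow> \<nu> (x \<otimes> y) = \<nu> x + \<nu> y"
    and val_add: "\<lbrakk>x \<in> carrier K; y \<in> carrier K\<rbrakk> \<Longrightarrow> min (\<nu> x) (\<nu> y) \<le> \<nu> (x \<oplus> y)"

text \<open>The value group \<open>\<Gamma>\<close> is the image of the valuation; it may be a proper subgroup of the type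
  \<open>'g\<close>, so bounds in \<open>\<Gamma>\<close> must be quantified over this set.\<close>

definition value_group ::
    "('a, 'm) ring_scheme \<Rightarrow> ('a \<Rightarrow> 'g::linordered_ab_group_add extended) \<Rightarrow> 'g set" where
  "value_group K \<nu> = {\<gamma>. \<exists>x\<in>carrier K. \<nu> x = Fin \<gamma>}"

definition valuation_ring ::
    "('a, 'm) ring_scheme \<Rightarrow> ('a \<Rightarrow> 'g::linordered_ab_group_add extended) \<Rightarrow> ('a, 'm) ring_scheme" where
  "valuation_ring K \<nu> = K\<lparr>carrier := {x \<in> carrier K. 0 \<le> \<nu> x}\<rparr>"

definition max_ideal ::
    "('a, 'm) ring_scheme \<Rightarrow> ('a \<Rightarrow> 'g::linordered_ab_group_add extended) \<Rightarrow> 'a set" where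
  "max_ideal K \<nu> = {x \<in> carrier K. 0 < \<nu> x}"

definition ring_char :: "('a, 'm) ring_scheme \<Rightarrow> nat" where
  "ring_char R =
    (if \<exists>k::nat. 0 < k \<and> [k] \<cdot>\<^bsub>R\<^esub> \<one>\<^bsub>R\<^esub> = \<zero>\<^bsub>R\<^esub>
     then LEAST k::nat. 0 < k \<and> [k] \<cdot>\<^bsub>R\<^esub> \<one>\<^bsub>R\<^esub> = \<zero>\<^bsub>R\<^esub> else 0)"

definition mixed_characteristic ::
    "('a, 'm) ring_scheme \<Rightarrow> ('a \<Rightarrow> 'g::linordered_ab_group_add extended) \<Rightarrow> nat \<Rightarrow> bool" where
  "mixed_characteristic K \<nu> p \<longleftrightarrow>
     Factorial_Ring.prime p \<and> ring_char K = 0 \<and>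
     ring_char (valuation_ring K \<nu> Quot max_ideal K \<nu>) = p"

definition ramification_values ::
    "('a, 'm) ring_scheme \<Rightarrow> ('a \<Rightarrow> 'g::linordered_ab_group_add extended) \<Rightarrow> nat \<Rightarrow> 'g set" where
  "ramification_values K \<nu> p =
     {\<gamma> \<in> value_group K \<nu>. 0 < \<gamma> \<and> Fin \<gamma> \<le> \<nu> ([p] \<cdot>\<^bsub>K\<^esub> \<one>\<^bsub>K\<^esub>)}"

definition finitely_ramified ::
    "('a, 'm) ring_scheme \<Rightarrow> ('a \<Rightarrow> 'g::linordered_ab_group_add extended) \<Rightarrow> nat \<Rightarrow> bool" where
  "finitely_ramified K \<nu> p \<longleftrightarrow> finite (ramification_values K \<nu> p)"

definition ramification_index ::
    "('a, 'm) ring_scheme \<Rightarrow> ('a \<Rightarrow> 'g::linordered_ab_group_add extended) \<Rightarrow> nat \<Rightarrow> nat" where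
  "ramification_index K \<nu> p = card (ramification_values K \<nu> p)"

text \<open>\<open>Complete valued field\<close> is understood in the classical sense: the valuation has rank at most one
  (the value group is archimedean) and every Cauchy sequence converges. In a finitely ramified field
  of mixed characteristic this says that the field is a complete discretely valued field.
  For value groups of higher rank the residue rings do not determine the field: \<open>\<rat>\<^sub>p\<close> and
  \<open>\<rat>\<^sub>p((t))\<close> with the composite rank two valuation have the same ones.\<close>

definition rank_le_one ::
    "('a, 'm) ring_scheme \<Rightarrow> ('a \<Rightarrow> 'g::linordered_ab_group_add extended) \<Rightarrow> bool" where
  "rank_le_one K \<nu> \<longleftrightarrow>
     (\<forall>x\<in>carrier K. \<forall>y\<in>carrier K.
        0 < \<nu> x \<and> y \<noteq> \<zero>\<^bsub>K\<^esub> \<longrightarrow> (\<exists>k::nat. \<nu> y \<le> \<nu> (x [^]\<^bsub>K\<^esub> k)))"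

definition val_Cauchy ::
    "('a, 'm) ring_scheme \<Rightarrow> ('a \<Rightarrow> 'g::linordered_ab_group_add extended) \<Rightarrow> (nat \<Rightarrow> 'a) \<Rightarrow> bool" where
  "val_Cauchy K \<nu> s \<longleftrightarrow>
     (\<forall>\<gamma>\<in>value_group K \<nu>. \<exists>N. \<forall>i\<ge>N. \<forall>j\<ge>N. Fin \<gamma> < \<nu> (s i \<ominus>\<^bsub>K\<^esub> s j))"

definition val_converges_to ::
    "('a, 'm) ring_scheme \<Rightarrow> ('a \<Rightarrow> 'g::linordered_ab_group_add extended) \<Rightarrow> (nat \<Rightarrow> 'a) \<Rightarrow> 'a \<Rightarrow> bool"
  where
  "val_converges_to K \<nu> s l \<longleftrightarrow>
     (\<forall>\<gamma>\<in>value_group K \<nu>. \<exists>N. \<forall>i\<ge>N. Fin \<gamma> < \<nu> (s i \<ominus>\<^bsub>K\<^esub> l))"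

locale complete_valued_field = valued_field +
  assumes rank_le_one: "rank_le_one K \<nu>"
    and Cauchy_converges:
      "\<lbrakk>\<And>i. s i \<in> carrier K; val_Cauchy K \<nu> s\<rbrakk> \<Longrightarrow> \<exists>l\<in>carrier K. val_converges_to K \<nu> s l"

definition is_uniformizer ::
    "('a, 'm) ring_scheme \<Rightarrow> ('a \<Rightarrow> 'g::linordered_ab_group_add extended) \<Rightarrow> 'a \<Rightarrow> bool" where
  "is_uniformizer K \<nu> \<pi> \<longleftrightarrow>
     \<pi> \<in> carrier K \<and> \<pi> \<noteq> \<zero>\<^bsub>K\<^esub> \<and> 0 < \<nu> \<pi> \<and> (\<forall>x\<in>carrier K. 0 < \<nu> x \<longrightarrow> \<nu> \<pi> \<le> \<nu> x)"

definition uniformizer ::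
    "('a, 'm) ring_scheme \<Rightarrow> ('a \<Rightarrow> 'g::linordered_ab_group_add extended) \<Rightarrow> 'a" where
  "uniformizer K \<nu> = (SOME \<pi>. is_uniformizer K \<nu> \<pi>)"

text \<open>For \<open>n \<ge> 1\<close> this does not depend on the choice of the uniformizer; the value at \<open>n = 0\<close> is
  irrelevant.\<close>

definition max_ideal_pow ::
    "('a, 'm) ring_scheme \<Rightarrow> ('a \<Rightarrow> 'g::linordered_ab_group_add extended) \<Rightarrow> nat \<Rightarrow> 'a set" where
  "max_ideal_pow K \<nu> n = {x \<in> carrier K. \<nu> (uniformizer K \<nu> [^]\<^bsub>K\<^esub> (n - 1)) < \<nu> x}"

definition nth_residue_ring ::
    "('a, 'm) ring_scheme \<Rightarrow> ('a \<Rightarrow> 'g::linordered_ab_group_add extended) \<Rightarrow> nat \<Rightarrow> 'a set ring" where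
  "nth_residue_ring K \<nu> n = valuation_ring K \<nu> Quot max_ideal_pow K \<nu> n"

definition valued_field_iso ::
    "('a, 'm) ring_scheme \<Rightarrow> ('a \<Rightarrow> 'g::linordered_ab_group_add extended) \<Rightarrow>
     ('b, 'l) ring_scheme \<Rightarrow> ('b \<Rightarrow> 'h::linordered_ab_group_add extended) \<Rightarrow> ('a \<Rightarrow> 'b) set" where
  "valued_field_iso K \<nu> L \<mu> =
     {f \<in> ring_iso K L. \<forall>a\<in>carrier K. \<forall>b\<in>carrier K. \<nu> a < \<nu> b \<longleftrightarrow> \<mu> (f a) < \<mu> (f b)}"

record ('c, 'g) valued_hyperfield = "'c monoid" +
  hzero :: 'c
  hadd :: "'c \<Rightarrow> 'c \<Rightarrow> 'c set"
  hval :: "'c \<Rightarrow> 'g extended"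

definition hyperfield_hom ::
    "('c, 'g::linordered_ab_group_add) valued_hyperfield \<Rightarrow>
     ('d, 'h::linordered_ab_group_add) valued_hyperfield \<Rightarrow> ('c \<Rightarrow> 'd) set" where
  "hyperfield_hom H H' =
     {f \<in> carrier H \<rightarrow> carrier H'.
        f (hzero H) = hzero H' \<and> f \<one>\<^bsub>H\<^esub> = \<one>\<^bsub>H'\<^esub> \<and>
        (\<forall>\<alpha>\<in>carrier H. \<forall>\<beta>\<in>carrier H.
           f (\<alpha> \<otimes>\<^bsub>H\<^esub> \<beta>) = f \<alpha> \<otimes>\<^bsub>H'\<^esub> f \<beta> \<and>
           f ` hadd H \<alpha> \<beta> \<subseteq> hadd H' (f \<alpha>) (f \<beta>) \<and>
           (hval H \<alpha> \<le> hval H \<beta> \<longleftrightarrow> hval H' (f \<alpha>) \<le> hval H' (f \<beta>)))}"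

definition hyperfield_iso ::
    "('c, 'g::linordered_ab_group_add) valued_hyperfield \<Rightarrow>
     ('d, 'h::linordered_ab_group_add) valued_hyperfield \<Rightarrow> ('c \<Rightarrow> 'd) set" where
  "hyperfield_iso H H' =
     {f \<in> hyperfield_hom H H'.
        bij_betw f (carrier H) (carrier H') \<and> inv_into (carrier H) f \<in> hyperfield_hom H' H}"

definition hclass ::
    "('a, 'm) ring_scheme \<Rightarrow> ('a \<Rightarrow> 'g::linordered_ab_group_add extended) \<Rightarrow> nat \<Rightarrow> 'a \<Rightarrow> 'a set" where
  "hclass K \<nu> n x = {x \<otimes>\<^bsub>K\<^esub> (\<one>\<^bsub>K\<^esub> \<oplus>\<^bsub>K\<^esub> m) | m. m \<in> max_ideal_pow K \<nu> n}"

text \<open>Multiplication and valuation are given by representatives: for \<open>n \<ge> 1\<close> the sets in the union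
  all coincide, and the valuation is constant on each class.\<close>

definition nth_hyperfield ::
    "('a, 'm) ring_scheme \<Rightarrow> ('a \<Rightarrow> 'g::linordered_ab_group_add extended) \<Rightarrow> nat \<Rightarrow>
     ('a set, 'g) valued_hyperfield" where
  "nth_hyperfield K \<nu> n =
     \<lparr>carrier = hclass K \<nu> n ` carrier K,
      monoid.mult = (\<lambda>\<alpha> \<beta>. \<Union>x\<in>\<alpha>. \<Union>y\<in>\<beta>. hclass K \<nu> n (x \<otimes>\<^bsub>K\<^esub> y)),
      one = hclass K \<nu> n \<one>\<^bsub>K\<^esub>,
      hzero = hclass K \<nu> n \<zero>\<^bsub>K\<^esub>,
      hadd = (\<lambda>\<alpha> \<beta>. {hclass K \<nu> n (x \<oplus>\<^bsub>K\<^esub> y) | x y. x \<in> \<alpha> \<and> y \<in> \<beta>}),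
      hval = (\<lambda>\<alpha>. the_elem (\<nu> ` \<alpha>))\<rparr>"

end

theory Submission
  imports Defs "HOL-Algebra.Subrings" "HOL-Algebra.Chinese_Remainder"
begin

text \<open>
  Write \<open>O\<^sub>1\<close>, \<open>O\<^sub>2\<close> for the valuation rings; they are complete discrete valuation rings. An isomorphism
  of valued fields is the same thing as an isomorphism \<open>O\<^sub>1 \<cong> O\<^sub>2\<close>, and it induces the isomorphisms of
  residue rings and of hyperfields. A hyperfield isomorphism gives one of residue rings: on \<open>O\<^sub>1\<close> the
  hyperfield class of \<open>x\<close> determines \<open>x\<close> modulo \<open>m\<^sup>n\<close>, and a sum of classes is single valued modulo
  \<open>m\<^sup>n\<close>, so choosing representatives yields a ring homomorphism from \<open>O\<^sub>1\<close> onto \<open>R\<^sub>n(K\<^sub>2)\<close> with kernel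
  \<open>m\<^sup>n\<close> (\<open>residue_ring_iso_of_hyperfield_iso\<close>). What remains is to lift an isomorphism
  \<open>R\<^sub>n(K\<^sub>1) \<cong> R\<^sub>n(K\<^sub>2)\<close> to \<open>O\<^sub>1 \<cong> O\<^sub>2\<close> (\<open>residue_correspondence_lifts\<close>).

  The residue fields may be imperfect, so there are no canonical representatives to transport.
  Instead, everything happens in the ring \<open>D\<close> of pairs \<open>(x, y)\<close> in \<open>O\<^sub>1 \<times> O\<^sub>2\<close> whose classes correspond
  to each other. An isomorphism is found as its graph, a subring of \<open>O\<^sub>1 \<times> O\<^sub>2\<close>.

  \<^item> The ring \<open>D\<close> contains a Cohen subring \<open>C\<close>: it maps onto the residue field, and its
    elements that vanish there are exactly the multiples of \<open>p\<close> (\<open>cohen_subring\<close>). Both components of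
    an element of \<open>C\<close> then have the same valuation, so \<open>C\<close> is the graph of an isomorphism between
    Cohen subrings of \<open>O\<^sub>1\<close> and \<open>O\<^sub>2\<close>. It is the intersection of a chain \<open>D = S\<^sub>0 \<supseteq> S\<^sub>1 \<supseteq> \<dots>\<close> in
    which \<open>S\<^sub>r\<^sub>+\<^sub>1\<close> is the preimage of a coefficient field of \<open>S\<^sub>r / (p S\<^sub>r + J\<^sub>r\<^sub>+\<^sub>2)\<close>. Here \<open>J\<^sub>r\<close>
    consists of the pairs in \<open>D\<close> with both valuations at least \<open>r\<close>. This quotient has
    characteristic \<open>p\<close> and a maximal ideal of square zero, and such a ring has a coefficient field
    (\<open>square_zero_coefficient_field\<close>).

  \<^item> Since \<open>e\<^sub>2 < n\<close>, the ramification indices agree; call them \<open>e\<close>. Over the first components of \<open>C\<close>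
    the uniformizer \<open>\<pi>\<^sub>1\<close> is a root of a monic polynomial \<open>E\<close> of degree \<open>e\<close>. Let \<open>(\<pi>\<^sub>1, \<rho>)\<close> be in \<open>D\<close>. Taking
    second components of the coefficients, \<open>E(\<rho>)\<close> lies in \<open>m\<^sup>n\<close>. The powers \<open>1, \<rho>, \<dots>, \<rho>\<^sup>e\<^sup>-\<^sup>1\<close> are
    a valuation basis over \<open>C\<close> (\<open>horner_p_pow_dvd\<close>) and the leading coefficient \<open>e\<close> of \<open>E'\<close> is not
    divisible by \<open>p\<^sup>e\<close>, so \<open>E'(\<rho>)\<close> has valuation less than \<open>e\<^sup>2\<close>. As \<open>n > e + e\<^sup>3 \<ge> 2 (e\<^sup>2 - 1)\<close>, Newton's
    method finds a root \<open>\<sigma>\<close> of \<open>E\<close> near \<open>\<rho>\<close>, and \<open>C[(\<pi>\<^sub>1, \<sigma>)]\<close> is the graph of an isomorphism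
    (\<open>iso_of_cohen_graph\<close>).
\<close>

section \<open>Polynomial values and the adjunction of a root\<close>

text \<open>Polynomials are given by coefficient functions because these, unlike lists, can be
  added, scaled, shifted and taken to limits pointwise.\<close>

primrec horner :: "('a, 'm) ring_scheme \<Rightarrow> nat \<Rightarrow> (nat \<Rightarrow> 'a) \<Rightarrow> 'a \<Rightarrow> 'a" where
  "horner R 0 f x = \<zero>\<^bsub>R\<^esub>"
| "horner R (Suc n) f x = f 0 \<oplus>\<^bsub>R\<^esub> x \<otimes>\<^bsub>R\<^esub> horner R n (\<lambda>i. f (Suc i)) x"

primrec horner_deriv :: "('a, 'm) ring_scheme \<Rightarrow> nat \<Rightarrow> (nat \<Rightarrow> 'a) \<Rightarrow> 'a \<Rightarrow> 'a" where
  "horner_deriv R 0 f x = \<zero>\<^bsub>R\<^esub>"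
| "horner_deriv R (Suc n) f x =
     horner R n (\<lambda>i. f (Suc i)) x \<oplus>\<^bsub>R\<^esub> x \<otimes>\<^bsub>R\<^esub> horner_deriv R n (\<lambda>i. f (Suc i)) x"

lemma horner_cong: "(\<And>i. i < n \<Longrightarrow> f i = g i) \<Longrightarrow> horner R n f x = horner R n g x"
proof (induction n arbitrary: f g)
  case (Suc n)
  have "horner R n (\<lambda>i. f (Suc i)) x = horner R n (\<lambda>i. g (Suc i)) x"
    by (rule Suc.IH) (simp add: Suc.prems)
  then show ?case using Suc.prems[of 0] by simp
qed simp

lemma horner_subring: "horner (R\<lparr>carrier := H\<rparr>) n f x = horner R n f x"
  by (induction n arbitrary: f) auto

context cring
begin

lemma horner_closed [simp]:
  "x \<in> carrier R \<Longrightarrow> (\<And>i. f i \<in> carrier R) \<Longrightarrow> horner R n f x \<in> carrier R"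
  by (induction n arbitrary: f) auto

lemma horner_deriv_closed [simp]:
  "x \<in> carrier R \<Longrightarrow> (\<And>i. f i \<in> carrier R) \<Longrightarrow> horner_deriv R n f x \<in> carrier R"
  by (induction n arbitrary: f) auto

lemma horner_zero: "x \<in> carrier R \<Longrightarrow> horner R n (\<lambda>i. \<zero>) x = \<zero>"
  by (induction n) auto

lemma horner_add:
  assumes "x \<in> carrier R" "\<And>i. f i \<in> carrier R" "\<And>i. g i \<in> carrier R"
  shows "horner R n (\<lambda>i. f i \<oplus> g i) x = horner R n f x \<oplus> horner R n g x"
  using assms
proof (induction n arbitrary: f g)
  case (Suc n)
  have c: "horner R n (\<lambda>i. f (Suc i)) x \<in> carrier R" "horner R n (\<lambda>i. g (Suc i)) x \<in> carrier R"
    "f 0 \<in> carrier R" "g 0 \<in> carrier R" "x \<in> carrier R"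
    using Suc.prems by auto
  have id: "a \<oplus> b \<oplus> x \<otimes> (u \<oplus> v) = a \<oplus> x \<otimes> u \<oplus> (b \<oplus> x \<otimes> v)"
    if "a \<in> carrier R" "b \<in> carrier R" "u \<in> carrier R" "v \<in> carrier R" for a b u v
    using that c(5) by algebra
  have "horner R n (\<lambda>i. f (Suc i) \<oplus> g (Suc i)) x
      = horner R n (\<lambda>i. f (Suc i)) x \<oplus> horner R n (\<lambda>i. g (Suc i)) x"
    using Suc.prems by (intro Suc.IH) auto
  then show ?case using id[OF c(3,4,1,2)] by simp
qed auto

lemma horner_scale:
  assumes "x \<in> carrier R" "\<And>i. f i \<in> carrier R" "c \<in> carrier R"
  shows "horner R n (\<lambda>i. c \<otimes> f i) x = c \<otimes> horner R n f x"
  using assms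
proof (induction n arbitrary: f)
  case (Suc n)
  have c: "horner R n (\<lambda>i. f (Suc i)) x \<in> carrier R" "f 0 \<in> carrier R" "x \<in> carrier R"
    "c \<in> carrier R"
    using Suc.prems by auto
  have "horner R n (\<lambda>i. c \<otimes> f (Suc i)) x = c \<otimes> horner R n (\<lambda>i. f (Suc i)) x"
    using Suc.prems by (intro Suc.IH) auto
  moreover have "c \<otimes> a \<oplus> x \<otimes> (c \<otimes> u) = c \<otimes> (a \<oplus> x \<otimes> u)"
    if "a \<in> carrier R" "u \<in> carrier R" for a u
    using that c(3,4) by algebra
  ultimately show ?case using c by simp
qed auto

lemma horner_Suc_top:
  assumes "x \<in> carrier R" "\<And>i. f i \<in> carrier R"
  shows "horner R (Suc n) f x = horner R n f x \<oplus> f n \<otimes> x [^] n"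
  using assms
proof (induction n arbitrary: f)
  case (Suc n)
  have c: "horner R n (\<lambda>i. f (Suc i)) x \<in> carrier R" "f 0 \<in> carrier R" "f (Suc n) \<in> carrier R"
    "x \<in> carrier R" "x [^] n \<in> carrier R"
    using Suc.prems by auto
  have "horner R (Suc n) (\<lambda>i. f (Suc i)) x
     = horner R n (\<lambda>i. f (Suc i)) x \<oplus> f (Suc n) \<otimes> x [^] n"
    using Suc.prems by (intro Suc.IH) auto
  then have "horner R (Suc (Suc n)) f x
     = f 0 \<oplus> x \<otimes> (horner R n (\<lambda>i. f (Suc i)) x \<oplus> f (Suc n) \<otimes> x [^] n)"
    by simp
  also have "\<dots> = f 0 \<oplus> x \<otimes> horner R n (\<lambda>i. f (Suc i)) x \<oplus> f (Suc n) \<otimes> (x [^] n \<otimes> x)"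
  proof -
    have "a \<oplus> x \<otimes> (u \<oplus> b \<otimes> y) = a \<oplus> x \<otimes> u \<oplus> b \<otimes> (y \<otimes> x)"
      if "a \<in> carrier R" "u \<in> carrier R" "b \<in> carrier R" "y \<in> carrier R" for a u b y
      using that c(4) by algebra
    then show ?thesis using c by blast
  qed
  finally show ?case by simp
qed auto

lemma horner_deriv_Suc:
  assumes "x \<in> carrier R" "\<And>i. f i \<in> carrier R"
  shows "horner_deriv R (Suc n) f x = horner R n (\<lambda>i. [Suc i] \<cdot> f (Suc i)) x"
  using assms
proof (induction n arbitrary: f)
  case (Suc n)
  have *: "horner R (Suc n) (\<lambda>i. [Suc i] \<cdot> f (Suc i)) x
     = f 1 \<oplus> x \<otimes> (horner R n (\<lambda>i. [Suc i] \<cdot> f (Suc (Suc i)) \<oplus> f (Suc (Suc i))) x)"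
    using Suc.prems by (simp add: add.nat_pow_Suc)
  have "horner_deriv R (Suc n) (\<lambda>i. f (Suc i)) x
     = horner R n (\<lambda>i. [Suc i] \<cdot> f (Suc (Suc i))) x"
    using Suc.prems by (intro Suc.IH) auto
  moreover have "horner R n (\<lambda>i. [Suc i] \<cdot> f (Suc (Suc i)) \<oplus> f (Suc (Suc i))) x
     = horner R n (\<lambda>i. [Suc i] \<cdot> f (Suc (Suc i))) x \<oplus> horner R n (\<lambda>i. f (Suc (Suc i))) x"
    using Suc.prems by (intro horner_add) auto
  moreover have "f 1 \<in> carrier R" "x \<in> carrier R"
    "horner R n (\<lambda>i. [Suc i] \<cdot> f (Suc (Suc i))) x \<in> carrier R"
    "horner R n (\<lambda>i. f (Suc (Suc i))) x \<in> carrier R"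
    using Suc.prems by auto
  moreover have "a \<oplus> x \<otimes> v \<oplus> x \<otimes> u = a \<oplus> x \<otimes> (u \<oplus> v)"
    if "a \<in> carrier R" "u \<in> carrier R" "v \<in> carrier R" for a u v
    using that \<open>x \<in> carrier R\<close> by algebra
  ultimately show ?case
    unfolding * by (subst horner_deriv.simps) (simp del: horner_deriv.simps)
qed auto

text \<open>The linear Taylor expansion is all that Newton's method needs; it is used both in a
  square-zero extension, where the remainder vanishes, and in a complete discrete valuation ring.\<close>

lemma horner_taylor:
  assumes "x \<in> carrier R" "h \<in> carrier R" "\<And>i. f i \<in> carrier R"
  shows "\<exists>q\<in>carrier R. horner R n f (x \<oplus> h)
           = horner R n f x \<oplus> h \<otimes> horner_deriv R n f x \<oplus> h \<otimes> h \<otimes> q"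
  using assms
proof (induction n arbitrary: f)
  case 0
  then show ?case by (intro bexI[of _ \<zero>]) auto
next
  case (Suc n)
  obtain q where q: "q \<in> carrier R" and eq: "horner R n (\<lambda>i. f (Suc i)) (x \<oplus> h)
      = horner R n (\<lambda>i. f (Suc i)) x \<oplus> h \<otimes> horner_deriv R n (\<lambda>i. f (Suc i)) x \<oplus> h \<otimes> h \<otimes> q"
    using Suc.IH[of "\<lambda>i. f (Suc i)"] Suc.prems by auto
  define u where "u = horner R n (\<lambda>i. f (Suc i)) x"
  define v where "v = horner_deriv R n (\<lambda>i. f (Suc i)) x"
  have c: "u \<in> carrier R" "v \<in> carrier R" "f 0 \<in> carrier R" "x \<in> carrier R" "h \<in> carrier R"
    using Suc.prems by (auto simp: u_def v_def)
  have "f 0 \<oplus> (x \<oplus> h) \<otimes> (u \<oplus> h \<otimes> v \<oplus> h \<otimes> h \<otimes> q)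
      = f 0 \<oplus> x \<otimes> u \<oplus> h \<otimes> (u \<oplus> x \<otimes> v) \<oplus> h \<otimes> h \<otimes> (v \<oplus> (x \<oplus> h) \<otimes> q)"
    using c q by algebra
  moreover have "v \<oplus> (x \<oplus> h) \<otimes> q \<in> carrier R" using c q by simp
  ultimately show ?case
    using eq unfolding u_def v_def horner.simps horner_deriv.simps by metis
qed

lemma horner_deriv_taylor:
  assumes "x \<in> carrier R" "h \<in> carrier R" "\<And>i. f i \<in> carrier R"
  shows "\<exists>q\<in>carrier R. horner_deriv R n f (x \<oplus> h) = horner_deriv R n f x \<oplus> h \<otimes> q"
proof (cases n)
  case 0
  then show ?thesis using assms(1,2) by (intro bexI[of _ \<zero>]) auto
next
  case (Suc m)
  define g where "g = (\<lambda>i. [Suc i] \<cdot> f (Suc i))"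
  have g: "g i \<in> carrier R" for i using assms by (simp add: g_def)
  obtain q where q: "q \<in> carrier R" "horner R m g (x \<oplus> h)
           = horner R m g x \<oplus> h \<otimes> horner_deriv R m g x \<oplus> h \<otimes> h \<otimes> q"
    using horner_taylor[where f = g and n = m, OF assms(1,2) g] by auto
  have c: "horner R m g x \<in> carrier R" "horner_deriv R m g x \<in> carrier R"
    using g assms by auto
  have id: "u \<oplus> h \<otimes> v \<oplus> h \<otimes> h \<otimes> w = u \<oplus> h \<otimes> (v \<oplus> h \<otimes> w)"
    if "u \<in> carrier R" "v \<in> carrier R" "w \<in> carrier R" for u v w
    using that assms(2) by algebra
  have "horner R m g (x \<oplus> h) = horner R m g x \<oplus> h \<otimes> (horner_deriv R m g x \<oplus> h \<otimes> q)"
    unfolding q(2) by (rule id[OF c q(1)])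
  moreover have "horner_deriv R n f (x \<oplus> h) = horner R m g (x \<oplus> h)"
    unfolding Suc g_def using assms by (intro horner_deriv_Suc) auto
  moreover have "horner_deriv R n f x = horner R m g x"
    unfolding Suc g_def using assms by (intro horner_deriv_Suc) auto
  ultimately show ?thesis using c q(1) assms(2) by auto
qed

lemma horner_diff_multiple:
  assumes "x \<in> carrier R" "h \<in> carrier R" "\<And>i. f i \<in> carrier R"
  shows "\<exists>q\<in>carrier R. horner R n f (x \<oplus> h) = horner R n f x \<oplus> h \<otimes> q"
proof -
  obtain q where q: "q \<in> carrier R" "horner R n f (x \<oplus> h)
           = horner R n f x \<oplus> h \<otimes> horner_deriv R n f x \<oplus> h \<otimes> h \<otimes> q"
    using horner_taylor[where f = f and n = n, OF assms] by auto
  have c: "horner R n f x \<in> carrier R" "horner_deriv R n f x \<in> carrier R"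
    using assms by auto
  have id: "u \<oplus> h \<otimes> v \<oplus> h \<otimes> h \<otimes> w = u \<oplus> h \<otimes> (v \<oplus> h \<otimes> w)"
    if "u \<in> carrier R" "v \<in> carrier R" "w \<in> carrier R" for u v w
    using that assms(2) by algebra
  have "horner R n f (x \<oplus> h) = horner R n f x \<oplus> h \<otimes> (horner_deriv R n f x \<oplus> h \<otimes> q)"
    unfolding q(2) by (rule id[OF c q(1)])
  then show ?thesis using c q(1) assms(2) by auto
qed

text \<open>If \<open>x\<close> is a root of a monic polynomial of degree \<open>d\<close> over
  \<open>T\<close>, this set is \<open>T[x]\<close>.\<close>

definition poly_values :: "'a set \<Rightarrow> nat \<Rightarrow> 'a \<Rightarrow> 'a set" where
  "poly_values T d x = {horner R d f x | f. range f \<subseteq> T}"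

text \<open>Multiplication by \<open>x\<close> shifts the coefficients, and the term
  \<open>x\<^sup>d\<close> that overflows is in the set by assumption; closure under products
  follows by Horner's scheme in one of the factors.\<close>

lemma poly_values_subring:
  assumes T: "subring T R" and x: "x \<in> carrier R" and d: "0 < d" and xd: "x [^] d \<in> poly_values T d x"
  shows "subring (poly_values T d x) R" "T \<subseteq> poly_values T d x" "x \<in> poly_values T d x"
proof -
  let ?P = "poly_values T d x"
  note Tc = subringE[OF T]
  have Tcarr: "\<And>t. t \<in> T \<Longrightarrow> t \<in> carrier R" using Tc(1) by auto
  have rng: "\<And>f i. range f \<subseteq> T \<Longrightarrow> f i \<in> carrier R" using Tcarr by auto
  have sub: "?P \<subseteq> carrier R"
    unfolding poly_values_def by clarify (rule horner_closed[OF x], erule rng)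
  have add: "a \<oplus> b \<in> ?P" if "a \<in> ?P" "b \<in> ?P" for a b
  proof -
    obtain f g where f: "range f \<subseteq> T" "a = horner R d f x" and g: "range g \<subseteq> T" "b = horner R d g x"
      using \<open>a \<in> ?P\<close> \<open>b \<in> ?P\<close> unfolding poly_values_def by blast
    have "a \<oplus> b = horner R d (\<lambda>i. f i \<oplus> g i) x"
      using horner_add[where f = f and g = g, OF x rng[OF f(1)] rng[OF g(1)]] f(2) g(2) by simp
    moreover have "range (\<lambda>i. f i \<oplus> g i) \<subseteq> T"
      using f g Tc(7) by (auto simp: image_subset_iff)
    ultimately show ?thesis unfolding poly_values_def by blast
  qed
  have scale: "c \<otimes> a \<in> ?P" if "c \<in> T" "a \<in> ?P" for a c
  proof -
    obtain f where f: "range f \<subseteq> T" "a = horner R d f x"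
      using \<open>a \<in> ?P\<close> unfolding poly_values_def by blast
    have "c \<otimes> a = horner R d (\<lambda>i. c \<otimes> f i) x"
      using horner_scale[where f = f, OF x rng[OF f(1)] Tcarr[OF \<open>c \<in> T\<close>]] f(2) by simp
    moreover have "range (\<lambda>i. c \<otimes> f i) \<subseteq> T"
      using f \<open>c \<in> T\<close> Tc(6) by (auto simp: image_subset_iff)
    ultimately show ?thesis unfolding poly_values_def by blast
  qed
  obtain d' where d': "d = Suc d'" using d by (cases d) auto
  show T_sub: "T \<subseteq> ?P"
  proof
    fix t assume t: "t \<in> T"
    have "horner R d (case_nat t (\<lambda>_. \<zero>)) x = t"
      using t x Tcarr by (simp add: d' horner_zero)
    moreover have "range (case_nat t (\<lambda>_. \<zero>)) \<subseteq> T"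
      using t Tc(2) by (auto split: nat.split)
    ultimately show "t \<in> ?P" unfolding poly_values_def by (smt (verit) mem_Collect_eq)
  qed
  have xmult: "x \<otimes> a \<in> ?P" if a: "a \<in> ?P" for a
  proof -
    obtain f where f: "range f \<subseteq> T" "a = horner R d f x"
      using a unfolding poly_values_def by blast
    let ?g = "case_nat \<zero> f"
    have g: "range ?g \<subseteq> T" using f Tc(2) by (auto simp: image_subset_iff split: nat.split)
    have "x \<otimes> a = horner R (Suc d) ?g x"
      using f horner_closed[where f = f, OF x rng[OF f(1)]] x by simp
    also have "\<dots> = horner R d ?g x \<oplus> ?g d \<otimes> x [^] d"
      using x rng[OF g] by (rule horner_Suc_top)
    finally have "x \<otimes> a = horner R d ?g x \<oplus> ?g d \<otimes> x [^] d" .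
    moreover have "horner R d ?g x \<in> ?P" using g unfolding poly_values_def by blast
    moreover have "?g d \<otimes> x [^] d \<in> ?P" using g xd by (intro scale) auto
    ultimately show ?thesis using add by metis
  qed
  have mult': "horner R n f x \<otimes> b \<in> ?P" if "range f \<subseteq> T" "b \<in> ?P" for n f b
    using that(1)
  proof (induction n arbitrary: f)
    case 0
    have "b \<in> carrier R" using that(2) sub by auto
    then show ?case using T_sub Tc(2) by auto
  next
    case (Suc n)
    let ?h = "horner R n (\<lambda>i. f (Suc i)) x"
    have r: "range (\<lambda>i. f (Suc i)) \<subseteq> T" using Suc.prems by auto
    have h: "?h \<in> carrier R" using rng[OF r] x by auto
    have "(f 0 \<oplus> x \<otimes> ?h) \<otimes> b = f 0 \<otimes> b \<oplus> x \<otimes> (?h \<otimes> b)"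
    proof -
      have "f 0 \<in> carrier R" "b \<in> carrier R" using rng[OF Suc.prems] that(2) sub by auto
      moreover have "(a \<oplus> x \<otimes> u) \<otimes> c = a \<otimes> c \<oplus> x \<otimes> (u \<otimes> c)"
        if "a \<in> carrier R" "u \<in> carrier R" "c \<in> carrier R" for a u c
        using that x by algebra
      ultimately show ?thesis using h by blast
    qed
    moreover have "f 0 \<otimes> b \<in> ?P" using scale[OF _ that(2), of "f 0"] Suc.prems by auto
    moreover have "x \<otimes> (?h \<otimes> b) \<in> ?P" using xmult Suc.IH[OF r] by auto
    ultimately show ?case using add by simp
  qed
  have mult: "a \<otimes> b \<in> ?P" if "a \<in> ?P" "b \<in> ?P" for a b
    using mult' that unfolding poly_values_def by blast
  have one: "\<one> \<in> ?P" using T_sub Tc(3) by auto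
  show "x \<in> ?P" using xmult[OF one] x by simp
  show "subring ?P R"
  proof (rule subringI[OF sub one _ mult add])
    fix a assume a: "a \<in> ?P"
    have "\<ominus> \<one> \<otimes> a \<in> ?P" using scale[OF _ a] Tc(3,5) by auto
    moreover have "\<ominus> \<one> \<otimes> a = \<ominus> a" using a sub by (simp add: l_minus subset_iff)
    ultimately show "\<ominus> a \<in> ?P" by simp
  qed
qed

end

section \<open>Coefficient fields of square-zero thickenings\<close>

lemma (in ring_hom_ring) hom_nat_multiple_one: "h ([(k::nat)] \<cdot> \<one>) = [k] \<cdot>\<^bsub>S\<^esub> \<one>\<^bsub>S\<^esub>"
proof (induction k)
  case 0
  then show ?case using hom_zero by simp
next
  case (Suc k)
  have "h ([k] \<cdot> \<one> \<oplus> \<one>) = h ([k] \<cdot> \<one>) \<oplus>\<^bsub>S\<^esub> h \<one>"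
    by (rule hom_add) auto
  then show ?case using Suc hom_one by (simp add: S.add.nat_pow_Suc R.add.nat_pow_Suc)
qed

lemma (in ideal) coset_eq_zero_iff:
  "a \<in> carrier R \<Longrightarrow> I +> a = \<zero>\<^bsub>R Quot I\<^esub> \<longleftrightarrow> a \<in> I"
  using a_rcos_const rcos_const_imp_mem unfolding FactRing_def by auto

lemma (in ideal) coset_eq_iff:
  "a \<in> carrier R \<Longrightarrow> b \<in> carrier R \<Longrightarrow> I +> a = I +> b \<longleftrightarrow> a \<ominus> b \<in> I"
  using quotient_eq_iff_same_a_r_cos[OF is_ideal] by simp

lemma (in ideal) coset_surj: "q \<in> carrier (R Quot I) \<Longrightarrow> \<exists>a\<in>carrier R. q = I +> a"
  using A_RCOSETS_def'[of R I] unfolding FactRing_def by auto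

context cring begin

lemma binomial_theorem:
  assumes "x \<in> carrier R" "y \<in> carrier R"
  shows "(x \<oplus> y) [^] n = (\<Oplus>k\<in>{..n}. [(n choose k)] \<cdot> (x [^] k \<otimes> y [^] (n - k)))"
proof (induction n)
  case (Suc n)
  let ?F = "\<lambda>k. if k = 0 then \<zero> else [(n choose (k - 1))] \<cdot> (x [^] k \<otimes> y [^] (Suc n - k))"
  let ?G = "\<lambda>k. [(n choose k)] \<cdot> (x [^] k \<otimes> y [^] (Suc n - k))"
  have cx: "x [^] k \<in> carrier R" and cy: "y [^] k \<in> carrier R" for k :: nat
    using assms by auto
  have "(x \<oplus> y) [^] Suc n = x \<otimes> (x \<oplus> y) [^] n \<oplus> y \<otimes> (x \<oplus> y) [^] n"
    using assms by (simp add: m_comm l_distr)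
  also have "x \<otimes> (x \<oplus> y) [^] n = (\<Oplus>k\<in>{..Suc n}. ?F k)"
  proof -
    have "x \<otimes> (x \<oplus> y) [^] n = (\<Oplus>k\<in>{..n}. x \<otimes> ([(n choose k)] \<cdot> (x [^] k \<otimes> y [^] (n - k))))"
      unfolding Suc using assms cx cy by (intro finsum_rdistr) auto
    also have "\<dots> = (\<Oplus>k\<in>{..n}. ?F (Suc k))"
      using assms cx cy
      by (intro finsum_cong') (auto simp: add_pow_rdistr m_assoc m_comm m_lcomm)
    also have "\<dots> = (\<Oplus>k\<in>{..n}. ?F (Suc k)) \<oplus> ?F 0"
      using assms cx cy by (simp add: finsum_closed Pi_def)
    also have "\<dots> = (\<Oplus>k\<in>{..Suc n}. ?F k)"
      using cx cy by (intro finsum_Suc2[symmetric]) auto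
    finally show ?thesis .
  qed
  also have "y \<otimes> (x \<oplus> y) [^] n = (\<Oplus>k\<in>{..Suc n}. ?G k)"
  proof -
    have "y \<otimes> (x \<oplus> y) [^] n = (\<Oplus>k\<in>{..n}. y \<otimes> ([(n choose k)] \<cdot> (x [^] k \<otimes> y [^] (n - k))))"
      unfolding Suc using assms cx cy by (intro finsum_rdistr) auto
    also have "\<dots> = (\<Oplus>k\<in>{..n}. ?G k)"
      using assms cx cy
      by (intro finsum_cong') (auto simp: add_pow_rdistr m_assoc m_comm m_lcomm Suc_diff_le)
    also have "\<dots> = ?G (Suc n) \<oplus> (\<Oplus>k\<in>{..n}. ?G k)"
      using assms cx cy by (simp add: binomial_eq_0 finsum_closed Pi_def)
    also have "\<dots> = (\<Oplus>k\<in>{..Suc n}. ?G k)"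
      using cx cy by (intro finsum_Suc[symmetric]) auto
    finally show ?thesis .
  qed
  also have "(\<Oplus>k\<in>{..Suc n}. if k = 0 then \<zero> else
        [(n choose (k - 1))] \<cdot> (x [^] k \<otimes> y [^] (Suc n - k)))
      \<oplus> (\<Oplus>k\<in>{..Suc n}. [(n choose k)] \<cdot> (x [^] k \<otimes> y [^] (Suc n - k)))
      = (\<Oplus>k\<in>{..Suc n}. (if k = 0 then \<zero> else
        [(n choose (k - 1))] \<cdot> (x [^] k \<otimes> y [^] (Suc n - k))) \<oplus>
          [(n choose k)] \<cdot> (x [^] k \<otimes> y [^] (Suc n - k)))"
    using assms cx cy by (subst finsum_addf) auto
  also have "\<dots> = (\<Oplus>k\<in>{..Suc n}. [(Suc n choose k)] \<cdot> (x [^] k \<otimes> y [^] (Suc n - k)))"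
  proof (rule finsum_cong')
    fix k assume "k \<in> {..Suc n}"
    then show "(if k = 0 then \<zero> else
        [(n choose (k - 1))] \<cdot> (x [^] k \<otimes> y [^] (Suc n - k))) \<oplus>
          [(n choose k)] \<cdot> (x [^] k \<otimes> y [^] (Suc n - k))
        = [(Suc n choose k)] \<cdot> (x [^] k \<otimes> y [^] (Suc n - k))"
      using assms cx cy by (cases k) (auto simp: add.nat_pow_mult)
  qed (use cx cy in auto)
  finally show ?case .
qed (use assms in simp)

lemma multiple_eq_zero:
  assumes "[(p::nat)] \<cdot> \<one> = \<zero>" "p dvd k" "x \<in> carrier R"
  shows "[k] \<cdot> x = \<zero>"
proof -
  obtain l where l: "k = p * l" using assms(2) by (elim dvdE)
  have "[p] \<cdot> x = ([p] \<cdot> \<one>) \<otimes> x"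
    using assms(3) add_pow_ldistr[of \<one> x p] by simp
  then have "[p] \<cdot> x = \<zero>" using assms by simp
  then show ?thesis
    using assms(3) by (simp add: l flip: add.nat_pow_pow)
qed

text \<open>The binomial coefficients \<open>p choose k\<close> with \<open>0 < k < p\<close> are
  divisible by \<open>p\<close>.\<close>

lemma frobenius_add:
  assumes p: "Factorial_Ring.prime (p::nat)" and char: "[p] \<cdot> \<one> = \<zero>"
    and x: "x \<in> carrier R" and y: "y \<in> carrier R"
  shows "(x \<oplus> y) [^] p = x [^] p \<oplus> y [^] p"
proof -
  have cx: "x [^] k \<in> carrier R" and cy: "y [^] k \<in> carrier R" for k :: nat
    using x y by auto
  obtain q where q: "p = Suc (Suc q)"
    using prime_ge_2_nat[OF p] by (metis Suc_le_D numeral_2_eq_2 Suc_le_mono)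
  let ?t = "\<lambda>k. [(p choose k)] \<cdot> (x [^] k \<otimes> y [^] (p - k))"
  have tc: "?t \<in> A \<rightarrow> carrier R" for A using cx cy by auto
  have "(x \<oplus> y) [^] p = (\<Oplus>k\<in>{..p}. ?t k)"
    using binomial_theorem[OF x y] .
  also have "\<dots> = ?t p \<oplus> (\<Oplus>k\<in>{..Suc q}. ?t k)"
    using finsum_Suc[of ?t "Suc q"] tc by (simp add: q)
  also have "(\<Oplus>k\<in>{..Suc q}. ?t k) = (\<Oplus>k\<in>{..q}. ?t (Suc k)) \<oplus> ?t 0"
    using tc by (subst finsum_Suc2) auto
  also have "(\<Oplus>k\<in>{..q}. ?t (Suc k)) = (\<Oplus>k\<in>{..q}. \<zero>)"
  proof (rule finsum_cong')
    fix k assume "k \<in> {..q}"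
    then have "p dvd (p choose Suc k)"
      using p q by (intro dvd_choose_prime) auto
    then show "?t (Suc k) = \<zero>"
      using x cx cy by (intro multiple_eq_zero[OF char] m_closed) auto
  qed auto
  finally show ?thesis using cx cy by simp
qed

lemma subring_nat_multiple:
  assumes "subring T R" "t \<in> T" shows "[(k::nat)] \<cdot> t \<in> T"
  using subringE(2,7)[OF assms(1)] assms(2) by (induction k) (auto simp: add.nat_pow_Suc)

lemma subring_nat_pow:
  assumes "subring T R" "t \<in> T" shows "t [^] (k::nat) \<in> T"
  using subringE(3,6)[OF assms(1)] assms(2) by (induction k) auto

text \<open>The \<open>p\<close>-th powers form a subring that meets \<open>N\<close> only in
  zero, because \<open>y\<^sup>p = 0\<close> for \<open>y\<close> in \<open>N\<close>. A maximal
  subring \<open>T\<close> that contains them and meets \<open>N\<close> in zero is a field. If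
  some \<open>x\<close> were not congruent to an element of \<open>T\<close>, its minimal
  polynomial modulo \<open>N\<close> would have degree \<open>d \<le> p\<close>, since
  \<open>x\<^sup>p\<close> is in \<open>T\<close>. For \<open>d = p\<close> this relation holds
  exactly; for \<open>d < p\<close> the polynomial is separable and one Newton step moves
  \<open>x\<close> inside its class to an exact root. In both cases \<open>T\<close> could be
  enlarged by that root.\<close>

theorem square_zero_coefficient_field:
  assumes N: "ideal N R" and sq: "\<And>a b. a \<in> N \<Longrightarrow> b \<in> N \<Longrightarrow> a \<otimes> b = \<zero>"
    and p: "Factorial_Ring.prime (p::nat)" and char: "[p] \<cdot> \<one> = \<zero>"
    and unit: "\<And>a. a \<in> carrier R \<Longrightarrow> a \<notin> N \<Longrightarrow> a \<in> Units R" and one: "\<one> \<notin> N"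
  shows "\<exists>T. subring T R \<and> T \<inter> N = {\<zero>} \<and> (\<forall>x\<in>carrier R. \<exists>t\<in>T. x \<ominus> t \<in> N)"
proof -
  interpret N: ideal N R by (rule N)
  have p2: "2 \<le> p" using p by (rule prime_ge_2_nat)
  have N_carr: "a \<in> carrier R" if "a \<in> N" for a using that by (rule N.Icarr)
  have N_add: "a \<oplus> b \<in> N" if "a \<in> N" "b \<in> N" for a b using that by (rule N.a_closed)
  have N_mult: "a \<otimes> b \<in> N" if "a \<in> carrier R" "b \<in> N" for a b using that by (simp add: N.I_l_closed)
  have N_neg: "\<ominus> a \<in> N" if "a \<in> N" for a using that by (rule N.a_inv_closed)
  have N_zero: "\<zero> \<in> N" by (rule N.zero_closed)
  have N_cancel: "a \<in> N" if "a \<oplus> b \<in> N" "b \<in> N" "a \<in> carrier R" for a b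
  proof -
    have "a \<oplus> b \<oplus> \<ominus> b \<in> N" using that N_add N_neg by blast
    moreover have "a \<oplus> b \<oplus> \<ominus> b = a" using that N_carr[OF that(2)] by algebra
    ultimately show ?thesis by simp
  qed
  have unit_notin: "a \<notin> N" if "a \<in> Units R" for a
  proof
    assume "a \<in> N"
    then have "inv a \<otimes> a \<in> N" by (rule N_mult[OF Units_inv_closed[OF that]])
    then show False using that one by simp
  qed
  have pow_N: "y [^] p = \<zero>" if "y \<in> N" for y
  proof -
    have "p = Suc (Suc (p - 2))" using p2 by simp
    then have "y [^] p = y [^] (p - 2) \<otimes> (y \<otimes> y)"
      using N_carr[OF that] by (metis m_assoc nat_pow_Suc nat_pow_closed)
    then show ?thesis using sq[OF that that] N_carr[OF that] by simp
  qed
  \<comment> \<open>The \<open>p\<close>-th powers are built in from the start: without them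
    \<open>T\<close> could not absorb inseparable elements.\<close>
  define T0 where "T0 = (\<lambda>y. y [^] p) ` carrier R"
  have p_pow_neg: "\<ominus> (y [^] p) = (\<ominus> y) [^] p" if "y \<in> carrier R" for y
  proof -
    have "(\<ominus> y) [^] p \<oplus> y [^] p = (\<ominus> y \<oplus> y) [^] p"
      using that by (intro frobenius_add[OF p char, symmetric]) auto
    also have "\<dots> = \<zero>" using that p2 by (simp add: l_neg nat_pow_zero)
    finally show ?thesis using that by (metis minus_equality nat_pow_closed a_inv_closed)
  qed
  have T0: "subring T0 R"
  proof (rule subringI)
    show "\<one> \<in> T0" unfolding T0_def by (intro image_eqI[of _ _ \<one>]) auto
  next
    fix a assume "a \<in> T0"
    then show "\<ominus> a \<in> T0" unfolding T0_def using p_pow_neg by auto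
  next
    fix a b assume "a \<in> T0" "b \<in> T0"
    then obtain x y where xy: "x \<in> carrier R" "y \<in> carrier R" "a = x [^] p" "b = y [^] p"
      unfolding T0_def by blast
    have "a \<otimes> b = (x \<otimes> y) [^] p" "a \<oplus> b = (x \<oplus> y) [^] p"
      using xy frobenius_add[OF p char] by (simp_all add: nat_pow_distrib)
    then show "a \<otimes> b \<in> T0" "a \<oplus> b \<in> T0" unfolding T0_def using xy by auto
  qed (auto simp: T0_def)
  have T0_N: "T0 \<inter> N \<subseteq> {\<zero>}"
    using unit unit_notin Units_pow_closed pow_N unfolding T0_def by blast
  define \<A> where "\<A> = {T. subring T R \<and> T0 \<subseteq> T \<and> T \<inter> N \<subseteq> {\<zero>}}"
  have "\<exists>M\<in>\<A>. \<forall>X\<in>\<A>. M \<subseteq> X \<longrightarrow> X = M"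
  proof (rule subset_Zorn_nonempty)
    show "\<A> \<noteq> {}" using T0 T0_N unfolding \<A>_def by blast
  next
    fix C assume "C \<noteq> {}" and C: "subset.chain \<A> C"
    have C_sub: "T \<in> \<A>" if "T \<in> C" for T using C that by (auto simp: subset_chain_def)
    have C_lin: "S \<subseteq> T \<or> T \<subseteq> S" if "S \<in> C" "T \<in> C" for S T
      using C that by (auto simp: subset_chain_def)
    have common: "\<exists>T\<in>C. a \<in> T \<and> b \<in> T" if "a \<in> \<Union>C" "b \<in> \<Union>C" for a b
      using that C_lin by blast
    have ring: "subring T R" if "T \<in> C" for T using C_sub[OF that] by (simp add: \<A>_def)
    have "subring (\<Union>C) R"
    proof (rule subringI)
      show "\<Union>C \<subseteq> carrier R" using subringE(1)[OF ring] by auto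
      show "\<one> \<in> \<Union>C" using subringE(3)[OF ring] \<open>C \<noteq> {}\<close> by auto
    next
      fix a assume "a \<in> \<Union>C" then show "\<ominus> a \<in> \<Union>C" using subringE(5)[OF ring] by auto
    next
      fix a b assume "a \<in> \<Union>C" "b \<in> \<Union>C"
      then obtain T where T: "T \<in> C" "a \<in> T" "b \<in> T" using common by blast
      then have "a \<otimes> b \<in> T" "a \<oplus> b \<in> T" using subringE(6,7)[OF ring[OF T(1)]] by auto
      then show "a \<otimes> b \<in> \<Union>C" "a \<oplus> b \<in> \<Union>C" using T by auto
    qed
    moreover have "T0 \<subseteq> \<Union>C" using C_sub \<open>C \<noteq> {}\<close> by (fastforce simp: \<A>_def)
    moreover have "\<Union>C \<inter> N \<subseteq> {\<zero>}" using C_sub by (fastforce simp: \<A>_def)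
    ultimately show "\<Union>C \<in> \<A>" by (simp add: \<A>_def)
  qed
  then obtain T where T_in: "T \<in> \<A>" and T_max: "\<forall>X\<in>\<A>. T \<subseteq> X \<longrightarrow> X = T" by auto
  have T: "subring T R" "T0 \<subseteq> T" "T \<inter> N \<subseteq> {\<zero>}" using T_in by (simp_all add: \<A>_def)
  have max: "X = T" if "subring X R" "T0 \<subseteq> X" "X \<inter> N \<subseteq> {\<zero>}" "T \<subseteq> X" for X
    using T_max that by (simp add: \<A>_def)
  note T_ring = subringE[OF T(1)]
  have T_carr: "t \<in> carrier R" if "t \<in> T" for t using that T_ring(1) by blast
  \<comment> \<open>An inverse is a \<open>p\<close>-th power times an element of
    \<open>T\<close>: \<open>1/t = t\<^sup>p\<^sup>-\<^sup>1 (1/t)\<^sup>p\<close>.\<close>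
  have T_unit: "t \<in> Units R" and T_inv: "inv t \<in> T" if t: "t \<in> T" "t \<noteq> \<zero>" for t
  proof -
    show u: "t \<in> Units R" using t T(3) T_carr unit by blast
    have "inv t = t [^] (p - 1) \<otimes> (inv t) [^] p"
    proof -
      have "p = Suc (p - 1)" using p2 by simp
      then have "t [^] (p - 1) \<otimes> (inv t) [^] p = t [^] (p - 1) \<otimes> ((inv t) [^] (p - 1) \<otimes> inv t)"
        using nat_pow_Suc by metis
      also have "\<dots> = (t [^] (p - 1) \<otimes> (inv t) [^] (p - 1)) \<otimes> inv t"
        using u by (intro m_assoc[symmetric]) auto
      also have "t [^] (p - 1) \<otimes> (inv t) [^] (p - 1) = (t \<otimes> inv t) [^] (p - 1)"
        using u by (intro nat_pow_distrib[symmetric]) auto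
      finally show ?thesis using u by simp
    qed
    moreover have "(inv t) [^] p \<in> T" using T(2) u unfolding T0_def by auto
    moreover have "t [^] (p - 1) \<in> T" using subring_nat_pow[OF T(1) t(1)] .
    ultimately show "inv t \<in> T" using T_ring(6) by metis
  qed
  have "\<exists>t\<in>T. x \<ominus> t \<in> N" if x: "x \<in> carrier R" for x
  proof (rule ccontr)
    assume x_notin: "\<not> (\<exists>t\<in>T. x \<ominus> t \<in> N)"
    define Rel where "Rel d \<longleftrightarrow> (\<exists>f. range f \<subseteq> T \<and> x [^] d \<oplus> horner R d f x \<in> N)" for d :: nat
    have xp: "x [^] p \<in> T" using T(2) x unfolding T0_def by auto
    have Rel_p: "Rel p"
    proof -
      let ?f = "case_nat (\<ominus> (x [^] p)) (\<lambda>_. \<zero>)"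
      have "range ?f \<subseteq> T" using xp T_ring(2,5) by (auto split: nat.split)
      moreover have "horner R p ?f x = \<ominus> (x [^] p)"
        using p2 x by (cases p) (auto simp: horner_zero)
      ultimately show ?thesis unfolding Rel_def using x N_zero by (intro exI[of _ ?f]) (auto simp: r_neg)
    qed
    define d where "d = (LEAST d. Rel d)"
    have Rel_d: "Rel d" unfolding d_def using Rel_p by (rule LeastI)
    have d_min: "d \<le> k" if "Rel k" for k unfolding d_def using that by (rule Least_le)
    have d_le: "d \<le> p" using d_min[OF Rel_p] .
    have d_pos: "0 < d"
    proof (rule ccontr)
      assume "\<not> 0 < d"
      then have "Rel 0" using Rel_d by simp
      then show False unfolding Rel_def using one by simp
    qed
    have fT: "f i \<in> carrier R" if "range f \<subseteq> T" for f :: "nat \<Rightarrow> 'a" and i using that T_carr by blast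
    \<comment> \<open>Minimality of \<open>d\<close>: a relation of lower degree has a zero
      leading coefficient, for otherwise it could be made monic.\<close>
    have indep: "\<forall>i<n. f i = \<zero>" if "range f \<subseteq> T" "n \<le> d" "horner R n f x \<in> N" for n f
      using that
    proof (induction n)
      case (Suc n)
      have top: "horner R (Suc n) f x = horner R n f x \<oplus> f n \<otimes> x [^] n"
        by (rule horner_Suc_top[OF x fT[OF Suc.prems(1)]])
      have hc: "horner R n f x \<in> carrier R" by (rule horner_closed[OF x fT[OF Suc.prems(1)]])
      have "f n = \<zero>"
      proof (rule ccontr)
        assume nz: "f n \<noteq> \<zero>"
        have fn: "f n \<in> T" using Suc.prems(1) by auto
        let ?c = "inv (f n)"
        have c: "?c \<in> T" "?c \<in> carrier R" "?c \<otimes> f n = \<one>"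
          using T_inv[OF fn nz] T_unit[OF fn nz] by auto
        have "?c \<otimes> (horner R n f x \<oplus> f n \<otimes> x [^] n) \<in> N"
          using N_mult[OF c(2)] Suc.prems(3) top by simp
        also have "?c \<otimes> (horner R n f x \<oplus> f n \<otimes> x [^] n)
            = ?c \<otimes> horner R n f x \<oplus> (?c \<otimes> f n) \<otimes> x [^] n"
          using c(2) hc T_carr[OF fn] x by (simp add: r_distr m_assoc)
        also have "\<dots> = x [^] n \<oplus> horner R n (\<lambda>i. ?c \<otimes> f i) x"
          using horner_scale[where f = f and n = n, OF x fT[OF Suc.prems(1)] c(2)] hc c x
          by (simp add: a_comm)
        finally have "Rel n"
          unfolding Rel_def using c(1) Suc.prems(1) T_ring(6) by (intro exI[of _ "\<lambda>i. ?c \<otimes> f i"]) auto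
        then show False using d_min Suc.prems(2) by fastforce
      qed
      moreover have "horner R n f x \<in> N"
        using Suc.prems(3) calculation hc x unfolding top by simp
      then have "\<forall>i<n. f i = \<zero>" using Suc.IH Suc.prems by simp
      ultimately show ?case using less_Suc_eq by auto
    qed simp
    \<comment> \<open>Membership of the power in \<open>poly_values\<close> says that the new
      element is an exact root of a monic polynomial of degree \<open>d\<close> over
      \<open>T\<close>.\<close>
    have "\<exists>x'. x' \<in> carrier R \<and> x' \<ominus> x \<in> N \<and> x' [^] d \<in> poly_values T d x'"
    proof (cases "d = p")
      case True
      let ?f = "case_nat (x [^] p) (\<lambda>_. \<zero>)"
      have "range ?f \<subseteq> T" using xp T_ring(2) by (auto split: nat.split)
      moreover have "horner R p ?f x = x [^] p"
        using p2 x by (cases p) (auto simp: horner_zero)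
      ultimately have "x [^] d \<in> poly_values T d x"
        unfolding poly_values_def True by (metis (mono_tags, lifting) mem_Collect_eq)
      then show ?thesis using x N_zero by (intro exI[of _ x]) (auto simp: minus_eq r_neg)
    next
      case False
      then have d_less: "d < p" using d_le by simp
      obtain f where f: "range f \<subseteq> T" "x [^] d \<oplus> horner R d f x \<in> N"
        using Rel_d unfolding Rel_def by blast
      define F where "F i = (if i < d then f i else \<one>)" for i
      have F: "range F \<subseteq> T" using f(1) T_ring(3) unfolding F_def by auto
      have F_top: "F d = \<one>" by (simp add: F_def)
      have F_val: "horner R (Suc d) F y = y [^] d \<oplus> horner R d f y" if y: "y \<in> carrier R" for y
      proof -
        have "horner R d F y = horner R d f y" by (rule horner_cong) (simp add: F_def)
        then show ?thesis
          using horner_Suc_top[where f = F and n = d, OF y fT[OF F]]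
            horner_closed[where f = f and n = d, OF y fT[OF f(1)]] y F_top
          by (simp add: a_comm del: horner.simps)
      qed
      define g where "g = horner R (Suc d) F x"
      have g: "g \<in> N" using f(2) F_val[OF x] by (simp add: g_def)
      define \<Delta> where "\<Delta> = horner_deriv R (Suc d) F x"
      have \<Delta>_eq: "\<Delta> = horner R d (\<lambda>i. [Suc i] \<cdot> F (Suc i)) x"
        unfolding \<Delta>_def by (rule horner_deriv_Suc[OF x fT[OF F]])
      have \<Delta>_carr: "\<Delta> \<in> carrier R" unfolding \<Delta>_def by (rule horner_deriv_closed[OF x fT[OF F]])
      \<comment> \<open>The derivative has leading coefficient \<open>d\<close>, which is
        invertible because \<open>0 < d < p\<close>.\<close>
      have "\<Delta> \<notin> N"
      proof
        assume "\<Delta> \<in> N"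
        moreover have "range (\<lambda>i. [Suc i] \<cdot> F (Suc i)) \<subseteq> T"
          using F subring_nat_multiple[OF T(1)] by (auto simp del: add.nat_pow_Suc)
        ultimately have "\<forall>i<d. [Suc i] \<cdot> F (Suc i) = \<zero>"
          using indep[of "\<lambda>i. [Suc i] \<cdot> F (Suc i)" d] \<Delta>_eq by simp
        then have "[Suc (d - 1)] \<cdot> F (Suc (d - 1)) = \<zero>" using d_pos by (metis diff_less zero_less_one)
        then have d0: "[d] \<cdot> \<one> = \<zero>" using d_pos by (simp add: F_def del: add.nat_pow_Suc)
        have "coprime d p" using d_pos d_less p
          by (metis coprime_commute nat_dvd_not_less prime_imp_coprime)
        then obtain a b where ab: "d * a = p * b + 1"
          using bezout_nat[of d p] d_pos by auto
        have "[(p * b + 1)] \<cdot> \<one> = \<one>"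
          using multiple_eq_zero[OF char, of "p * b" \<one>] by (simp add: add.nat_pow_Suc)
        moreover have "[(d * a)] \<cdot> \<one> = \<zero>"
          using multiple_eq_zero[OF d0, of "d * a" \<one>] by simp
        ultimately show False using ab N_zero one by simp
      qed
      then have \<Delta>: "\<Delta> \<in> Units R" using unit \<Delta>_carr by blast
      \<comment> \<open>The Newton correction; it lies in \<open>N\<close>, so its square vanishes
        and one step suffices.\<close>
      define h where "h = \<ominus> (inv \<Delta> \<otimes> g)"
      have h: "h \<in> N" unfolding h_def using \<Delta> g N_mult N_neg by auto
      note hc = N_carr[OF h] and gc = N_carr[OF g]
      obtain q where q: "q \<in> carrier R" "horner R (Suc d) F (x \<oplus> h) = g \<oplus> h \<otimes> \<Delta> \<oplus> h \<otimes> h \<otimes> q"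
        using horner_taylor[where f = F and n = "Suc d", OF x hc fT[OF F]]
        unfolding g_def \<Delta>_def by blast
      have "h \<otimes> \<Delta> = \<ominus> ((inv \<Delta> \<otimes> \<Delta>) \<otimes> g)"
      proof -
        have "\<ominus> (i \<otimes> g) \<otimes> \<Delta> = \<ominus> ((i \<otimes> \<Delta>) \<otimes> g)" if "i \<in> carrier R" for i
          using that gc \<Delta>_carr by algebra
        then show ?thesis using \<Delta> by (simp add: h_def)
      qed
      then have "horner R (Suc d) F (x \<oplus> h) = \<zero>"
        using q sq[OF h h] gc \<Delta> by (simp add: r_neg)
      then have "(x \<oplus> h) [^] d \<oplus> horner R d f (x \<oplus> h) = \<zero>" using F_val hc x by simp
      then have "(x \<oplus> h) [^] d = \<ominus> horner R d f (x \<oplus> h)"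
        using hc x horner_closed[where f = f, OF _ fT[OF f(1)]] by (simp add: minus_equality)
      also have "\<dots> = \<ominus> \<one> \<otimes> horner R d f (x \<oplus> h)"
        using hc x horner_closed[where f = f, OF _ fT[OF f(1)]] by (simp add: l_minus)
      also have "\<dots> = horner R d (\<lambda>i. \<ominus> \<one> \<otimes> f i) (x \<oplus> h)"
        using hc x by (intro horner_scale[symmetric] fT[OF f(1)]) auto
      finally have "(x \<oplus> h) [^] d = horner R d (\<lambda>i. \<ominus> \<one> \<otimes> f i) (x \<oplus> h)" .
      moreover have "range (\<lambda>i. \<ominus> \<one> \<otimes> f i) \<subseteq> T"
        using f(1) T_ring(3,5,6) by auto
      ultimately have "(x \<oplus> h) [^] d \<in> poly_values T d (x \<oplus> h)" unfolding poly_values_def by blast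
      moreover have "x \<oplus> h \<ominus> x = h" using x hc by algebra
      ultimately show ?thesis using x hc h by (intro exI[of _ "x \<oplus> h"]) auto
    qed
    then obtain x' where x': "x' \<in> carrier R" "x' \<ominus> x \<in> N" "x' [^] d \<in> poly_values T d x'" by blast
    note P = poly_values_subring[OF T(1) x'(1) d_pos x'(3)]
    have "poly_values T d x' \<inter> N \<subseteq> {\<zero>}"
    proof clarify
      fix y assume y: "y \<in> poly_values T d x'" "y \<in> N"
      then obtain f where f: "range f \<subseteq> T" "y = horner R d f x'" unfolding poly_values_def by blast
      have diffc: "x \<ominus> x' \<in> carrier R" using x x' by simp
      obtain q where q: "q \<in> carrier R" "horner R d f (x' \<oplus> (x \<ominus> x')) = y \<oplus> (x \<ominus> x') \<otimes> q"
        using horner_diff_multiple[where f = f and n = d, OF x'(1) diffc fT[OF f(1)]] f(2) by blast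
      have "x' \<oplus> (x \<ominus> x') = x" "x \<ominus> x' = \<ominus> (x' \<ominus> x)" using x x'(1) by algebra+
      moreover have "\<ominus> (x' \<ominus> x) \<otimes> q \<in> N"
        using N_mult[OF q(1) N_neg[OF x'(2)]] q(1) x x'(1) by (simp add: m_comm)
      ultimately have "horner R d f x \<in> N" using q(2) y(2) N_add by simp
      then have "\<forall>i<d. f i = \<zero>" using indep[OF f(1) order_refl] by simp
      then have "y = horner R d (\<lambda>_. \<zero>) x'" unfolding f(2) by (intro horner_cong) simp
      then show "y = \<zero>" using horner_zero x'(1) by simp
    qed
    then have "poly_values T d x' = T" using max P T(2) by blast
    then have "x' \<in> T" using P(3) by simp
    moreover have "x \<ominus> x' \<in> N"
    proof -
      have "x \<ominus> x' = \<ominus> (x' \<ominus> x)" using x x'(1) by algebra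
      then show ?thesis using N_neg x'(2) by simp
    qed
    ultimately show False using x_notin by blast
  qed
  moreover have "T \<inter> N = {\<zero>}" using T(3) T_ring(2) N_zero by blast
  ultimately show ?thesis using T(1) by blast
qed

lemma cring_idealI:
  assumes "I \<subseteq> carrier R" "\<zero> \<in> I" "\<And>a b. a \<in> I \<Longrightarrow> b \<in> I \<Longrightarrow> a \<oplus> b \<in> I"
    and mult: "\<And>a x. a \<in> I \<Longrightarrow> x \<in> carrier R \<Longrightarrow> x \<otimes> a \<in> I"
  shows "ideal I R"
proof (rule idealI[OF ring_axioms])
  show "subgroup I (add_monoid R)"
  proof (rule add.subgroupI)
    fix a assume a: "a \<in> I"
    then have "\<ominus> \<one> \<otimes> a \<in> I" using mult by simp
    then show "\<ominus> a \<in> I" using a assms(1) by (auto simp: l_minus subset_iff)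
  qed (use assms in auto)
next
  fix a x assume "a \<in> I" "x \<in> carrier R"
  then show "x \<otimes> a \<in> I" using mult by simp
  then show "a \<otimes> x \<in> I"
    using m_comm[of a x] \<open>a \<in> I\<close> \<open>x \<in> carrier R\<close> assms(1) by auto
qed

text \<open>The form of the preceding theorem in which the chain below uses it: the coefficient
  field of \<open>R / I\<close> is pulled back to \<open>R\<close>.\<close>

lemma coefficient_subring_mod:
  assumes I: "ideal I R" and N: "ideal N R" and IN: "I \<subseteq> N"
    and sq: "\<And>a b. a \<in> N \<Longrightarrow> b \<in> N \<Longrightarrow> a \<otimes> b \<in> I"
    and p: "Factorial_Ring.prime (p::nat)" and char: "[p] \<cdot> \<one> \<in> I"
    and inverse: "\<And>a. a \<in> carrier R \<Longrightarrow> a \<notin> N \<Longrightarrow> \<exists>b\<in>carrier R. \<exists>m\<in>N. a \<otimes> b = \<one> \<oplus> m"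
    and one: "\<one> \<notin> N"
  shows "\<exists>T. subring T R \<and> I \<subseteq> T \<and> T \<inter> N \<subseteq> I \<and> (\<forall>x\<in>carrier R. \<exists>t\<in>T. \<exists>m\<in>N. x = t \<oplus> m)"
proof -
  interpret I: ideal I R by (rule I)
  interpret N: ideal N R by (rule N)
  interpret Q: cring "R Quot I" by (rule I.quotient_is_cring[OF is_cring])
  interpret h: ring_hom_ring R "R Quot I" "(+>) I" by (rule I.rcos_ring_hom_ring)
  let ?h = "(+>) I"
  have N_carr: "a \<in> carrier R" if "a \<in> N" for a using that by (rule N.Icarr)
  note h_eq = I.coset_eq_iff and h_zero = I.coset_eq_zero_iff and h_surj = I.coset_surj
  have h_N: "a \<in> N" if a: "a \<in> carrier R" and im: "?h a \<in> ?h ` N" for a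
  proof -
    obtain m where m: "m \<in> N" "?h a = ?h m" using im by blast
    then have "a \<ominus> m \<in> N" using h_eq[OF a N_carr[OF m(1)]] IN by blast
    then have "a \<ominus> m \<oplus> m \<in> N" using m(1) N.a_closed by blast
    moreover have "a \<ominus> m \<oplus> m = a" using a N_carr[OF m(1)] by algebra
    ultimately show ?thesis by simp
  qed
  have hN: "ideal (?h ` N) (R Quot I)" by (rule ring_ideal_imp_quot_ideal[OF I N])
  have h_mult: "?h (k \<otimes> l) = ?h k \<otimes>\<^bsub>R Quot I\<^esub> ?h l" if "k \<in> carrier R" "l \<in> carrier R" for k l
    using that by simp
  have sq': "a \<otimes>\<^bsub>R Quot I\<^esub> b = \<zero>\<^bsub>R Quot I\<^esub>" if ab: "a \<in> ?h ` N" "b \<in> ?h ` N" for a b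
  proof -
    obtain k l where kl: "k \<in> N" "l \<in> N" "a = ?h k" "b = ?h l" using ab by auto
    then have "?h (k \<otimes> l) = \<zero>\<^bsub>R Quot I\<^esub>" using sq[of k l] h_zero[of "k \<otimes> l"] N_carr by simp
    then show ?thesis using kl N_carr h_mult[of k l] by simp
  qed
  have char': "[p] \<cdot>\<^bsub>R Quot I\<^esub> \<one>\<^bsub>R Quot I\<^esub> = \<zero>\<^bsub>R Quot I\<^esub>"
    using h.hom_nat_multiple_one[of p] char h_zero[of "[p] \<cdot> \<one>"] by simp
  have unit': "a \<in> Units (R Quot I)" if a: "a \<in> carrier (R Quot I)" "a \<notin> ?h ` N" for a
  proof -
    obtain k where k: "k \<in> carrier R" "a = ?h k" using h_surj[OF a(1)] by blast
    then have "k \<notin> N" using a(2) by blast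
    then obtain b m where b: "b \<in> carrier R" "m \<in> N" "k \<otimes> b = \<one> \<oplus> m" using inverse k(1) by blast
    have mc: "m \<in> carrier R" using b(2) N_carr by simp
    \<comment> \<open>An inverse modulo \<open>N\<close> becomes one modulo \<open>I\<close>,
      since \<open>(1 + m) (1 - m) = 1 - m\<^sup>2\<close>.\<close>
    have "k \<otimes> (b \<otimes> (\<one> \<ominus> m)) = (k \<otimes> b) \<otimes> (\<one> \<ominus> m)" using k(1) b(1) mc by (simp add: m_assoc)
    also have "\<dots> = \<one> \<ominus> m \<otimes> m" unfolding b(3) using mc by algebra
    finally have eq: "k \<otimes> (b \<otimes> (\<one> \<ominus> m)) \<ominus> \<one> = \<ominus> (m \<otimes> m)" using mc by simp algebra
    have "?h (k \<otimes> (b \<otimes> (\<one> \<ominus> m))) = ?h \<one>"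
      using k(1) b(1) mc sq[OF b(2,2)] eq by (subst h_eq) (auto simp: I.a_inv_closed)
    then have one': "a \<otimes>\<^bsub>R Quot I\<^esub> ?h (b \<otimes> (\<one> \<ominus> m)) = \<one>\<^bsub>R Quot I\<^esub>"
      using k b(1) mc h_mult[of k "b \<otimes> (\<one> \<ominus> m)"] h.hom_one by simp
    have "?h (b \<otimes> (\<one> \<ominus> m)) \<in> carrier (R Quot I)" using b(1) mc by (intro h.hom_closed) auto
    then show ?thesis using one' a(1) Q.m_comm unfolding Units_def by force
  qed
  have one': "\<one>\<^bsub>R Quot I\<^esub> \<notin> ?h ` N" using h_N[OF one_closed] one h.hom_one by metis
  obtain T' where T': "subring T' (R Quot I)" "T' \<inter> ?h ` N = {\<zero>\<^bsub>R Quot I\<^esub>}"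
    "\<forall>x\<in>carrier (R Quot I). \<exists>t\<in>T'. x \<ominus>\<^bsub>R Quot I\<^esub> t \<in> ?h ` N"
    using Q.square_zero_coefficient_field[OF hN sq' p char' unit' one'] by auto
  note T'_ring = subringE[OF T'(1)]
  define T where "T = {x \<in> carrier R. ?h x \<in> T'}"
  have "subring T R"
  proof (rule subringI)
    show "\<one> \<in> T" using T'_ring(3) h.hom_one by (simp add: T_def)
    fix a assume "a \<in> T"
    then show "\<ominus> a \<in> T" using T'_ring(5) by (simp add: T_def)
  next
    fix a b assume "a \<in> T" "b \<in> T"
    then show "a \<otimes> b \<in> T" "a \<oplus> b \<in> T"
      using T'_ring(6,7) by (simp_all add: T_def)
  qed (auto simp: T_def)
  moreover have "I \<subseteq> T"
  proof
    fix a assume a: "a \<in> I"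
    then have "?h a = \<zero>\<^bsub>R Quot I\<^esub>" using h_zero[OF I.Icarr[OF a]] by simp
    then show "a \<in> T" using T'_ring(2) I.Icarr[OF a] by (simp add: T_def)
  qed
  moreover have "T \<inter> N \<subseteq> I"
  proof clarify
    fix x assume x: "x \<in> T" "x \<in> N"
    then have "?h x \<in> T' \<inter> ?h ` N" by (simp add: T_def)
    then have "?h x = \<zero>\<^bsub>R Quot I\<^esub>" using T'(2) by blast
    then show "x \<in> I" using h_zero[OF N_carr[OF x(2)]] by simp
  qed
  moreover have "\<exists>t\<in>T. \<exists>m\<in>N. x = t \<oplus> m" if x: "x \<in> carrier R" for x
  proof -
    obtain t' where t': "t' \<in> T'" "?h x \<ominus>\<^bsub>R Quot I\<^esub> t' \<in> ?h ` N" 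
      using T'(3)[rule_format, OF h.hom_closed[OF x]] by auto
    have "t' \<in> carrier (R Quot I)" using t'(1) T'_ring(1) by auto
    then obtain t where t: "t \<in> carrier R" "t' = ?h t" using h_surj by auto
    have "?h (x \<ominus> t) \<in> ?h ` N"
    proof -
      have "?h (x \<ominus> t) = ?h x \<ominus>\<^bsub>R Quot I\<^esub> ?h t"
        unfolding minus_eq Q.minus_eq h.hom_a_inv[OF t(1), symmetric]
        using x t(1) by (intro h.hom_add) auto
      then show ?thesis using t'(2) t(2) by simp
    qed
    then have "x \<ominus> t \<in> N" by (rule h_N[rotated]) (use x t(1) in simp)
    moreover have "x = t \<oplus> (x \<ominus> t)" using x t(1) by algebra
    moreover have "t \<in> T" using t t'(1) by (simp add: T_def)
    ultimately show ?thesis by blast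
  qed
  ultimately show ?thesis by blast
qed

end

section \<open>Cohen subrings of complete filtered rings\<close>

lemma nat_multiple_subring: "[(k::nat)] \<cdot>\<^bsub>R\<lparr>carrier := S\<rparr>\<^esub> x = [k] \<cdot>\<^bsub>R\<^esub> x"
  by (simp add: add_pow_def nat_pow_def)

lemma (in ring) subring_trans:
  assumes "subring S R" "subring T (R\<lparr>carrier := S\<rparr>)"
  shows "subring T R"
proof -
  have "ring (R\<lparr>carrier := S\<rparr>)" by (rule subring_is_ring[OF assms(1)])
  then have "ring (R\<lparr>carrier := T\<rparr>)"
    using ring.subring_is_ring[OF _ assms(2)] by simp
  moreover have "T \<subseteq> carrier R" using subringE(1)[OF assms(2)] subringE(1)[OF assms(1)] by auto
  ultimately show ?thesis by (rule ring_incl_imp_subring[rotated])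
qed

text \<open>A filtration by ideals behaving like the powers of the maximal ideal
  \<open>J 1\<close>. The completeness axiom is stated for sequences that converge at the rate of
  the filtration; the limit is then as close to the \<open>r\<close>-th term as the next step
  allows. The last axiom says that elements of high degree are multiples of \<open>p\<close>,
  where dividing by \<open>p\<close> costs the ramification index \<open>e\<close> in degree.\<close>

locale complete_filtered_ring = cring R for R (structure) +
  fixes J :: "nat \<Rightarrow> 'a set" and p e n0 :: nat
  assumes J_ideal: "ideal (J r) R"
    and J_Suc: "J (Suc r) \<subseteq> J r"
    and J_mult: "a \<in> J r \<Longrightarrow> b \<in> J k \<Longrightarrow> a \<otimes> b \<in> J (r + k)"
    and prime_p: "Factorial_Ring.prime p"
    and p_in_J: "[p] \<cdot> \<one> \<in> J 1"
    and one_notin: "\<one> \<notin> J 1"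
    and residue_inverse:
      "a \<in> carrier R \<Longrightarrow> a \<notin> J 1 \<Longrightarrow> \<exists>b\<in>carrier R. \<exists>m\<in>J 1. a \<otimes> b = \<one> \<oplus> m"
    and J_complete:
      "(\<And>r. s r \<in> carrier R) \<Longrightarrow> (\<And>r. s (Suc r) \<ominus> s r \<in> J (Suc r)) \<Longrightarrow>
         \<exists>l\<in>carrier R. \<forall>r. l \<ominus> s r \<in> J (Suc r)"
    and p_cancel: "x \<in> carrier R \<Longrightarrow> [p] \<cdot> \<one> \<otimes> x = \<zero> \<Longrightarrow> x = \<zero>"
    and e_pos: "0 < e"
    and J_eq_p_mult: "n0 \<le> r \<Longrightarrow> y \<in> J (r + e) \<Longrightarrow> \<exists>x\<in>J r. y = [p] \<cdot> \<one> \<otimes> x"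
begin

abbreviation P where "P \<equiv> [p] \<cdot> \<one>"

lemma J_carr: "a \<in> J r \<Longrightarrow> a \<in> carrier R"
  using ideal.Icarr[OF J_ideal] .

lemma J_add: "a \<in> J r \<Longrightarrow> b \<in> J r \<Longrightarrow> a \<oplus> b \<in> J r"
  using additive_subgroup.a_closed[OF ideal.axioms(1)[OF J_ideal]] .

lemma J_neg: "a \<in> J r \<Longrightarrow> \<ominus> a \<in> J r"
  using additive_subgroup.a_inv_closed[OF ideal.axioms(1)[OF J_ideal]] .

lemma J_zero: "\<zero> \<in> J r"
  using additive_subgroup.zero_closed[OF ideal.axioms(1)[OF J_ideal]] .

lemma J_lmult: "a \<in> J r \<Longrightarrow> x \<in> carrier R \<Longrightarrow> x \<otimes> a \<in> J r"
  using ideal.I_l_closed[OF J_ideal] .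

lemma J_mono: "r \<le> s \<Longrightarrow> J s \<subseteq> J r"
  by (rule lift_Suc_antimono_le[of J, OF J_Suc])

definition pJ :: "nat \<Rightarrow> 'a set \<Rightarrow> 'a set" where
  "pJ r S = {P \<otimes> s \<oplus> j | s j. s \<in> S \<and> j \<in> J (Suc (Suc r))}"

text \<open>The \<open>r\<close>-th approximation to a Cohen subring. The condition on products
  says that the maximal ideal of \<open>S\<close> has square zero modulo
  \<open>p S + J\<^sub>r\<^sub>+\<^sub>2\<close>, which is what the construction of the next stage
  consumes.\<close>

definition cohen_stage :: "nat \<Rightarrow> 'a set \<Rightarrow> bool" where
  "cohen_stage r S \<longleftrightarrow> subring S R \<and> J (Suc r) \<subseteq> S \<and>
     (\<forall>a\<in>S \<inter> J 1. \<forall>b\<in>S \<inter> J 1. a \<otimes> b \<in> pJ r S) \<and>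
     (\<forall>x\<in>carrier R. \<exists>s\<in>S. \<exists>m\<in>J 1. x = s \<oplus> m)"

text \<open>\<open>T\<close> is the preimage in \<open>S\<close> of a coefficient field of
  \<open>S / (p S + J\<^sub>r\<^sub>+\<^sub>2)\<close>.\<close>

definition next_stage :: "nat \<Rightarrow> 'a set \<Rightarrow> 'a set \<Rightarrow> bool" where
  "next_stage r S T \<longleftrightarrow> T \<subseteq> S \<and> pJ r S \<subseteq> T \<and> T \<inter> J 1 \<subseteq> pJ r S"

lemma cohen_stage_carrier: "cohen_stage 0 (carrier R)"
  unfolding cohen_stage_def
proof (intro conjI ballI carrier_is_subring)
  fix a b assume "a \<in> carrier R \<inter> J 1" "b \<in> carrier R \<inter> J 1"
  then have "a \<otimes> b \<in> J (1 + 1)" by (intro J_mult) auto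
  then have ab: "a \<otimes> b \<in> J (Suc (Suc 0))" by (simp add: numeral_2_eq_2)
  then have "a \<otimes> b = P \<otimes> \<zero> \<oplus> a \<otimes> b" using J_carr by simp
  then show "a \<otimes> b \<in> pJ 0 (carrier R)" unfolding pJ_def using ab by blast
next
  fix x assume "x \<in> carrier R"
  then show "\<exists>s\<in>carrier R. \<exists>m\<in>J 1. x = s \<oplus> m" using J_zero[of 1] by (intro bexI[of _ x] bexI[of _ \<zero>]) auto
qed (use J_carr in blast)

text \<open>The square-zero condition reproduces itself. The maximal ideal of the new stage
  \<open>T\<close> is contained in \<open>p S + J\<^sub>r\<^sub>+\<^sub>2\<close>; a product of
  two of its elements is \<open>p\<close> times an element of \<open>p S \<subseteq> T\<close>, up
  to terms in \<open>J\<^sub>r\<^sub>+\<^sub>3\<close>.\<close>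

lemma cohen_stage_refine:
  assumes S: "cohen_stage r S"
  shows "\<exists>T. cohen_stage (Suc r) T \<and> next_stage r S T"
proof -
  have S_sub: "subring S R" and JS: "J (Suc r) \<subseteq> S"
    and S_sq: "\<And>a b. a \<in> S \<Longrightarrow> a \<in> J 1 \<Longrightarrow> b \<in> S \<Longrightarrow> b \<in> J 1 \<Longrightarrow> a \<otimes> b \<in> pJ r S"
    and S_surj: "\<And>x. x \<in> carrier R \<Longrightarrow> \<exists>s\<in>S. \<exists>m\<in>J 1. x = s \<oplus> m"
    using S unfolding cohen_stage_def by auto
  note S_ring = subringE[OF S_sub]
  have S_carr: "a \<in> carrier R" if "a \<in> S" for a using that S_ring(1) by blast
  have P_carr: "P \<in> carrier R" by simp
  have P_S: "P \<in> S" using subring_nat_multiple[OF S_sub S_ring(3)] .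
  let ?S = "R\<lparr>carrier := S\<rparr>"
  interpret S: cring ?S using subcring_iff[OF S_ring(1)] subcringI'[OF S_sub] by simp
  let ?I = "pJ r S" and ?N = "S \<inter> J 1"
  have I_intro: "P \<otimes> s \<oplus> j \<in> ?I" if "s \<in> S" "j \<in> J (Suc (Suc r))" for s j
    unfolding pJ_def using that by blast
  have JS2: "J (Suc (Suc r)) \<subseteq> S" using JS J_Suc by blast
  have J_I: "J (Suc (Suc r)) \<subseteq> ?I"
  proof
    fix j assume j: "j \<in> J (Suc (Suc r))"
    have "P \<otimes> \<zero> \<oplus> j \<in> ?I" using I_intro[OF S_ring(2) j] .
    then show "j \<in> ?I" using J_carr[OF j] by simp
  qed
  have P_I: "P \<otimes> s \<in> ?I" if "s \<in> S" for s
    using I_intro[OF that J_zero] S_carr[OF that] by simp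
  have P_mult: "P \<otimes> x \<in> J (Suc k)" if "x \<in> J k" for x k
    using J_mult[OF p_in_J that] by simp
  have I_N: "?I \<subseteq> ?N"
  proof
    fix a assume "a \<in> ?I"
    then obtain s j where sj: "s \<in> S" "j \<in> J (Suc (Suc r))" "a = P \<otimes> s \<oplus> j" unfolding pJ_def by blast
    have "P \<otimes> s \<in> J 1" using J_lmult[OF p_in_J S_carr[OF sj(1)]] m_comm[OF P_carr S_carr[OF sj(1)]] by simp
    moreover have "j \<in> J 1" using sj(2) J_mono[of 1 "Suc (Suc r)"] by auto
    moreover have "P \<otimes> s \<oplus> j \<in> S" using sj JS2 S_ring(6,7) P_S by blast
    ultimately show "a \<in> ?N" using sj(3) J_add by simp
  qed
  have idI: "ideal ?I ?S"
  proof (rule S.cring_idealI)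
    show "?I \<subseteq> carrier ?S" using I_N by auto
    show "\<zero>\<^bsub>?S\<^esub> \<in> ?I" using J_I J_zero by auto
  next
    fix a b assume "a \<in> ?I" "b \<in> ?I"
    then obtain s j s' j' where *: "s \<in> S" "j \<in> J (Suc (Suc r))" "a = P \<otimes> s \<oplus> j"
      "s' \<in> S" "j' \<in> J (Suc (Suc r))" "b = P \<otimes> s' \<oplus> j'" unfolding pJ_def by blast
    have "a \<oplus> b = P \<otimes> (s \<oplus> s') \<oplus> (j \<oplus> j')"
      using *(3,6) S_carr[OF *(1)] S_carr[OF *(4)] J_carr[OF *(2)] J_carr[OF *(5)] P_carr by algebra
    then have "a \<oplus> b \<in> ?I" using I_intro[OF S_ring(7)[OF *(1,4)] J_add[OF *(2,5)]] by simp
    then show "a \<oplus>\<^bsub>?S\<^esub> b \<in> ?I" by simp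
  next
    fix a x assume "a \<in> ?I" and x: "x \<in> carrier ?S"
    then obtain s j where sj: "s \<in> S" "j \<in> J (Suc (Suc r))" "a = P \<otimes> s \<oplus> j" unfolding pJ_def by blast
    have x': "x \<in> S" using x by simp
    have "x \<otimes> a = P \<otimes> (x \<otimes> s) \<oplus> x \<otimes> j"
      using sj(3) S_carr[OF sj(1)] S_carr[OF x'] J_carr[OF sj(2)] P_carr by algebra
    then have "x \<otimes> a \<in> ?I"
      using I_intro[OF S_ring(6)[OF x' sj(1)] J_lmult[OF sj(2) S_carr[OF x']]] by simp
    then show "x \<otimes>\<^bsub>?S\<^esub> a \<in> ?I" by simp
  qed
  have idN: "ideal ?N ?S"
  proof (rule S.cring_idealI)
    show "\<zero>\<^bsub>?S\<^esub> \<in> ?N" using S_ring(2) J_zero by simp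
  qed (auto intro: S_ring(6,7) J_add J_lmult S_carr)
  have inverse: "\<exists>b\<in>carrier ?S. \<exists>m\<in>?N. a \<otimes>\<^bsub>?S\<^esub> b = \<one>\<^bsub>?S\<^esub> \<oplus>\<^bsub>?S\<^esub> m"
    if "a \<in> carrier ?S" "a \<notin> ?N" for a
  proof -
    have a: "a \<in> S" "a \<in> carrier R" "a \<notin> J 1" using that S_carr by auto
    obtain b m where b: "b \<in> carrier R" "m \<in> J 1" "a \<otimes> b = \<one> \<oplus> m"
      using residue_inverse[OF a(2,3)] by blast
    obtain s m' where s: "s \<in> S" "m' \<in> J 1" "b = s \<oplus> m'" using S_surj[OF b(1)] by blast
    let ?m = "m \<oplus> \<ominus> (a \<otimes> m')"
    have m: "?m \<in> J 1" using b s a J_add J_neg J_lmult by blast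
    have eq: "a \<otimes> s = \<one> \<oplus> ?m"
    proof -
      have "a \<otimes> s = a \<otimes> (s \<oplus> m') \<oplus> \<ominus> (a \<otimes> m')"
        using a(2) S_carr[OF s(1)] J_carr[OF s(2)] by algebra
      also have "\<dots> = \<one> \<oplus> m \<oplus> \<ominus> (a \<otimes> m')" using b(3) s(3) by simp
      finally show ?thesis using J_carr[OF b(2)] J_carr[OF s(2)] a(2) by (simp add: a_assoc)
    qed
    have "?m = a \<otimes> s \<oplus> \<ominus> \<one>"
    proof -
      have "?m = \<one> \<oplus> ?m \<oplus> \<ominus> \<one>" using J_carr[OF m] by algebra
      then show ?thesis using eq by simp
    qed
    also have "\<dots> \<in> S" using S_ring(3,5,6,7) a(1) s(1) by blast
    finally show ?thesis using s(1) m eq by auto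
  qed
  have "\<exists>T. subring T ?S \<and> ?I \<subseteq> T \<and> T \<inter> ?N \<subseteq> ?I \<and>
      (\<forall>x\<in>carrier ?S. \<exists>t\<in>T. \<exists>m\<in>?N. x = t \<oplus>\<^bsub>?S\<^esub> m)"
  proof (rule S.coefficient_subring_mod[OF idI idN I_N _ prime_p _ inverse])
    show "[p] \<cdot>\<^bsub>?S\<^esub> \<one>\<^bsub>?S\<^esub> \<in> ?I" using P_I[OF S_ring(3)] by (simp add: nat_multiple_subring)
  qed (use S_sq one_notin in auto)
  then obtain T where T: "subring T ?S" "?I \<subseteq> T" "T \<inter> ?N \<subseteq> ?I"
    "\<forall>x\<in>S. \<exists>t\<in>T. \<exists>m\<in>?N. x = t \<oplus> m" by auto
  have T_sub: "subring T R" by (rule subring_trans[OF S_sub T(1)])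
  have TS: "T \<subseteq> S" using subringE(1)[OF T(1)] by simp
  have TJ: "T \<inter> J 1 \<subseteq> ?I" using TS T(3) by blast
  have T_sq: "a \<otimes> b \<in> pJ (Suc r) T" if ab: "a \<in> T \<inter> J 1" "b \<in> T \<inter> J 1" for a b
  proof -
    have "a \<in> ?I" "b \<in> ?I" using ab TJ by auto
    then obtain s j s' j' where *: "s \<in> S" "j \<in> J (Suc (Suc r))" "a = P \<otimes> s \<oplus> j"
      "s' \<in> S" "j' \<in> J (Suc (Suc r))" "b = P \<otimes> s' \<oplus> j'" unfolding pJ_def by blast
    note c = S_carr[OF *(1)] S_carr[OF *(4)] J_carr[OF *(2)] J_carr[OF *(5)]
    let ?j = "s \<otimes> (P \<otimes> j') \<oplus> s' \<otimes> (P \<otimes> j) \<oplus> j \<otimes> j'"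
    have "a \<otimes> b = P \<otimes> (P \<otimes> (s \<otimes> s')) \<oplus> ?j"
      using *(3,6) c P_carr by algebra
    moreover have "P \<otimes> (s \<otimes> s') \<in> T" using P_I[OF S_ring(6)[OF *(1,4)]] T(2) by auto
    moreover have "?j \<in> J (Suc (Suc (Suc r)))"
    proof -
      have "j \<otimes> j' \<in> J (Suc (Suc r) + Suc (Suc r))" using J_mult *(2,5) by blast
      then have "j \<otimes> j' \<in> J (Suc (Suc (Suc r)))"
        using J_mono[of "Suc (Suc (Suc r))" "Suc (Suc r) + Suc (Suc r)"] by auto
      moreover have "s \<otimes> (P \<otimes> j') \<in> J (Suc (Suc (Suc r)))" using J_lmult[OF P_mult[OF *(5)] c(1)] .
      moreover have "s' \<otimes> (P \<otimes> j) \<in> J (Suc (Suc (Suc r)))" using J_lmult[OF P_mult[OF *(2)] c(2)] .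
      ultimately show ?thesis using J_add by simp
    qed
    ultimately show ?thesis unfolding pJ_def by blast
  qed
  have "cohen_stage (Suc r) T"
    unfolding cohen_stage_def
  proof (intro conjI ballI T_sq T_sub)
    show "J (Suc (Suc r)) \<subseteq> T" using J_I T(2) by blast
    fix x assume "x \<in> carrier R"
    then obtain s m where s: "s \<in> S" "m \<in> J 1" "x = s \<oplus> m" using S_surj by blast
    obtain t m' where t: "t \<in> T" "m' \<in> ?N" "s = t \<oplus> m'" using T(4) s(1) by blast
    have "x = t \<oplus> (m' \<oplus> m)"
      using s(3) t(3) S_carr t(1) TS J_carr[OF s(2)] t(2) by (auto simp: a_assoc)
    then show "\<exists>s\<in>T. \<exists>m\<in>J 1. x = s \<oplus> m" using t J_add s(2) by blast
  qed
  then show ?thesis using TS T(2) TJ unfolding next_stage_def by blast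
qed

text \<open>The intersection \<open>C\<close> of the stages. Each stage is contained in the next
  one up to \<open>J\<^sub>r\<^sub>+\<^sub>1\<close>, so a residue class can be followed down the
  chain and by completeness has a representative in \<open>C\<close>. An element of
  \<open>C\<close> in \<open>J\<^sub>1\<close> lies in
  \<open>p S\<^sub>r + J\<^sub>r\<^sub>+\<^sub>2\<close> for all \<open>r\<close>; for large
  \<open>r\<close> the second summand is divisible by \<open>p\<close> too, and the quotient,
  being unique, lies in all stages.\<close>

theorem cohen_subring:
  "\<exists>C. subring C R \<and> (\<forall>x\<in>carrier R. \<exists>c\<in>C. \<exists>m\<in>J 1. x = c \<oplus> m) \<and>
     (\<forall>c\<in>C \<inter> J 1. \<exists>d\<in>C. c = P \<otimes> d) \<and>
     (\<forall>s. (\<forall>r. s r \<in> C \<and> s (Suc r) \<ominus> s r \<in> J (Suc r)) \<longrightarrow>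
        (\<exists>l\<in>C. \<forall>r. l \<ominus> s r \<in> J (Suc r)))"
proof -
  have "\<exists>S. \<forall>r. cohen_stage r (S r) \<and> next_stage r (S r) (S (Suc r))"
    using cohen_stage_carrier cohen_stage_refine
    by (intro dependent_nat_choice) auto
  then obtain S where stage: "\<And>r. cohen_stage r (S r)" and ref: "\<And>r. next_stage r (S r) (S (Suc r))" by blast
  have ring: "subring (S r) R" and JS: "J (Suc r) \<subseteq> S r"
    and surj: "\<And>x. x \<in> carrier R \<Longrightarrow> \<exists>s\<in>S r. \<exists>m\<in>J 1. x = s \<oplus> m" for r
    using stage[of r] unfolding cohen_stage_def by auto
  have S_Suc: "S (Suc r) \<subseteq> S r" and pS: "pJ r (S r) \<subseteq> S (Suc r)"
    and SJ: "S (Suc r) \<inter> J 1 \<subseteq> pJ r (S r)" for r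
    using ref[of r] unfolding next_stage_def by auto
  have S_carr: "a \<in> carrier R" if "a \<in> S r" for a r using that subringE(1)[OF ring] by blast
  have S_mono: "S s \<subseteq> S r" if "r \<le> s" for r s by (rule lift_Suc_antimono_le[of S, OF S_Suc that])
  have P_carr: "P \<in> carrier R" by simp
  \<comment> \<open>Correct \<open>u\<close> first modulo \<open>J 1\<close>; the error is in
    \<open>p S\<^sub>r\<^sub>-\<^sub>1 + J\<^sub>r\<^sub>+\<^sub>1\<close>, and the factor of
    \<open>p\<close> is handled by induction.\<close>
  have approx: "\<exists>t\<in>S (Suc r). \<exists>j\<in>J (Suc r). u = t \<oplus> j" if "u \<in> S r" for u r
    using that
  proof (induction r arbitrary: u)
    case 0
    then show ?case using surj[OF S_carr[OF 0], of 1] by simp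
  next
    case (Suc r)
    note u = S_carr[OF Suc.prems]
    obtain t m where t: "t \<in> S (Suc (Suc r))" "m \<in> J 1" "u = t \<oplus> m" using surj[OF u] by blast
    note tc = S_carr[OF t(1)] and mc = J_carr[OF t(2)]
    have "m = u \<oplus> \<ominus> t" using t(3) tc mc by algebra
    moreover have "t \<in> S (Suc r)" using t(1) S_Suc by blast
    ultimately have "m \<in> S (Suc r)" using Suc.prems subringE(5,7)[OF ring[of "Suc r"]] by simp
    then obtain s j where s: "s \<in> S r" "j \<in> J (Suc (Suc r))" "m = P \<otimes> s \<oplus> j"
      using SJ[of r] t(2) unfolding pJ_def by blast
    obtain s' j' where s': "s' \<in> S (Suc r)" "j' \<in> J (Suc r)" "s = s' \<oplus> j'" using Suc.IH[OF s(1)] by blast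
    note c = S_carr[OF s'(1)] J_carr[OF s'(2)] J_carr[OF s(2)]
    have "P \<otimes> s' \<oplus> \<zero> \<in> pJ (Suc r) (S (Suc r))" unfolding pJ_def using s'(1) J_zero by blast
    then have "P \<otimes> s' \<in> S (Suc (Suc r))" using pS[of "Suc r"] c P_carr by auto
    then have "t \<oplus> P \<otimes> s' \<in> S (Suc (Suc r))" using t(1) subringE(7)[OF ring] by blast
    moreover have "P \<otimes> j' \<oplus> j \<in> J (Suc (Suc r))" using J_mult[OF p_in_J s'(2)] s(2) J_add by simp
    moreover have "u = (t \<oplus> P \<otimes> s') \<oplus> (P \<otimes> j' \<oplus> j)"
      using t(3) s(3) s'(3) tc c P_carr by algebra
    ultimately show ?case by blast
  qed
  define C where "C = (\<Inter>r. S r)"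
  have C_ring: "subring C R" unfolding C_def using ring by (intro subring_Inter) auto
  have C_S: "c \<in> S r" if "c \<in> C" for c r using that by (simp add: C_def)
  \<comment> \<open>Stages are closed, because
    \<open>J\<^sub>r\<^sub>+\<^sub>1 \<subseteq> S\<^sub>r\<close>.\<close>
  have limit_S: "l \<in> C" if l: "l \<in> carrier R" and "\<And>r. s r \<in> S r" "\<And>r. l \<ominus> s r \<in> J (Suc r)" for l s
  proof -
    have "l \<in> S r" for r
    proof -
      have "l \<ominus> s r \<in> S r" "s r \<in> S r" using that JS[of r] by auto
      then have "l \<ominus> s r \<oplus> s r \<in> S r" using subringE(7)[OF ring] by blast
      moreover have "l \<ominus> s r \<oplus> s r = l" 
      proof -
        have "l \<ominus> x \<oplus> x = l" if "x \<in> carrier R" for x using that l by algebra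
        then show ?thesis using S_carr that(2) by blast
      qed
      ultimately show ?thesis by simp
    qed
    then show ?thesis by (simp add: C_def)
  qed
  have "\<exists>c\<in>C. \<exists>m\<in>J 1. x = c \<oplus> m" if x: "x \<in> carrier R" for x
  proof -
    obtain x0 m0 where x0: "x0 \<in> S 0" "m0 \<in> J 1" "x = x0 \<oplus> m0" using surj[OF x] by blast
    have "\<exists>t. \<forall>r. (t r \<in> S r \<and> (r = 0 \<longrightarrow> t r = x0)) \<and> (\<exists>j\<in>J (Suc r). t r = t (Suc r) \<oplus> j)"
    proof (rule dependent_nat_choice)
      show "\<exists>y. y \<in> S 0 \<and> ((0::nat) = 0 \<longrightarrow> y = x0)" using x0(1) by blast
    qed (use approx in blast)
    then obtain t where t: "t 0 = x0" "\<And>r. t r \<in> S r" "\<And>r. \<exists>j\<in>J (Suc r). t r = t (Suc r) \<oplus> j" by blast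
    have step: "t (Suc r) \<ominus> t r \<in> J (Suc r)" for r
    proof -
      obtain j where j: "j \<in> J (Suc r)" "t r = t (Suc r) \<oplus> j" using t(3) by blast
      have "y \<ominus> (y \<oplus> j) = \<ominus> j" if "y \<in> carrier R" for y using that J_carr[OF j(1)] by algebra
      then show ?thesis using j J_neg S_carr[OF t(2)] by simp
    qed
    obtain l where l: "l \<in> carrier R" "\<forall>r. l \<ominus> t r \<in> J (Suc r)"
      using J_complete[of t, OF S_carr[OF t(2)] step] by blast
    have "l \<in> C" using limit_S[OF l(1) t(2)] l(2) by blast
    moreover have "\<ominus> (l \<ominus> x0) \<oplus> m0 \<in> J 1"
      using l(2) t(1) J_neg[of "l \<ominus> x0" 1] J_add[OF _ x0(2)] by (metis One_nat_def)
    moreover have "x = l \<oplus> (\<ominus> (l \<ominus> x0) \<oplus> m0)"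
      using l(1) S_carr[OF x0(1)] J_carr[OF x0(2)] x0(3) by algebra
    ultimately show ?thesis by blast
  qed
  moreover have "\<exists>d\<in>C. c = P \<otimes> d" if c: "c \<in> C" "c \<in> J 1" for c
  proof -
    have ex: "\<exists>d\<in>S k. c = P \<otimes> d" for k
    proof -
      \<comment> \<open>Far enough that the summand in the filtration is \<open>p\<close> times an
        element of \<open>S k\<close>.\<close>
      let ?r = "n0 + k + e"
      obtain s j where s: "s \<in> S ?r" "j \<in> J (Suc (Suc ?r))" "c = P \<otimes> s \<oplus> j"
        using SJ[of ?r] C_S[OF c(1)] c(2) unfolding pJ_def by blast
      have "j \<in> J (Suc (Suc (n0 + k)) + e)" using s(2) by (simp add: add.commute add.left_commute)
      then obtain j' where j': "j' \<in> J (Suc (Suc (n0 + k)))" "j = P \<otimes> j'"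
        using J_eq_p_mult[of "Suc (Suc (n0 + k))" j] by auto
      have "J (Suc (Suc (n0 + k))) \<subseteq> J (Suc k)" by (rule J_mono) simp
      then have j'_S: "j' \<in> S k" using j'(1) JS[of k] by blast
      have "s \<in> S k" using s(1) S_mono[of k ?r] by auto
      moreover have "c = P \<otimes> (s \<oplus> j')"
        using s(3) j'(2) S_carr[OF s(1)] J_carr[OF j'(1)] by (simp add: r_distr)
      ultimately show ?thesis using j'_S subringE(7)[OF ring] by blast
    qed
    obtain d where d: "d \<in> S 0" "c = P \<otimes> d" using ex by blast
    have "d \<in> S k" for k
    proof -
      obtain d' where d': "d' \<in> S k" "c = P \<otimes> d'" using ex by blast
      note cs = S_carr[OF d(1)] S_carr[OF d'(1)]
      have "P \<otimes> (d \<ominus> d') = P \<otimes> d \<ominus> P \<otimes> d'" using cs P_carr by algebra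
      then have "P \<otimes> (d \<ominus> d') = \<zero>" using d(2) d'(2) cs by (simp add: minus_eq r_neg)
      then have "d \<ominus> d' = \<zero>" using p_cancel cs by simp
      then have "d = d'" using cs by simp
      then show ?thesis using d'(1) by simp
    qed
    then show ?thesis using d(2) by (auto simp: C_def)
  qed
  moreover have "\<exists>l\<in>C. \<forall>r. l \<ominus> s r \<in> J (Suc r)"
    if s: "\<forall>r. s r \<in> C \<and> s (Suc r) \<ominus> s r \<in> J (Suc r)" for s
  proof -
    have "s r \<in> carrier R" for r using s S_carr C_S by blast
    then obtain l where l: "l \<in> carrier R" "\<forall>r. l \<ominus> s r \<in> J (Suc r)"
      using J_complete[of s] s by blast
    have "l \<in> C" using limit_S[OF l(1), of s] l(2) s C_S by blast
    then show ?thesis using l(2) by blast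
  qed
  ultimately show ?thesis using C_ring by blast
qed

end

section \<open>Complete discrete valuation rings\<close>

definition mpow :: "('a, 'm) ring_scheme \<Rightarrow> 'a \<Rightarrow> nat \<Rightarrow> 'a set" where
  "mpow R \<pi> k = {\<pi> [^]\<^bsub>R\<^esub> k \<otimes>\<^bsub>R\<^esub> x | x. x \<in> carrier R}"

lemma (in cring) horner_in_ideal:
  assumes "ideal I R" "x \<in> carrier R" "\<And>i. f i \<in> I"
  shows "horner R n f x \<in> I"
  using assms(3)
proof (induction n arbitrary: f)
  case 0
  then show ?case using additive_subgroup.zero_closed[OF ideal.axioms(1)[OF assms(1)]] by simp
next
  case (Suc n)
  have "horner R n (\<lambda>i. f (Suc i)) x \<in> I" by (rule Suc.IH) (rule Suc.prems)
  then show ?case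
    using Suc.prems[of 0] ideal.I_l_closed[OF assms(1) _ assms(2)]
      additive_subgroup.a_closed[OF ideal.axioms(1)[OF assms(1)]] by simp
qed

lemma (in comm_monoid) Units_if_inverse:
  assumes "x \<in> carrier G" "y \<in> carrier G" "x \<otimes> y = \<one>" shows "x \<in> Units G"
  using assms m_comm[of x y] unfolding Units_def by auto

text \<open>Valuations are expressed by membership in the ideals \<open>I k\<close>; this treats
  zero on the same footing as the other elements.\<close>

locale complete_dvr = domain R for R (structure) +
  fixes \<pi>
  assumes pi_carr [simp]: "\<pi> \<in> carrier R"
    and pi_nonzero: "\<pi> \<noteq> \<zero>"
    and pi_nonunit: "\<pi> \<notin> Units R"
    and pi_decomp: "x \<in> carrier R \<Longrightarrow> x \<noteq> \<zero> \<Longrightarrow> \<exists>k::nat. \<exists>u\<in>Units R. x = \<pi> [^] k \<otimes> u"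
    and pi_complete:
      "(\<And>r. s r \<in> carrier R) \<Longrightarrow> (\<And>r. s (Suc r) \<ominus> s r \<in> mpow R \<pi> (Suc r)) \<Longrightarrow>
         \<exists>l\<in>carrier R. \<forall>r. l \<ominus> s r \<in> mpow R \<pi> (Suc r)"
begin

abbreviation I where "I \<equiv> mpow R \<pi>"

lemma pi_pow_nonzero: "\<pi> [^] (k::nat) \<noteq> \<zero>"
  using pi_nonzero by (induction k) (auto simp: integral_iff)

lemma I_memI: "x \<in> carrier R \<Longrightarrow> \<pi> [^] k \<otimes> x \<in> I k"
  unfolding mpow_def by blast

lemma I_memE:
  assumes "a \<in> I k" obtains x where "x \<in> carrier R" "a = \<pi> [^] k \<otimes> x"
  using assms unfolding mpow_def by blast

lemma I_carr: "a \<in> I k \<Longrightarrow> a \<in> carrier R"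
  unfolding mpow_def by auto

lemma I_0 [simp]: "I 0 = carrier R"
  unfolding mpow_def by force

lemma I_ideal: "ideal (I k) R"
proof (rule cring_idealI)
  show "I k \<subseteq> carrier R" using I_carr by blast
  show "\<zero> \<in> I k" using I_memI[of \<zero> k] by simp
next
  fix a b assume "a \<in> I k" "b \<in> I k"
  then obtain x y where "x \<in> carrier R" "a = \<pi> [^] k \<otimes> x" "y \<in> carrier R" "b = \<pi> [^] k \<otimes> y"
    by (metis I_memE)
  then show "a \<oplus> b \<in> I k" using I_memI[of "x \<oplus> y" k] by (simp add: r_distr)
next
  fix a x assume "a \<in> I k" and x: "x \<in> carrier R"
  then obtain y where y: "y \<in> carrier R" "a = \<pi> [^] k \<otimes> y" by (metis I_memE)
  then have "x \<otimes> a = \<pi> [^] k \<otimes> (x \<otimes> y)" using x by (simp add: m_lcomm)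
  then show "x \<otimes> a \<in> I k" using I_memI x y by simp
qed

lemma I_zero: "\<zero> \<in> I k"
  using additive_subgroup.zero_closed[OF ideal.axioms(1)[OF I_ideal]] .

lemma I_add: "a \<in> I k \<Longrightarrow> b \<in> I k \<Longrightarrow> a \<oplus> b \<in> I k"
  using additive_subgroup.a_closed[OF ideal.axioms(1)[OF I_ideal]] .

lemma I_neg: "a \<in> I k \<Longrightarrow> \<ominus> a \<in> I k"
  using additive_subgroup.a_inv_closed[OF ideal.axioms(1)[OF I_ideal]] .

lemma I_minus: "a \<in> I k \<Longrightarrow> b \<in> I k \<Longrightarrow> a \<ominus> b \<in> I k"
  using I_add I_neg by (simp add: minus_eq)

lemma I_lmult: "a \<in> I k \<Longrightarrow> x \<in> carrier R \<Longrightarrow> x \<otimes> a \<in> I k"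
  using ideal.I_l_closed[OF I_ideal] .

lemma I_rmult: "a \<in> I k \<Longrightarrow> x \<in> carrier R \<Longrightarrow> a \<otimes> x \<in> I k"
  using ideal.I_r_closed[OF I_ideal] .

lemma I_cancel_add: "a \<oplus> b \<in> I k \<Longrightarrow> b \<in> I k \<Longrightarrow> a \<in> carrier R \<Longrightarrow> a \<in> I k"
proof -
  assume *: "a \<oplus> b \<in> I k" "b \<in> I k" "a \<in> carrier R"
  have "a \<oplus> b \<ominus> b \<in> I k" using * I_minus by blast
  moreover have "a \<oplus> b \<ominus> b = a" using *(3) I_carr[OF *(2)] by algebra
  ultimately show ?thesis by simp
qed

lemma I_cancel_minus: "a \<ominus> b \<in> I k \<Longrightarrow> b \<in> I k \<Longrightarrow> a \<in> carrier R \<Longrightarrow> a \<in> I k"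
  using I_cancel_add[of a "\<ominus> b"] I_neg by (simp add: minus_eq)

lemma I_mult: "a \<in> I r \<Longrightarrow> b \<in> I k \<Longrightarrow> a \<otimes> b \<in> I (r + k)"
proof -
  assume "a \<in> I r" "b \<in> I k"
  then obtain x y where xy: "x \<in> carrier R" "a = \<pi> [^] r \<otimes> x" "y \<in> carrier R" "b = \<pi> [^] k \<otimes> y"
    by (metis I_memE)
  have id: "s \<otimes> x \<otimes> (t \<otimes> y) = (s \<otimes> t) \<otimes> (x \<otimes> y)" if "s \<in> carrier R" "t \<in> carrier R" for s t
    using that xy(1,3) by algebra
  then have "a \<otimes> b = \<pi> [^] (r + k) \<otimes> (x \<otimes> y)" unfolding xy(2,4) by (simp add: nat_pow_mult)
  then show ?thesis using I_memI xy by simp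
qed

lemma I_mono: "r \<le> k \<Longrightarrow> I k \<subseteq> I r"
proof
  fix a assume "r \<le> k" "a \<in> I k"
  then obtain x where x: "x \<in> carrier R" "a = \<pi> [^] k \<otimes> x" by (metis I_memE)
  have "\<pi> [^] k = \<pi> [^] r \<otimes> \<pi> [^] (k - r)" using \<open>r \<le> k\<close> by (simp add: nat_pow_mult)
  then have "a = \<pi> [^] r \<otimes> (\<pi> [^] (k - r) \<otimes> x)" using x by (simp add: m_assoc)
  then show "a \<in> I r" using I_memI x by simp
qed

lemma pi_pow_mem_iff: "x \<in> carrier R \<Longrightarrow> \<pi> [^] k \<otimes> x \<in> I (k + j) \<longleftrightarrow> x \<in> I j"
proof
  assume x: "x \<in> carrier R" and "\<pi> [^] k \<otimes> x \<in> I (k + j)"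
  then obtain y where y: "y \<in> carrier R" "\<pi> [^] k \<otimes> x = \<pi> [^] (k + j) \<otimes> y" by (metis I_memE)
  then have "\<pi> [^] k \<otimes> x = \<pi> [^] k \<otimes> (\<pi> [^] j \<otimes> y)" by (simp add: m_assoc flip: nat_pow_mult)
  then have "x = \<pi> [^] j \<otimes> y" using m_lcancel[OF pi_pow_nonzero, of k x "\<pi> [^] j \<otimes> y"] x y by simp
  then show "x \<in> I j" using I_memI y by simp
next
  assume "x \<in> carrier R" "x \<in> I j"
  moreover have "\<pi> [^] k \<in> I k" using I_memI[of \<one> k] by simp
  ultimately show "\<pi> [^] k \<otimes> x \<in> I (k + j)" using I_mult by blast
qed

lemma unit_notin_I: "u \<in> Units R \<Longrightarrow> u \<notin> I (Suc k)"
proof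
  assume u: "u \<in> Units R" and "u \<in> I (Suc k)"
  then obtain x where x: "x \<in> carrier R" "u = \<pi> [^] Suc k \<otimes> x" by (metis I_memE)
  have "\<pi> \<otimes> (\<pi> [^] k \<otimes> x \<otimes> inv u) = \<pi> [^] Suc k \<otimes> x \<otimes> inv u"
    using x(1) u nat_pow_Suc2[OF pi_carr, of k] by (simp add: m_assoc)
  also have "\<dots> = \<one>" using u by (simp only: x(2)[symmetric] Units_r_inv)
  finally have "\<pi> \<otimes> (\<pi> [^] k \<otimes> x \<otimes> inv u) = \<one>" .
  then have "\<pi> \<in> Units R"
    by (rule Units_if_inverse[rotated 2]) (use x(1) u in auto)
  then show False using pi_nonunit by simp
qed

lemma unit_iff: "x \<in> carrier R \<Longrightarrow> x \<in> Units R \<longleftrightarrow> x \<notin> I 1"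
proof
  assume x: "x \<in> carrier R" and n: "x \<notin> I 1"
  then have "x \<noteq> \<zero>" using I_zero by blast
  then obtain k u where ku: "u \<in> Units R" "x = \<pi> [^] (k::nat) \<otimes> u" using pi_decomp[OF x] by blast
  have "k = 0"
  proof (rule ccontr)
    assume "k \<noteq> 0"
    then have "I k \<subseteq> I 1" by (intro I_mono) simp
    then show False using n ku I_memI[of u k] by blast
  qed
  then show "x \<in> Units R" using ku by simp
qed (use unit_notin_I[of x 0] in simp)

lemma exact_mem:
  assumes "x \<in> I k" "x \<notin> I (Suc k)"
  shows "\<exists>u\<in>Units R. x = \<pi> [^] k \<otimes> u"
proof -
  obtain y where y: "y \<in> carrier R" "x = \<pi> [^] k \<otimes> y" using assms(1) by (metis I_memE)
  then have "y \<notin> I 1" using assms(2) pi_pow_mem_iff[of y k 1] by simp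
  then show ?thesis using y unit_iff by blast
qed

lemma pow_unit_exact: "u \<in> Units R \<Longrightarrow> \<pi> [^] k \<otimes> u \<in> I k \<and> \<pi> [^] k \<otimes> u \<notin> I (Suc k)"
  using pi_pow_mem_iff[of u k 1] I_memI[of u k] unit_notin_I[of u 0] Units_closed[of u] by simp

lemma I_separated: "x \<in> carrier R \<Longrightarrow> (\<And>k. x \<in> I k) \<Longrightarrow> x = \<zero>"
  using pi_decomp pow_unit_exact by blast

lemma pow_unit_mem_iff:
  assumes "u \<in> Units R" "x \<in> carrier R"
  shows "\<pi> [^] k \<otimes> u \<otimes> x \<in> I (k + j) \<longleftrightarrow> x \<in> I j"
proof -
  note uc = Units_closed[OF assms(1)]
  have "\<pi> [^] k \<otimes> u \<otimes> x = \<pi> [^] k \<otimes> (u \<otimes> x)" using assms uc by (simp add: m_assoc)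
  then have "\<pi> [^] k \<otimes> u \<otimes> x \<in> I (k + j) \<longleftrightarrow> u \<otimes> x \<in> I j"
    using pi_pow_mem_iff[of "u \<otimes> x" k j] assms uc by simp
  moreover have "u \<otimes> x \<in> I j \<Longrightarrow> x \<in> I j"
  proof -
    assume "u \<otimes> x \<in> I j"
    then have "inv u \<otimes> (u \<otimes> x) \<in> I j" by (rule I_lmult) (use assms in auto)
    moreover have "inv u \<otimes> (u \<otimes> x) = x"
      using m_assoc[of "inv u" u x] assms uc by simp
    ultimately show ?thesis by simp
  qed
  ultimately show ?thesis using I_lmult[of x j u] uc by auto
qed

lemma mem_dvd:
  assumes u: "u \<in> Units R" and y: "y \<in> I (r + k)"
  shows "\<exists>x\<in>I r. y = \<pi> [^] k \<otimes> u \<otimes> x"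
proof -
  obtain z where z: "z \<in> carrier R" "y = \<pi> [^] (r + k) \<otimes> z" using I_memE[OF y] by blast
  have "s \<otimes> u \<otimes> (t \<otimes> (i \<otimes> z)) = (t \<otimes> s) \<otimes> ((u \<otimes> i) \<otimes> z)"
    if "s \<in> carrier R" "t \<in> carrier R" "i \<in> carrier R" for s t i
    using that z(1) Units_closed[OF u] by algebra
  then have "\<pi> [^] k \<otimes> u \<otimes> (\<pi> [^] r \<otimes> (inv u \<otimes> z)) = y"
    unfolding z(2) using u z(1) by (simp add: nat_pow_mult)
  moreover have "\<pi> [^] r \<otimes> (inv u \<otimes> z) \<in> I r" using I_memI u z(1) by simp
  ultimately show ?thesis by metis
qed

text \<open>Two uniformizers differ by a unit. This allows the root found by Newton's method to
  replace the given uniformizer.\<close>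

lemma other_uniformizer:
  assumes "\<rho> \<in> I 1" "\<rho> \<notin> I 2"
  shows "mpow R \<rho> = I" and "complete_dvr R \<rho>"
proof -
  obtain u where u: "u \<in> Units R" "\<rho> = \<pi> \<otimes> u" using exact_mem[of \<rho> 1] assms by (auto simp: numeral_2_eq_2)
  note uc = Units_closed[OF u(1)]
  have pow: "\<rho> [^] k = \<pi> [^] k \<otimes> u [^] k" for k :: nat
    unfolding u(2) using uc by (simp add: nat_pow_distrib)
  have uk: "u [^] k \<in> Units R" for k :: nat using u(1) by (rule Units_pow_closed)
  show eq: "mpow R \<rho> = I"
  proof (intro ext)
    fix k
    show "mpow R \<rho> k = I k"
    proof (intro equalityI subsetI)
      fix a assume "a \<in> mpow R \<rho> k"
      then obtain x where x: "x \<in> carrier R" "a = \<rho> [^] k \<otimes> x" unfolding mpow_def by blast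
      then have "a = \<pi> [^] k \<otimes> (u [^] k \<otimes> x)" using pow uc by (simp add: m_assoc)
      then show "a \<in> I k" using I_memI x(1) uc by simp
    next
      fix a assume "a \<in> I k"
      then obtain x where x: "x \<in> carrier R" "a = \<pi> [^] k \<otimes> x" by (metis I_memE)
      have "\<rho> [^] k \<otimes> (inv (u [^] k) \<otimes> x) = \<pi> [^] k \<otimes> ((u [^] k \<otimes> inv (u [^] k)) \<otimes> x)"
        unfolding pow using uk uc x(1) by (simp add: m_assoc del: Units_r_inv)
      then have "a = \<rho> [^] k \<otimes> (inv (u [^] k) \<otimes> x)" using x uk by simp
      then show "a \<in> mpow R \<rho> k" unfolding mpow_def using x(1) uk by blast
    qed
  qed
  show "complete_dvr R \<rho>"
  proof (unfold_locales)
    show "\<rho> \<in> carrier R" using u uc by simp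
    show "\<rho> \<noteq> \<zero>" using assms(2) I_zero by blast
    show "\<rho> \<notin> Units R" using assms(1) unit_notin_I[of \<rho> 0] by auto
    fix x assume "x \<in> carrier R" "x \<noteq> \<zero>"
    then obtain k v where v: "v \<in> Units R" "x = \<pi> [^] (k::nat) \<otimes> v" using pi_decomp by blast
    have "\<rho> [^] k \<otimes> (inv (u [^] k) \<otimes> v) = \<pi> [^] k \<otimes> ((u [^] k \<otimes> inv (u [^] k)) \<otimes> v)"
      unfolding pow using uk uc Units_closed[OF v(1)] by (simp add: m_assoc del: Units_r_inv)
    then have "x = \<rho> [^] k \<otimes> (inv (u [^] k) \<otimes> v)" using v Units_closed[OF v(1)] uk by simp
    then show "\<exists>k::nat. \<exists>u\<in>Units R. x = \<rho> [^] k \<otimes> u" using uk v(1) by blast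
  qed (use pi_complete eq in auto)
qed

lemma horner_diff_in_I:
  assumes "\<And>i. f i \<in> carrier R" "\<And>i. g i \<in> carrier R" "\<And>i. f i \<ominus> g i \<in> I k" "x \<in> carrier R"
  shows "horner R n f x \<ominus> horner R n g x \<in> I k"
proof -
  let ?h = "\<lambda>i. f i \<ominus> g i"
  have hc: "?h i \<in> carrier R" for i using assms by simp
  have "f = (\<lambda>i. g i \<oplus> ?h i)"
  proof
    fix i
    have "a = b \<oplus> (a \<ominus> b)" if "a \<in> carrier R" "b \<in> carrier R" for a b using that by algebra
    then show "f i = g i \<oplus> ?h i" using assms by blast
  qed
  then have "horner R n f x = horner R n (\<lambda>i. g i \<oplus> ?h i) x" by metis
  also have "\<dots> = horner R n g x \<oplus> horner R n ?h x"
    by (rule horner_add[OF assms(4,2) hc])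
  finally have eq: "horner R n f x = horner R n g x \<oplus> horner R n ?h x" .
  have "a \<oplus> b \<ominus> a = b" if "a \<in> carrier R" "b \<in> carrier R" for a b using that by algebra
  moreover have "horner R n g x \<in> carrier R" "horner R n ?h x \<in> carrier R"
    using horner_closed[OF assms(4), where f = g, OF assms(2)] horner_closed[OF assms(4), where f = ?h, OF hc] by auto
  ultimately have "horner R n f x \<ominus> horner R n g x = horner R n ?h x" unfolding eq by blast
  then show ?thesis using horner_in_ideal[OF I_ideal assms(4), of ?h k n] assms(3) by simp
qed

text \<open>Newton's method from an approximate root. If \<open>f(x)\<close> is in
  \<open>I (n + k)\<close> and \<open>f'(x)\<close> has valuation exactly \<open>\<delta>\<close>,
  the correction has valuation at least \<open>n + k - \<delta> > \<delta>\<close>. Hence the new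
  value, a multiple of the square of the correction, is in \<open>I (n + k + 1)\<close>, and the
  valuation of the derivative does not change.\<close>

lemma newton_root:
  assumes f: "\<And>i. f i \<in> carrier R" and x0: "x0 \<in> carrier R"
    and root: "horner R N f x0 \<in> I n"
    and deriv: "horner_deriv R N f x0 \<in> I \<delta>" "horner_deriv R N f x0 \<notin> I (Suc \<delta>)"
    and n: "2 * \<delta> < n"
  shows "\<exists>x\<in>carrier R. horner R N f x = \<zero> \<and> x \<ominus> x0 \<in> I (n - \<delta>)"
proof -
  define Q where "Q k x \<longleftrightarrow> x \<in> carrier R \<and> horner R N f x \<in> I (n + k) \<and> horner_deriv R N f x \<in> I \<delta> \<and>
      horner_deriv R N f x \<notin> I (Suc \<delta>) \<and> x \<ominus> x0 \<in> I (n - \<delta>)" for k x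
  have "\<exists>s. \<forall>k. Q k (s k) \<and> s (Suc k) \<ominus> s k \<in> I (Suc k)"
  proof (rule dependent_nat_choice)
    show "\<exists>x. Q 0 x"
      using x0 root deriv I_zero by (intro exI[of _ x0]) (simp add: Q_def minus_eq r_neg)
  next
    fix x k assume "Q k x"
    then have x: "x \<in> carrier R" and fx: "horner R N f x \<in> I (n + k)"
      and dx: "horner_deriv R N f x \<in> I \<delta>" "horner_deriv R N f x \<notin> I (Suc \<delta>)"
      and xx0: "x \<ominus> x0 \<in> I (n - \<delta>)" unfolding Q_def by auto
    let ?m = "n + k - \<delta>"
    obtain u where u: "u \<in> Units R" "horner_deriv R N f x = \<pi> [^] \<delta> \<otimes> u" using exact_mem[OF dx] by blast
    obtain a where a: "a \<in> carrier R" "horner R N f x = \<pi> [^] (n + k) \<otimes> a" using I_memE[OF fx] by blast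
    have uc: "u \<in> carrier R" "inv u \<in> carrier R" using u(1) by auto
    define h where "h = \<ominus> (\<pi> [^] ?m \<otimes> (inv u \<otimes> a))"
    have h: "h \<in> I ?m" unfolding h_def using I_neg I_memI uc a by simp
    have hc: "h \<in> carrier R" using I_carr[OF h] .
    have cancel: "horner R N f x \<oplus> h \<otimes> horner_deriv R N f x = \<zero>"
    proof -
      have "s \<otimes> t \<otimes> a \<oplus> \<ominus> (s \<otimes> (i \<otimes> a)) \<otimes> (t \<otimes> u) = s \<otimes> t \<otimes> a \<otimes> (\<one> \<ominus> i \<otimes> u)"
        if "s \<in> carrier R" "t \<in> carrier R" "i \<in> carrier R" for s t i
        using that a(1) uc(1) by algebra
      moreover have "\<pi> [^] (n + k) = \<pi> [^] ?m \<otimes> \<pi> [^] \<delta>" using n by (simp add: nat_pow_mult)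
      ultimately show ?thesis unfolding u(2) a(2) h_def using u(1) uc a(1) by (simp add: minus_eq r_neg)
    qed
    obtain q where q: "q \<in> carrier R"
      "horner R N f (x \<oplus> h) = horner R N f x \<oplus> h \<otimes> horner_deriv R N f x \<oplus> h \<otimes> h \<otimes> q"
      using horner_taylor[where f = f and n = N, OF x hc f] by blast
    obtain q' where q': "q' \<in> carrier R"
      "horner_deriv R N f (x \<oplus> h) = horner_deriv R N f x \<oplus> h \<otimes> q'"
      using horner_deriv_taylor[where f = f and n = N, OF x hc f] by blast
    have "h \<otimes> h \<otimes> q \<in> I (?m + ?m)" using I_rmult[OF I_mult[OF h h] q(1)] .
    moreover have "n + Suc k \<le> ?m + ?m" using n by simp
    ultimately have "h \<otimes> h \<otimes> q \<in> I (n + Suc k)" using I_mono by blast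
    then have new: "horner R N f (x \<oplus> h) \<in> I (n + Suc k)" using q hc cancel by simp
    have "h \<otimes> q' \<in> I ?m" using I_rmult[OF h q'(1)] .
    moreover have "Suc \<delta> \<le> ?m" using n by simp
    ultimately have hq: "h \<otimes> q' \<in> I (Suc \<delta>)" using I_mono by blast
    then have "h \<otimes> q' \<in> I \<delta>" using I_mono[of \<delta> "Suc \<delta>"] by auto
    then have d1: "horner_deriv R N f (x \<oplus> h) \<in> I \<delta>" using q'(2) dx(1) I_add by simp
    have d2: "horner_deriv R N f (x \<oplus> h) \<notin> I (Suc \<delta>)"
      using q'(2) dx(2) hq I_cancel_add I_carr[OF dx(1)] by metis
    have id: "x \<oplus> h \<ominus> x = h" "x \<oplus> h \<ominus> x0 = (x \<ominus> x0) \<oplus> h" using x hc x0 by algebra+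
    have "n - \<delta> \<le> ?m" by simp
    then have "h \<in> I (n - \<delta>)" using h I_mono by blast
    then have "x \<oplus> h \<ominus> x0 \<in> I (n - \<delta>)" using id(2) xx0 I_add by simp
    moreover have "Suc k \<le> ?m" using n by simp
    then have "h \<in> I (Suc k)" using h I_mono by blast
    ultimately show "\<exists>y. Q (Suc k) y \<and> y \<ominus> x \<in> I (Suc k)"
      using x hc new d1 d2 id(1) unfolding Q_def by (intro exI[of _ "x \<oplus> h"]) simp
  qed
  then obtain s where s: "\<And>k. Q k (s k)" "\<And>k. s (Suc k) \<ominus> s k \<in> I (Suc k)" by blast
  have sc: "s k \<in> carrier R" for k using s(1) unfolding Q_def by blast
  obtain l where l: "l \<in> carrier R" "\<And>k. l \<ominus> s k \<in> I (Suc k)"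
    using pi_complete[of s, OF sc s(2)] by blast
  have "horner R N f l \<in> I k" for k
  proof -
    have dc: "l \<ominus> s k \<in> carrier R" using l(1) sc by simp
    obtain q where q: "q \<in> carrier R" "horner R N f (s k \<oplus> (l \<ominus> s k)) = horner R N f (s k) \<oplus> (l \<ominus> s k) \<otimes> q"
      using horner_diff_multiple[where f = f and n = N, OF sc dc f] by blast
    have "a \<oplus> (l \<ominus> a) = l" if "a \<in> carrier R" for a using that l(1) by algebra
    then have eq: "s k \<oplus> (l \<ominus> s k) = l" using sc by blast
    have "l \<ominus> s k \<in> I k" using l(2)[of k] I_mono[of k "Suc k"] by auto
    moreover have "horner R N f (s k) \<in> I k" using s(1)[of k] I_mono[of k "n + k"] unfolding Q_def by auto
    ultimately show ?thesis using q eq I_add I_rmult by metis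
  qed
  then have "horner R N f l = \<zero>" using I_separated horner_closed[where f = f, OF l(1) f] by blast
  moreover have "l \<ominus> x0 \<in> I (n - \<delta>)"
  proof -
    have "n - \<delta> \<le> Suc n" by simp
    then have "l \<ominus> s n \<in> I (n - \<delta>)" using l(2)[of n] I_mono by blast
    moreover have "s n \<ominus> x0 \<in> I (n - \<delta>)" using s(1) unfolding Q_def by blast
    moreover have "l \<ominus> x0 = (l \<ominus> a) \<oplus> (a \<ominus> x0)" if "a \<in> carrier R" for a
      using that l(1) x0 by algebra
    ultimately show ?thesis using I_add sc by metis
  qed
  ultimately show ?thesis using l(1) by blast
qed

end

text \<open>The map \<open>\<alpha>\<close> will be either projection of a subring of a product of
  two discrete valuation rings, and its image a Cohen subring; keeping \<open>C\<close> abstract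
  makes coefficients comparable between the factors. A \<open>p\<close>-adically convergent
  sequence in \<open>C\<close> has a limit as seen through \<open>\<alpha>\<close>.\<close>

locale cohen_dvr = complete_dvr R \<pi> + C: cring C for R (structure) and \<pi> and C (structure) +
  fixes \<alpha> and p e :: nat and v
  assumes alpha_hom: "\<alpha> \<in> ring_hom C R"
    and e_pos: "0 < e" and v_unit: "v \<in> Units R"
    and alpha_p: "\<alpha> ([p] \<cdot>\<^bsub>C\<^esub> \<one>\<^bsub>C\<^esub>) = \<pi> [^] e \<otimes> v"
    and alpha_p_dvd: "c \<in> carrier C \<Longrightarrow> \<alpha> c \<in> mpow R \<pi> 1 \<Longrightarrow> \<exists>d\<in>carrier C. c = [p] \<cdot>\<^bsub>C\<^esub> \<one>\<^bsub>C\<^esub> \<otimes>\<^bsub>C\<^esub> d"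
    and alpha_surj: "x \<in> carrier R \<Longrightarrow> \<exists>c\<in>carrier C. \<exists>m\<in>mpow R \<pi> 1. x = \<alpha> c \<oplus> m"
    and alpha_complete: "(\<And>r. s r \<in> carrier C) \<Longrightarrow>
      (\<And>r. \<exists>d\<in>carrier C. s (Suc r) = s r \<oplus>\<^bsub>C\<^esub> ([p] \<cdot>\<^bsub>C\<^esub> \<one>\<^bsub>C\<^esub>) [^]\<^bsub>C\<^esub> Suc r \<otimes>\<^bsub>C\<^esub> d) \<Longrightarrow>
      \<exists>l\<in>carrier C. \<forall>r. \<alpha> l \<ominus> \<alpha> (s r) \<in> mpow R \<pi> (Suc r)"
begin

sublocale h: ring_hom_cring C R \<alpha>
  by unfold_locales (rule alpha_hom)

abbreviation P where "P \<equiv> [p] \<cdot>\<^bsub>C\<^esub> \<one>\<^bsub>C\<^esub>"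

lemma P_closed [simp]: "P \<in> carrier C" by simp

lemma alpha_carr [simp]: "c \<in> carrier C \<Longrightarrow> \<alpha> c \<in> carrier R" by simp

lemma hom_pow: "c \<in> carrier C \<Longrightarrow> \<alpha> (c [^]\<^bsub>C\<^esub> (k::nat)) = \<alpha> c [^] k"
  by (induction k) auto

text \<open>The coefficients are units or divisible by \<open>\<pi>\<^sup>e\<close>. The constant
  coefficient is a nonunit because all other terms are, so it is divisible by
  \<open>\<pi>\<^sup>e\<close>; it can be removed, and \<open>\<pi>\<close> cancelled from the
  rest.\<close>

lemma horner_p_dvd_aux:
  assumes "\<And>i. f i \<in> carrier C" "n \<le> e" "horner R n (\<lambda>i. \<alpha> (f i)) \<pi> \<in> I n"
  shows "\<forall>i<n. \<exists>d\<in>carrier C. f i = P \<otimes>\<^bsub>C\<^esub> d"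
  using assms
proof (induction n arbitrary: f)
  case (Suc n)
  let ?h = "horner R n (\<lambda>i. \<alpha> (f (Suc i))) \<pi>"
  have hc: "?h \<in> carrier R" using Suc.prems(1) by (intro horner_closed) auto
  have f0: "f 0 \<in> carrier C" by (rule Suc.prems(1))
  have pih: "\<pi> \<otimes> ?h \<in> I 1" using I_memI[OF hc, of 1] by simp
  have sum: "\<alpha> (f 0) \<oplus> \<pi> \<otimes> ?h \<in> I (Suc n)" using Suc.prems(3) by simp
  then have "\<alpha> (f 0) \<oplus> \<pi> \<otimes> ?h \<in> I 1" using I_mono[of 1 "Suc n"] by auto
  then have "\<alpha> (f 0) \<in> I 1" using I_cancel_add pih f0 by simp
  then obtain d where d: "d \<in> carrier C" "f 0 = P \<otimes>\<^bsub>C\<^esub> d" using alpha_p_dvd[OF f0] by blast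
  have "\<alpha> (f 0) = \<pi> [^] e \<otimes> (v \<otimes> \<alpha> d)"
    using d v_unit[THEN Units_closed] alpha_p h.hom_mult[OF P_closed d(1)] by (simp add: m_assoc)
  then have "\<alpha> (f 0) \<in> I e" using I_memI d v_unit[THEN Units_closed] by simp
  then have "\<alpha> (f 0) \<in> I (Suc n)" using I_mono[OF Suc.prems(2)] by auto
  then have "\<pi> \<otimes> ?h \<in> I (Suc n)"
    using I_cancel_add[of "\<pi> \<otimes> ?h" "\<alpha> (f 0)"] sum hc f0 by (simp add: a_comm)
  then have "?h \<in> I n" using pi_pow_mem_iff[OF hc, of 1 n] by simp
  then have "\<forall>i<n. \<exists>d\<in>carrier C. f (Suc i) = P \<otimes>\<^bsub>C\<^esub> d"
    using Suc.IH[of "\<lambda>i. f (Suc i)"] Suc.prems by simp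
  then show ?case using d less_Suc_eq_0_disj by auto
qed simp

text \<open>A factor \<open>p\<close> can be extracted from all coefficients at once and
  cancelled. So the powers \<open>1, \<pi>, \<dots>, \<pi>\<^sup>e\<^sup>-\<^sup>1\<close> form a
  valuation basis over \<open>C\<close>; in particular they are independent.\<close>

lemma horner_p_pow_dvd:
  assumes "\<And>i. f i \<in> carrier C" "horner R e (\<lambda>i. \<alpha> (f i)) \<pi> \<in> I (e * j)"
  shows "\<forall>i<e. \<exists>d\<in>carrier C. f i = P [^]\<^bsub>C\<^esub> j \<otimes>\<^bsub>C\<^esub> d"
  using assms
proof (induction j arbitrary: f)
  case 0
  then show ?case by (auto intro!: bexI)
next
  case (Suc j)
  have "horner R e (\<lambda>i. \<alpha> (f i)) \<pi> \<in> I e" using Suc.prems(2) I_mono[of e "e * Suc j"] by auto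
  then have "\<forall>i<e. \<exists>d\<in>carrier C. f i = P \<otimes>\<^bsub>C\<^esub> d"
    using horner_p_dvd_aux[where f = f, OF Suc.prems(1) order_refl] by simp
  then have "\<forall>i. \<exists>d. d \<in> carrier C \<and> (i < e \<longrightarrow> f i = P \<otimes>\<^bsub>C\<^esub> d)" using C.zero_closed by meson
  then obtain g where g: "\<And>i. g i \<in> carrier C" "\<And>i. i < e \<Longrightarrow> f i = P \<otimes>\<^bsub>C\<^esub> g i" by metis
  let ?g = "\<lambda>i. \<alpha> (g i)"
  have gc: "?g i \<in> carrier R" for i using g by simp
  have "horner R e (\<lambda>i. \<alpha> (f i)) \<pi> = horner R e (\<lambda>i. \<alpha> P \<otimes> ?g i) \<pi>"
  proof (rule horner_cong)
    fix i assume "i < e"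
    then show "\<alpha> (f i) = \<alpha> P \<otimes> ?g i" using h.hom_mult[OF P_closed g(1)] g(2) by simp
  qed
  also have "\<dots> = \<alpha> P \<otimes> horner R e ?g \<pi>" by (rule horner_scale) (use gc in auto)
  finally have "\<pi> [^] e \<otimes> v \<otimes> horner R e ?g \<pi> \<in> I (e + e * j)" using Suc.prems(2) alpha_p by simp
  then have "horner R e ?g \<pi> \<in> I (e * j)"
    using pow_unit_mem_iff[OF v_unit horner_closed[where f = ?g, OF pi_carr gc]] by simp
  then have ih: "\<forall>i<e. \<exists>d\<in>carrier C. g i = P [^]\<^bsub>C\<^esub> j \<otimes>\<^bsub>C\<^esub> d" using Suc.IH[of g] g(1) by simp
  show ?case
  proof (intro allI impI)
    fix i assume i: "i < e"
    then obtain d where d: "d \<in> carrier C" "g i = P [^]\<^bsub>C\<^esub> j \<otimes>\<^bsub>C\<^esub> d" using ih by blast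
    have "f i = P [^]\<^bsub>C\<^esub> Suc j \<otimes>\<^bsub>C\<^esub> d"
      using g(2)[OF i] d by (simp add: C.m_assoc C.m_lcomm C.m_comm)
    then show "\<exists>d\<in>carrier C. f i = P [^]\<^bsub>C\<^esub> Suc j \<otimes>\<^bsub>C\<^esub> d" using d(1) by blast
  qed
qed

lemma expand_aux:
  assumes "x \<in> carrier R"
  shows "\<exists>f. (\<forall>i. f i \<in> carrier C) \<and> (\<exists>y\<in>carrier R. x = horner R n (\<lambda>i. \<alpha> (f i)) \<pi> \<oplus> \<pi> [^] n \<otimes> y)"
  using assms
proof (induction n arbitrary: x)
  case 0
  then show ?case by (intro exI[of _ "\<lambda>_. \<zero>\<^bsub>C\<^esub>"]) (auto intro!: bexI[of _ x])
next
  case (Suc n)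
  obtain c m where c: "c \<in> carrier C" "m \<in> I 1" "x = \<alpha> c \<oplus> m" using alpha_surj[OF Suc.prems] by blast
  obtain x' where x': "x' \<in> carrier R" "m = \<pi> \<otimes> x'" using I_memE[OF c(2)] by auto
  obtain f y where f: "\<forall>i. f i \<in> carrier C" and y: "y \<in> carrier R"
    "x' = horner R n (\<lambda>i. \<alpha> (f i)) \<pi> \<oplus> \<pi> [^] n \<otimes> y" using Suc.IH[OF x'(1)] by blast
  have hc: "horner R n (\<lambda>i. \<alpha> (f i)) \<pi> \<in> carrier R" using f by (intro horner_closed) auto
  have id: "a \<oplus> \<pi> \<otimes> (b \<oplus> t \<otimes> y) = a \<oplus> \<pi> \<otimes> b \<oplus> (t \<otimes> \<pi>) \<otimes> y"
    if "a \<in> carrier R" "b \<in> carrier R" "t \<in> carrier R" for a b t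
    using that y(1) pi_carr by algebra
  have "x = horner R (Suc n) (\<lambda>i. \<alpha> (case_nat c f i)) \<pi> \<oplus> \<pi> [^] Suc n \<otimes> y"
    using c(3) x'(2) y(2) id[OF alpha_carr[OF c(1)] hc, of "\<pi> [^] n"] by simp
  moreover have "\<forall>i. case_nat c f i \<in> carrier C" using c(1) f by (auto split: nat.split)
  ultimately show ?case using y(1) by blast
qed

text \<open>Expanding \<open>x\<close> in \<open>\<pi>\<close> with \<open>e\<close> digits from
  \<open>C\<close> leaves a multiple of \<open>\<pi>\<^sup>e\<close>, hence of \<open>p\<close>.
  Repeating this, the coefficients converge \<open>p\<close>-adically, so
  \<open>1, \<pi>, \<dots>, \<pi>\<^sup>e\<^sup>-\<^sup>1\<close> generate the ring over
  \<open>C\<close>.\<close>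

lemma expand:
  assumes x: "x \<in> carrier R"
  shows "\<exists>f. (\<forall>i. f i \<in> carrier C) \<and> x = horner R e (\<lambda>i. \<alpha> (f i)) \<pi>"
proof -
  have step: "\<exists>g. (\<forall>i. g i \<in> carrier C) \<and> (\<exists>z\<in>carrier R. y = horner R e (\<lambda>i. \<alpha> (g i)) \<pi> \<oplus> \<alpha> P \<otimes> z)"
    if y: "y \<in> carrier R" for y
  proof -
    obtain g z where g: "\<forall>i. g i \<in> carrier C" and z: "z \<in> carrier R"
      "y = horner R e (\<lambda>i. \<alpha> (g i)) \<pi> \<oplus> \<pi> [^] e \<otimes> z" using expand_aux[OF y, of e] by blast
    have "\<alpha> P \<otimes> (inv v \<otimes> z) = \<pi> [^] e \<otimes> ((v \<otimes> inv v) \<otimes> z)"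
      using z(1) v_unit v_unit[THEN Units_closed] unfolding alpha_p
      by (simp add: m_assoc del: Units_r_inv)
    then have "\<alpha> P \<otimes> (inv v \<otimes> z) = \<pi> [^] e \<otimes> z" using v_unit z(1) by simp
    moreover have "inv v \<otimes> z \<in> carrier R" using v_unit z(1) by simp
    ultimately show ?thesis using g z(2) by metis
  qed
  \<comment> \<open>\<open>G\<close> consists of the coefficients found so far and the cofactor of
    \<open>p\<^sup>r\<close> in the remainder.\<close>
  define Q where "Q r G \<longleftrightarrow> (\<forall>i. fst G i \<in> carrier C) \<and> snd G \<in> carrier R \<and>
      x = horner R e (\<lambda>i. \<alpha> (fst G i)) \<pi> \<oplus> \<alpha> P [^] r \<otimes> snd G" for r :: nat and G
  define nxt where "nxt r G H \<longleftrightarrow> (\<forall>i. \<exists>d\<in>carrier C. fst H i = fst G i \<oplus>\<^bsub>C\<^esub> P [^]\<^bsub>C\<^esub> r \<otimes>\<^bsub>C\<^esub> d)"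
    for r :: nat and G H :: "(nat \<Rightarrow> 'c) \<times> 'a"
  have "\<exists>G. \<forall>r. Q r (G r) \<and> nxt r (G r) (G (Suc r))"
  proof (rule dependent_nat_choice)
    show "\<exists>G. Q 0 G"
      using x horner_zero[OF pi_carr, of e]
      by (intro exI[of _ "(\<lambda>_. \<zero>\<^bsub>C\<^esub>, x)"]) (simp add: Q_def)
  next
    fix r G assume "Q r G"
    then have Q: "\<And>i. fst G i \<in> carrier C" "snd G \<in> carrier R"
      "x = horner R e (\<lambda>i. \<alpha> (fst G i)) \<pi> \<oplus> \<alpha> P [^] r \<otimes> snd G" unfolding Q_def by auto
    obtain g z where g: "\<And>i. g i \<in> carrier C" and z: "z \<in> carrier R"
      "snd G = horner R e (\<lambda>i. \<alpha> (g i)) \<pi> \<oplus> \<alpha> P \<otimes> z" using step[OF Q(2)] by blast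
    let ?F = "\<lambda>i. fst G i \<oplus>\<^bsub>C\<^esub> P [^]\<^bsub>C\<^esub> r \<otimes>\<^bsub>C\<^esub> g i"
    let ?q = "\<alpha> P [^] r"
    have qc: "?q \<in> carrier R" by simp
    have aG: "\<alpha> (fst G i) \<in> carrier R" and ag: "\<alpha> (g i) \<in> carrier R" for i using Q(1) g by auto
    have qg: "?q \<otimes> \<alpha> (g i) \<in> carrier R" for i using qc ag by simp
    have "(\<lambda>i. \<alpha> (?F i)) = (\<lambda>i. \<alpha> (fst G i) \<oplus> ?q \<otimes> \<alpha> (g i))"
      using Q(1) g by (intro ext) (simp add: hom_pow)
    then have "horner R e (\<lambda>i. \<alpha> (?F i)) \<pi>
        = horner R e (\<lambda>i. \<alpha> (fst G i)) \<pi> \<oplus> horner R e (\<lambda>i. ?q \<otimes> \<alpha> (g i)) \<pi>"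
      using horner_add[OF pi_carr, where f = "\<lambda>i. \<alpha> (fst G i)" and g = "\<lambda>i. ?q \<otimes> \<alpha> (g i)", OF aG qg] by simp
    also have "horner R e (\<lambda>i. ?q \<otimes> \<alpha> (g i)) \<pi> = ?q \<otimes> horner R e (\<lambda>i. \<alpha> (g i)) \<pi>"
      by (rule horner_scale[OF pi_carr ag qc])
    finally have F: "horner R e (\<lambda>i. \<alpha> (?F i)) \<pi>
        = horner R e (\<lambda>i. \<alpha> (fst G i)) \<pi> \<oplus> ?q \<otimes> horner R e (\<lambda>i. \<alpha> (g i)) \<pi>" .
    have "a \<oplus> q \<otimes> (b \<oplus> t \<otimes> z) = a \<oplus> q \<otimes> b \<oplus> (q \<otimes> t) \<otimes> z"
      if "a \<in> carrier R" "b \<in> carrier R" "t \<in> carrier R" "q \<in> carrier R" for a b t q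
      using that z(1) by algebra
    then have "x = horner R e (\<lambda>i. \<alpha> (?F i)) \<pi> \<oplus> \<alpha> P [^] Suc r \<otimes> z"
      using Q(3) z(2) F horner_closed[OF pi_carr, where f = "\<lambda>i. \<alpha> (fst G i)", OF aG]
        horner_closed[OF pi_carr, where f = "\<lambda>i. \<alpha> (g i)", OF ag] by simp
    then have "Q (Suc r) (?F, z)" unfolding Q_def using Q(1) g z(1) by simp
    moreover have "nxt r G (?F, z)" unfolding nxt_def using g by auto
    ultimately show "\<exists>H. Q (Suc r) H \<and> nxt r G H" by blast
  qed
  then obtain G where G: "\<And>r. Q r (G r)" "\<And>r. nxt r (G r) (G (Suc r))" by blast
  have Gc: "fst (G r) i \<in> carrier C" for r i using G(1) unfolding Q_def by blast
  have "\<exists>l\<in>carrier C. \<forall>r. \<alpha> l \<ominus> \<alpha> (fst (G (Suc r)) i) \<in> I (Suc r)" for i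
  proof (rule alpha_complete)
    fix r
    show "\<exists>d\<in>carrier C. fst (G (Suc (Suc r))) i = fst (G (Suc r)) i \<oplus>\<^bsub>C\<^esub> P [^]\<^bsub>C\<^esub> Suc r \<otimes>\<^bsub>C\<^esub> d"
      using G(2)[of "Suc r"] unfolding nxt_def by blast
  qed (rule Gc)
  then obtain l where l: "\<And>i. l i \<in> carrier C"
    "\<And>i r. \<alpha> (l i) \<ominus> \<alpha> (fst (G (Suc r)) i) \<in> I (Suc r)" by metis
  let ?y = "horner R e (\<lambda>i. \<alpha> (l i)) \<pi>"
  have yc: "?y \<in> carrier R" using l(1) by (intro horner_closed) auto
  have "?y \<ominus> x \<in> I (Suc r)" for r
  proof -
    let ?g = "horner R e (\<lambda>i. \<alpha> (fst (G (Suc r)) i)) \<pi>"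
    have gc: "?g \<in> carrier R" using Gc by (intro horner_closed) auto
    have sc: "snd (G (Suc r)) \<in> carrier R" and xe: "x = ?g \<oplus> \<alpha> P [^] Suc r \<otimes> snd (G (Suc r))"
      using G(1)[of "Suc r"] unfolding Q_def by auto
    have "?y \<ominus> ?g \<in> I (Suc r)"
      by (rule horner_diff_in_I) (use l Gc in auto)
    moreover have "\<alpha> P [^] Suc r \<otimes> snd (G (Suc r)) \<in> I (Suc r)"
    proof -
      have "\<alpha> P \<in> I e" unfolding alpha_p using I_memI v_unit[THEN Units_closed] by simp
      then have P1: "\<alpha> P \<in> I 1" using I_mono[of 1 e] e_pos by auto
      have "\<alpha> P [^] k \<in> I k" for k :: nat
      proof (induction k)
        case (Suc k) then show ?case using I_mult[OF Suc P1] by simp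
      qed simp
      then show ?thesis using I_rmult sc by blast
    qed
    moreover have "?y \<ominus> x = (?y \<ominus> ?g) \<ominus> \<alpha> P [^] Suc r \<otimes> snd (G (Suc r))"
    proof -
      have "a \<ominus> (b \<oplus> c) = (a \<ominus> b) \<ominus> c" if "a \<in> carrier R" "b \<in> carrier R" "c \<in> carrier R" for a b c
        using that by algebra
      moreover have "\<alpha> P [^] Suc r \<otimes> snd (G (Suc r)) \<in> carrier R" using sc by simp
      ultimately show ?thesis using yc gc xe by metis
    qed
    ultimately show ?thesis using I_minus by simp
  qed
  then have "?y \<ominus> x \<in> I k" for k using I_mono[of k "Suc k"] by auto
  then have "?y \<ominus> x = \<zero>" using I_separated yc x by simp
  then have "x = ?y" using yc x by simp
  then show ?thesis using l(1) by blast
qed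

text \<open>Coefficients of the monic polynomial
  \<open>X\<^sup>d - \<Sum> c\<^sub>i X\<^sup>i\<close> are written in \<open>C\<close>, so that
  it can be read in both factors of a product.\<close>

lemma monic_value:
  assumes x: "x \<in> carrier R" and c: "\<And>i. c i \<in> carrier C"
  shows "horner R (Suc d) (\<lambda>i. \<alpha> (if i < d then \<ominus>\<^bsub>C\<^esub> c i else \<one>\<^bsub>C\<^esub>)) x
    = x [^] d \<ominus> horner R d (\<lambda>i. \<alpha> (c i)) x"
proof -
  let ?g = "\<lambda>i. \<alpha> (if i < d then \<ominus>\<^bsub>C\<^esub> c i else \<one>\<^bsub>C\<^esub>)"
  have cc: "\<alpha> (c i) \<in> carrier R" and gc: "?g i \<in> carrier R" for i using c by auto
  have hc: "horner R d (\<lambda>i. \<alpha> (c i)) x \<in> carrier R"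
    by (rule horner_closed[where f = "\<lambda>i. \<alpha> (c i)", OF x cc])
  have "horner R d ?g x = horner R d (\<lambda>i. \<ominus> \<one> \<otimes> \<alpha> (c i)) x"
    by (rule horner_cong) (use cc c h.hom_a_inv in \<open>simp add: l_minus\<close>)
  also have "\<dots> = \<ominus> \<one> \<otimes> horner R d (\<lambda>i. \<alpha> (c i)) x"
    by (rule horner_scale[where f = "\<lambda>i. \<alpha> (c i)", OF x cc]) simp
  also have "\<dots> = \<ominus> horner R d (\<lambda>i. \<alpha> (c i)) x" using hc by (simp add: l_minus)
  finally show ?thesis
    using horner_Suc_top[where f = ?g and n = d, OF x gc] x hc
    by (simp add: minus_eq a_comm del: horner.simps)
qed

end

text \<open>The hypotheses of the locale do not refer to a particular uniformizer, except in the
  shape of \<open>p\<close>.\<close>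

lemma (in complete_dvr) cohen_dvr_at_uniformizer:
  assumes \<rho>: "\<rho> \<in> I 1" "\<rho> \<notin> I 2" and C: "cring C" and hom: "\<alpha> \<in> ring_hom C R" and e: "0 < e"
    and P: "\<alpha> ([p] \<cdot>\<^bsub>C\<^esub> \<one>\<^bsub>C\<^esub>) \<in> I e" "\<alpha> ([p] \<cdot>\<^bsub>C\<^esub> \<one>\<^bsub>C\<^esub>) \<notin> I (Suc e)"
    and dvd: "\<And>c. c \<in> carrier C \<Longrightarrow> \<alpha> c \<in> I 1 \<Longrightarrow> \<exists>d\<in>carrier C. c = [p] \<cdot>\<^bsub>C\<^esub> \<one>\<^bsub>C\<^esub> \<otimes>\<^bsub>C\<^esub> d"
    and surj: "\<And>x. x \<in> carrier R \<Longrightarrow> \<exists>c\<in>carrier C. \<exists>m\<in>I 1. x = \<alpha> c \<oplus> m"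
    and complete: "\<And>s. (\<And>r. s r \<in> carrier C) \<Longrightarrow>
      (\<And>r. \<exists>d\<in>carrier C. s (Suc r) = s r \<oplus>\<^bsub>C\<^esub> ([p] \<cdot>\<^bsub>C\<^esub> \<one>\<^bsub>C\<^esub>) [^]\<^bsub>C\<^esub> Suc r \<otimes>\<^bsub>C\<^esub> d) \<Longrightarrow>
      \<exists>l\<in>carrier C. \<forall>r. \<alpha> l \<ominus> \<alpha> (s r) \<in> I (Suc r)"
  shows "\<exists>v. cohen_dvr R \<rho> C \<alpha> p e v"
proof -
  note eq = other_uniformizer(1)[OF \<rho>]
  interpret X: complete_dvr R \<rho> by (rule other_uniformizer(2)[OF \<rho>])
  obtain v where v: "v \<in> Units R" "\<alpha> ([p] \<cdot>\<^bsub>C\<^esub> \<one>\<^bsub>C\<^esub>) = \<rho> [^] e \<otimes> v"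
    using X.exact_mem[unfolded eq, OF P] by blast
  have "cohen_dvr R \<rho> C \<alpha> p e v"
    by (intro cohen_dvr.intro cohen_dvr_axioms.intro X.complete_dvr_axioms C hom e v)
      (use dvd surj complete in \<open>simp_all add: eq\<close>)
  then show ?thesis by blast
qed

section \<open>Products of rings and graphs of isomorphisms\<close>

lemma RDirProd_simps [simp]:
  "carrier (RDirProd R S) = carrier R \<times> carrier S"
  "(a, b) \<otimes>\<^bsub>RDirProd R S\<^esub> (c, d) = (a \<otimes>\<^bsub>R\<^esub> c, b \<otimes>\<^bsub>S\<^esub> d)"
  "(a, b) \<oplus>\<^bsub>RDirProd R S\<^esub> (c, d) = (a \<oplus>\<^bsub>R\<^esub> c, b \<oplus>\<^bsub>S\<^esub> d)"
  "\<one>\<^bsub>RDirProd R S\<^esub> = (\<one>\<^bsub>R\<^esub>, \<one>\<^bsub>S\<^esub>)" "\<zero>\<^bsub>RDirProd R S\<^esub> = (\<zero>\<^bsub>R\<^esub>, \<zero>\<^bsub>S\<^esub>)"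
  by (auto simp: RDirProd_def DirProd_def monoid.defs)

lemma RDirProd_cring:
  assumes "cring R" "cring S" shows "cring (RDirProd R S)"
proof -
  interpret R: cring R by fact
  interpret S: cring S by fact
  interpret P: ring "RDirProd R S" using RDirProd_ring R.ring_axioms S.ring_axioms by blast
  show ?thesis by unfold_locales (auto simp: R.m_comm S.m_comm)
qed

lemma RDirProd_a_inv:
  assumes "cring R" "cring S" "a \<in> carrier R" "b \<in> carrier S"
  shows "\<ominus>\<^bsub>RDirProd R S\<^esub> (a, b) = (\<ominus>\<^bsub>R\<^esub> a, \<ominus>\<^bsub>S\<^esub> b)"
proof -
  interpret R: cring R by fact
  interpret S: cring S by fact
  interpret P: cring "RDirProd R S" using RDirProd_cring assms by blast
  show ?thesis
    by (rule P.minus_equality) (use assms in \<open>auto simp: R.l_neg S.l_neg\<close>)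
qed

lemma RDirProd_horner:
  "horner (RDirProd R S) n f (x, y) = (horner R n (\<lambda>i. fst (f i)) x, horner S n (\<lambda>i. snd (f i)) y)"
proof (induction n arbitrary: f)
  case (Suc n)
  then show ?case by (cases "f 0") simp
qed simp

lemma RDirProd_nat_multiple: "[(k::nat)] \<cdot>\<^bsub>RDirProd R S\<^esub> (x, y) = ([k] \<cdot>\<^bsub>R\<^esub> x, [k] \<cdot>\<^bsub>S\<^esub> y)"
  by (induction k) (auto simp: add_pow_def nat_pow_def)

lemma subring_RDirProd_minus:
  assumes "cring R" "cring S" "subring D (RDirProd R S)" "(a, b) \<in> D" "(c, d) \<in> D"
  shows "(a, b) \<ominus>\<^bsub>(RDirProd R S)\<lparr>carrier := D\<rparr>\<^esub> (c, d) = (a \<ominus>\<^bsub>R\<^esub> c, b \<ominus>\<^bsub>S\<^esub> d)"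
proof -
  let ?A = "RDirProd R S"
  interpret R: cring R by fact
  interpret S: cring S by fact
  interpret P: cring ?A using RDirProd_cring assms by blast
  interpret D: ring "?A\<lparr>carrier := D\<rparr>" using P.subring_is_ring[OF assms(3)] .
  note DE = subringE[OF assms(3)]
  have c: "a \<in> carrier R" "b \<in> carrier S" "c \<in> carrier R" "d \<in> carrier S" using assms(4,5) DE(1) by auto
  have "\<ominus>\<^bsub>?A\<lparr>carrier := D\<rparr>\<^esub> (c, d) = (\<ominus>\<^bsub>R\<^esub> c, \<ominus>\<^bsub>S\<^esub> d)"
  proof (rule D.minus_equality)
    show "(\<ominus>\<^bsub>R\<^esub> c, \<ominus>\<^bsub>S\<^esub> d) \<in> carrier (?A\<lparr>carrier := D\<rparr>)"
      using DE(5)[OF assms(5)] RDirProd_a_inv[OF assms(1,2) c(3,4)] by simp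
  qed (use assms(5) c in \<open>auto simp: R.l_neg S.l_neg\<close>)
  then show ?thesis by (simp add: D.minus_eq R.minus_eq S.minus_eq)
qed

lemma subring_RDirProd_nat_multiple_one:
  "[(k::nat)] \<cdot>\<^bsub>(RDirProd R S)\<lparr>carrier := D\<rparr>\<^esub> \<one>\<^bsub>(RDirProd R S)\<lparr>carrier := D\<rparr>\<^esub>
    = ([k] \<cdot>\<^bsub>R\<^esub> \<one>\<^bsub>R\<^esub>, [k] \<cdot>\<^bsub>S\<^esub> \<one>\<^bsub>S\<^esub>)"
  by (simp add: nat_multiple_subring RDirProd_nat_multiple)

text \<open>All isomorphisms below are constructed as their graphs; the two kernel conditions make
  the relation single valued in both directions.\<close>

theorem ring_iso_of_graph:
  assumes R: "cring R" and S: "cring S" and G: "subring G (RDirProd R S)"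
    and surj: "fst ` G = carrier R" "snd ` G = carrier S"
    and inj: "\<And>y. (\<zero>\<^bsub>R\<^esub>, y) \<in> G \<Longrightarrow> y = \<zero>\<^bsub>S\<^esub>" "\<And>x. (x, \<zero>\<^bsub>S\<^esub>) \<in> G \<Longrightarrow> x = \<zero>\<^bsub>R\<^esub>"
  shows "\<exists>f\<in>ring_iso R S. \<forall>x\<in>carrier R. (x, f x) \<in> G"
proof -
  interpret R: cring R by fact
  interpret S: cring S by fact
  note GE = subringE[OF G]
  have carr: "x \<in> carrier R \<and> y \<in> carrier S" if "(x, y) \<in> G" for x y using GE(1) that by auto
  have neg: "(\<ominus>\<^bsub>R\<^esub> x, \<ominus>\<^bsub>S\<^esub> y) \<in> G" if "(x, y) \<in> G" for x y
    using GE(5)[OF that] RDirProd_a_inv[OF R S] carr[OF that] by simp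
  have diff: "(x \<ominus>\<^bsub>R\<^esub> x', y \<ominus>\<^bsub>S\<^esub> y') \<in> G" if "(x, y) \<in> G" "(x', y') \<in> G" for x y x' y'
    using GE(7)[OF that(1) neg[OF that(2)]] by (simp add: R.minus_eq S.minus_eq)
  have uniq: "y = y'" if "(x, y) \<in> G" "(x, y') \<in> G" for x y y'
  proof -
    have "(\<zero>\<^bsub>R\<^esub>, y \<ominus>\<^bsub>S\<^esub> y') \<in> G" using diff[OF that] carr[OF that(1)] by (simp add: R.minus_eq R.r_neg)
    then have "y \<ominus>\<^bsub>S\<^esub> y' = \<zero>\<^bsub>S\<^esub>" by (rule inj(1))
    then show ?thesis using carr[OF that(1)] carr[OF that(2)] by simp
  qed
  have uniq': "x = x'" if "(x, y) \<in> G" "(x', y) \<in> G" for x x' y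
  proof -
    have "(x \<ominus>\<^bsub>R\<^esub> x', \<zero>\<^bsub>S\<^esub>) \<in> G" using diff[OF that] carr[OF that(1)] by (simp add: S.minus_eq S.r_neg)
    then have "x \<ominus>\<^bsub>R\<^esub> x' = \<zero>\<^bsub>R\<^esub>" by (rule inj(2))
    then show ?thesis using carr[OF that(1)] carr[OF that(2)] by simp
  qed
  define f where "f x = (SOME y. (x, y) \<in> G)" for x
  have f: "(x, f x) \<in> G" if "x \<in> carrier R" for x
  proof -
    have "x \<in> fst ` G" using that surj(1) by simp
    then have "\<exists>y. (x, y) \<in> G" by force
    then show ?thesis unfolding f_def by (rule someI_ex)
  qed
  have f_eq: "f x = y" if "(x, y) \<in> G" for x y using uniq[OF f that] carr[OF that] by simp
  have "f \<in> ring_iso R S"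
  proof (rule ring_iso_memI)
    fix x assume "x \<in> carrier R" then show "f x \<in> carrier S" using f carr by blast
  next
    fix x y assume xy: "x \<in> carrier R" "y \<in> carrier R"
    show "f (x \<otimes>\<^bsub>R\<^esub> y) = f x \<otimes>\<^bsub>S\<^esub> f y" using GE(6)[OF f[OF xy(1)] f[OF xy(2)]] f_eq by simp
    show "f (x \<oplus>\<^bsub>R\<^esub> y) = f x \<oplus>\<^bsub>S\<^esub> f y" using GE(7)[OF f[OF xy(1)] f[OF xy(2)]] f_eq by simp
  next
    show "f \<one>\<^bsub>R\<^esub> = \<one>\<^bsub>S\<^esub>" using GE(3) f_eq by simp
    show "bij_betw f (carrier R) (carrier S)"
    proof (rule bij_betwI')
      fix x y assume "x \<in> carrier R" "y \<in> carrier R"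
      then show "(f x = f y) = (x = y)" using f uniq' by metis
    next
      fix x assume "x \<in> carrier R" then show "f x \<in> carrier S" using f carr by blast
    next
      fix y assume "y \<in> carrier S"
      then obtain x where "(x, y) \<in> G" using surj(2) by force
      then show "\<exists>x\<in>carrier R. y = f x" using f_eq carr by blast
    qed
  qed
  then show ?thesis using f by blast
qed

text \<open>An isomorphism between the quotients by the \<open>n\<close>-th powers of the maximal
  ideals, given as the set \<open>D\<close> of pairs with corresponding classes. The axioms are
  symmetric in the two rings, so each statement about one of them holds for the other.\<close>

locale dvr_correspondence = R1: complete_dvr R1 \<pi>1 + R2: complete_dvr R2 \<pi>2
  for R1 :: "('a, 'm) ring_scheme" and \<pi>1 and R2 :: "('b, 'l) ring_scheme" and \<pi>2 +
  fixes D :: "('a \<times> 'b) set" and n :: nat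
  assumes D_carr: "(x, y) \<in> D \<Longrightarrow> x \<in> carrier R1 \<and> y \<in> carrier R2"
    and D_one: "(\<one>\<^bsub>R1\<^esub>, \<one>\<^bsub>R2\<^esub>) \<in> D"
    and D_add: "(x, y) \<in> D \<Longrightarrow> (x', y') \<in> D \<Longrightarrow> (x \<oplus>\<^bsub>R1\<^esub> x', y \<oplus>\<^bsub>R2\<^esub> y') \<in> D"
    and D_mult: "(x, y) \<in> D \<Longrightarrow> (x', y') \<in> D \<Longrightarrow> (x \<otimes>\<^bsub>R1\<^esub> x', y \<otimes>\<^bsub>R2\<^esub> y') \<in> D"
    and D_neg: "(x, y) \<in> D \<Longrightarrow> (\<ominus>\<^bsub>R1\<^esub> x, \<ominus>\<^bsub>R2\<^esub> y) \<in> D"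
    and D_total: "x \<in> carrier R1 \<Longrightarrow> \<exists>y. (x, y) \<in> D"
    and D_total': "y \<in> carrier R2 \<Longrightarrow> \<exists>x. (x, y) \<in> D"
    and D_zero: "y \<in> carrier R2 \<Longrightarrow> (\<zero>\<^bsub>R1\<^esub>, y) \<in> D \<longleftrightarrow> y \<in> R2.I n"
    and D_zero': "x \<in> carrier R1 \<Longrightarrow> (x, \<zero>\<^bsub>R2\<^esub>) \<in> D \<longleftrightarrow> x \<in> R1.I n"
    and n_ge: "2 \<le> n"
begin

lemma D_diff: "(x, y) \<in> D \<Longrightarrow> (x', y') \<in> D \<Longrightarrow> (x \<ominus>\<^bsub>R1\<^esub> x', y \<ominus>\<^bsub>R2\<^esub> y') \<in> D"
  using D_add[OF _ D_neg] by (simp add: R1.minus_eq R2.minus_eq)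

lemma D_uniq: "(x, y) \<in> D \<Longrightarrow> (x, y') \<in> D \<Longrightarrow> y \<ominus>\<^bsub>R2\<^esub> y' \<in> R2.I n"
proof -
  assume *: "(x, y) \<in> D" "(x, y') \<in> D"
  have "(\<zero>\<^bsub>R1\<^esub>, y \<ominus>\<^bsub>R2\<^esub> y') \<in> D"
    using D_diff[OF *] D_carr[OF *(1)] by (simp add: R1.minus_eq R1.r_neg)
  then show ?thesis using D_zero D_carr by blast
qed

lemma D_partner_nonunit:
  assumes "(\<pi>1, \<rho>) \<in> D" shows "\<rho> \<in> R2.I 1"
proof (rule ccontr)
  assume "\<rho> \<notin> R2.I 1"
  then have u: "\<rho> \<in> Units R2" using R2.unit_iff D_carr[OF assms] by blast
  obtain w where w: "(w, inv\<^bsub>R2\<^esub> \<rho>) \<in> D" using D_total'[OF R2.Units_inv_closed[OF u]] by blast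
  note wc = D_carr[OF w, THEN conjunct1]
  have "(\<pi>1 \<otimes>\<^bsub>R1\<^esub> w, \<one>\<^bsub>R2\<^esub>) \<in> D" using D_mult[OF assms w] u by simp
  then have "(\<one>\<^bsub>R1\<^esub> \<ominus>\<^bsub>R1\<^esub> \<pi>1 \<otimes>\<^bsub>R1\<^esub> w, \<zero>\<^bsub>R2\<^esub>) \<in> D"
    using D_diff[OF D_one, of "\<pi>1 \<otimes>\<^bsub>R1\<^esub> w" "\<one>\<^bsub>R2\<^esub>"] by (simp add: R2.minus_eq R2.r_neg)
  then have "\<one>\<^bsub>R1\<^esub> \<ominus>\<^bsub>R1\<^esub> \<pi>1 \<otimes>\<^bsub>R1\<^esub> w \<in> R1.I n" using D_zero' wc by simp
  then have "\<one>\<^bsub>R1\<^esub> \<ominus>\<^bsub>R1\<^esub> \<pi>1 \<otimes>\<^bsub>R1\<^esub> w \<in> R1.I 1" using R1.I_mono[of 1 n] n_ge by auto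
  moreover have "\<pi>1 \<otimes>\<^bsub>R1\<^esub> w \<in> R1.I 1" using R1.I_memI[OF wc, of 1] by simp
  ultimately have "\<one>\<^bsub>R1\<^esub> \<in> R1.I 1" using R1.I_cancel_minus by blast
  then show False using R1.unit_notin_I[of "\<one>\<^bsub>R1\<^esub>" 0] by simp
qed

text \<open>The partner of \<open>\<pi>1\<close> is a nonunit, so partners of multiples of
  \<open>\<pi>1\<^sup>k\<close> are in \<open>I k\<close>: correspondence preserves valuations as
  far as they are visible modulo \<open>I n\<close>.\<close>

lemma D_level:
  assumes xy: "(x, y) \<in> D" and k: "k \<le> n" and x: "x \<in> R1.I k"
  shows "y \<in> R2.I k"
proof -
  obtain \<rho> where r: "(\<pi>1, \<rho>) \<in> D" using D_total[OF R1.pi_carr] by blast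
  have r1: "\<rho> \<in> R2.I 1" by (rule D_partner_nonunit[OF r])
  have pow: "(\<pi>1 [^]\<^bsub>R1\<^esub> j, \<rho> [^]\<^bsub>R2\<^esub> j) \<in> D \<and> \<rho> [^]\<^bsub>R2\<^esub> j \<in> R2.I j" for j :: nat
  proof (induction j)
    case 0
    then show ?case using D_one by simp
  next
    case (Suc j)
    then show ?case using D_mult[OF _ r] R2.I_mult[OF _ r1, of _ j] by simp
  qed
  obtain x' where x': "x' \<in> carrier R1" "x = \<pi>1 [^]\<^bsub>R1\<^esub> k \<otimes>\<^bsub>R1\<^esub> x'" using R1.I_memE[OF x] by blast
  obtain y' where y': "(x', y') \<in> D" using D_total[OF x'(1)] by blast
  have "(x, \<rho> [^]\<^bsub>R2\<^esub> k \<otimes>\<^bsub>R2\<^esub> y') \<in> D" using D_mult[OF pow[THEN conjunct1] y'] x'(2) by simp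
  then have "y \<ominus>\<^bsub>R2\<^esub> (\<rho> [^]\<^bsub>R2\<^esub> k \<otimes>\<^bsub>R2\<^esub> y') \<in> R2.I n" by (rule D_uniq[OF xy])
  then have "y \<ominus>\<^bsub>R2\<^esub> (\<rho> [^]\<^bsub>R2\<^esub> k \<otimes>\<^bsub>R2\<^esub> y') \<in> R2.I k" using R2.I_mono[OF k] by auto
  moreover have "\<rho> [^]\<^bsub>R2\<^esub> k \<otimes>\<^bsub>R2\<^esub> y' \<in> R2.I k"
    using R2.I_rmult[OF pow[THEN conjunct2]] D_carr[OF y'] by blast
  ultimately show ?thesis using R2.I_cancel_minus D_carr[OF xy] by blast
qed

lemma swap: "dvr_correspondence R2 \<pi>2 R1 \<pi>1 (D\<inverse>) n"
  by unfold_locales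
    (use D_carr D_one D_add D_mult D_neg D_total D_total' D_zero D_zero' n_ge in auto)

lemma D_level_iff:
  assumes "(x, y) \<in> D" "k \<le> n" shows "x \<in> R1.I k \<longleftrightarrow> y \<in> R2.I k"
  using D_level[OF assms] dvr_correspondence.D_level[OF swap, of y x k] assms by auto

lemma D_subring: "subring D (RDirProd R1 R2)"
proof -
  interpret P: cring "RDirProd R1 R2" by (rule RDirProd_cring[OF R1.is_cring R2.is_cring])
  show ?thesis
  proof (rule P.subringI)
    show "D \<subseteq> carrier (RDirProd R1 R2)" using D_carr by auto
    show "\<one>\<^bsub>RDirProd R1 R2\<^esub> \<in> D" using D_one by simp
    fix a assume "a \<in> D"
    then show "\<ominus>\<^bsub>RDirProd R1 R2\<^esub> a \<in> D"
      using D_neg D_carr RDirProd_a_inv[OF R1.is_cring R2.is_cring] by (cases a) auto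
  next
    fix a b assume "a \<in> D" "b \<in> D"
    then show "a \<otimes>\<^bsub>RDirProd R1 R2\<^esub> b \<in> D" "a \<oplus>\<^bsub>RDirProd R1 R2\<^esub> b \<in> D"
      using D_add D_mult by (cases a; cases b; auto)+
  qed
qed

end

section \<open>The ring of corresponding pairs\<close>

lemma (in complete_dvr) pow_unit_index_unique:
  assumes "u \<in> Units R" "\<pi> [^] (e::nat) \<otimes> u \<in> I k" "\<pi> [^] e \<otimes> u \<notin> I (Suc k)"
  shows "e = k"
proof (rule ccontr)
  assume "e \<noteq> k"
  then consider "Suc e \<le> k" | "Suc k \<le> e" by linarith
  then show False
  proof cases
    case 1
    then show False using pow_unit_exact[OF assms(1), of e] assms(2) I_mono by blast
  next
    case 2
    then show False using pow_unit_exact[OF assms(1), of e] assms(3) I_mono by blast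
  qed
qed

text \<open>An integer prime to \<open>p\<close> is a unit by Bezout, so the valuation of an
  integer is \<open>e\<close> times its \<open>p\<close>-adic valuation.\<close>

lemma (in complete_dvr) p_power_dvd_of_mem:
  assumes p: "Factorial_Ring.prime (p::nat)" and P: "[p] \<cdot> \<one> = \<pi> [^] e \<otimes> u" "u \<in> Units R" "0 < e"
    and k: "[k] \<cdot> \<one> \<in> I (e * j)"
  shows "p ^ j dvd k"
  using k
proof (induction j arbitrary: k)
  case (Suc j)
  have PI: "[p] \<cdot> \<one> \<in> I 1"
    using pow_unit_exact[OF P(2), of e] P(1,3) I_mono[of 1 e] by auto
  have k1: "[k] \<cdot> \<one> \<in> I 1" using Suc.prems I_mono[of 1 "e * Suc j"] P(3) by auto
  have "p dvd k"
  proof (rule ccontr)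
    assume "\<not> p dvd k"
    then have cop: "coprime k p" using prime_imp_coprime[OF p] by (simp add: coprime_commute)
    then have "k \<noteq> 0" using p by (metis coprime_0_left_iff not_prime_unit)
    then obtain a b where ab: "k * a = p * b + 1"
      using bezout_nat[of k p] cop by auto
    have mult: "[(m * l)] \<cdot> \<one> \<in> I 1" if "[m] \<cdot> \<one> \<in> I 1" for m l :: nat
    proof -
      have "[(m * l)] \<cdot> \<one> = [l] \<cdot> ([m] \<cdot> \<one>)" by (simp add: add.nat_pow_pow)
      also have "\<dots> = ([l] \<cdot> \<one>) \<otimes> ([m] \<cdot> \<one>)"
        using add_pow_ldistr[of \<one> "[m] \<cdot> \<one>" l] by simp
      finally show ?thesis using I_lmult[OF that] by simp
    qed
    have "[(p * b)] \<cdot> \<one> \<oplus> \<one> = [(k * a)] \<cdot> \<one>" unfolding ab by (simp add: add.nat_pow_Suc)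
    then have "\<one> \<oplus> [(p * b)] \<cdot> \<one> \<in> I 1" using mult[OF k1] by (simp add: a_comm)
    then have "\<one> \<in> I 1" using I_cancel_add mult[OF PI] by blast
    then show False using unit_notin_I[of \<one> 0] by simp
  qed
  then obtain k' where k': "k = p * k'" by (elim dvdE)
  have "[k] \<cdot> \<one> = [p] \<cdot> ([k'] \<cdot> \<one>)" unfolding k' by (simp add: add.nat_pow_pow mult.commute)
  also have "\<dots> = [p] \<cdot> \<one> \<otimes> [k'] \<cdot> \<one>"
    using add_pow_ldistr[of \<one> "[k'] \<cdot> \<one>" p] by simp
  finally have "\<pi> [^] e \<otimes> u \<otimes> [k'] \<cdot> \<one> \<in> I (e + e * j)" using Suc.prems P(1) by simp
  then have "[k'] \<cdot> \<one> \<in> I (e * j)" using pow_unit_mem_iff[OF P(2)] by simp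
  then have "p ^ j dvd k'" by (rule Suc.IH)
  then show ?case unfolding k' by simp
qed simp

text \<open>The bound on \<open>n\<close> enters twice: it exceeds \<open>e2\<close>, so that the
  ramification index is visible in the quotient, and it exceeds twice the valuation of the
  derivative to which Newton's method is applied.\<close>

locale dvr_lift = dvr_correspondence +
  fixes p e1 e2 :: nat and u1 u2
  assumes prime_p: "Factorial_Ring.prime p"
    and P1: "[p] \<cdot>\<^bsub>R1\<^esub> \<one>\<^bsub>R1\<^esub> = \<pi>1 [^]\<^bsub>R1\<^esub> e1 \<otimes>\<^bsub>R1\<^esub> u1" and u1: "u1 \<in> Units R1"
    and P2: "[p] \<cdot>\<^bsub>R2\<^esub> \<one>\<^bsub>R2\<^esub> = \<pi>2 [^]\<^bsub>R2\<^esub> e2 \<otimes>\<^bsub>R2\<^esub> u2" and u2: "u2 \<in> Units R2"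
    and e1_pos: "0 < e1" and e2_pos: "0 < e2"
    and n_bound: "e2 * (1 + e1\<^sup>2) < n"
begin

abbreviation p1 where "p1 \<equiv> [p] \<cdot>\<^bsub>R1\<^esub> \<one>\<^bsub>R1\<^esub>"
abbreviation p2 where "p2 \<equiv> [p] \<cdot>\<^bsub>R2\<^esub> \<one>\<^bsub>R2\<^esub>"
abbreviation A where "A \<equiv> (RDirProd R1 R2)\<lparr>carrier := D\<rparr>"

sublocale RP: cring "RDirProd R1 R2"
  by (rule RDirProd_cring[OF R1.is_cring R2.is_cring])

sublocale A: cring A
  using RP.subcring_iff[of D] RP.subcringI'[OF D_subring] subringE(1)[OF D_subring] by simp

lemma D_p: "(p1, p2) \<in> D"
  using RP.subring_nat_multiple[OF D_subring, of "(\<one>\<^bsub>R1\<^esub>, \<one>\<^bsub>R2\<^esub>)" p] D_one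
  by (simp add: RDirProd_nat_multiple)

text \<open>Both indices are the valuation of \<open>p\<close>, which correspondence preserves
  below \<open>n\<close>.\<close>

lemma e_eq: "e1 = e2"
proof (rule R1.pow_unit_index_unique[OF u1])
  have "e2 * 1 \<le> e2 * (1 + e1\<^sup>2)" by (intro mult_le_mono2) simp
  then have n: "e2 \<le> n" "Suc e2 \<le> n" using n_bound by auto
  have "p2 \<in> R2.I e2" "p2 \<notin> R2.I (Suc e2)"
    using R2.pow_unit_exact[OF u2, of e2] P2 by auto
  then show "\<pi>1 [^]\<^bsub>R1\<^esub> e1 \<otimes>\<^bsub>R1\<^esub> u1 \<in> R1.I e2" "\<pi>1 [^]\<^bsub>R1\<^esub> e1 \<otimes>\<^bsub>R1\<^esub> u1 \<notin> R1.I (Suc e2)"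
    using D_level_iff[OF D_p n(1)] D_level_iff[OF D_p n(2)] P1 by auto
qed

lemma A_minus: "(a, b) \<in> D \<Longrightarrow> (c, d) \<in> D \<Longrightarrow> (a, b) \<ominus>\<^bsub>A\<^esub> (c, d) = (a \<ominus>\<^bsub>R1\<^esub> c, b \<ominus>\<^bsub>R2\<^esub> d)"
  by (rule subring_RDirProd_minus[OF R1.is_cring R2.is_cring D_subring])

lemma A_p: "[p] \<cdot>\<^bsub>A\<^esub> \<one>\<^bsub>A\<^esub> = (p1, p2)"
  by (rule subring_RDirProd_nat_multiple_one)

definition J :: "nat \<Rightarrow> ('a \<times> 'c) set" where
  "J r = {(x, y). (x, y) \<in> D \<and> x \<in> R1.I r \<and> y \<in> R2.I r}"

lemma J_iff: "(x, y) \<in> J r \<longleftrightarrow> (x, y) \<in> D \<and> x \<in> R1.I r \<and> y \<in> R2.I r"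
  by (simp add: J_def)

lemma p1_mem: "p1 \<in> R1.I e1" and p2_mem: "p2 \<in> R2.I e1"
  using R1.pow_unit_exact[OF u1, of e1] R2.pow_unit_exact[OF u2, of e2] P1 P2 e_eq by auto

lemma D_of_I: "x \<in> R1.I n \<Longrightarrow> y \<in> R2.I n \<Longrightarrow> (x, y) \<in> D"
  using D_add[of x "\<zero>\<^bsub>R2\<^esub>" "\<zero>\<^bsub>R1\<^esub>" y] D_zero[of y] D_zero'[of x] R1.I_carr R2.I_carr by simp

lemma J_level: "(x, y) \<in> D \<Longrightarrow> k \<le> n \<Longrightarrow> x \<in> R1.I k \<or> y \<in> R2.I k \<Longrightarrow> (x, y) \<in> J k"
  using D_level_iff by (auto simp: J_iff)

text \<open>The ring of corresponding pairs with the filtration by valuation. Pairs in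
  \<open>I n \<times> I n\<close> belong to \<open>D\<close>; therefore \<open>D\<close> is closed
  under limits, and pairs of valuation at least \<open>n + e\<close> can be divided by
  \<open>p\<close> inside \<open>D\<close>.\<close>

sublocale F: complete_filtered_ring A J p e1 n
proof (intro complete_filtered_ring.intro complete_filtered_ring_axioms.intro A.is_cring)
  fix r
  show "ideal (J r) A"
  proof (rule A.cring_idealI)
    show "J r \<subseteq> carrier A" by (auto simp: J_def)
    show "\<zero>\<^bsub>A\<^esub> \<in> J r" using A.zero_closed R1.I_zero R2.I_zero by (simp add: J_iff)
  next
    fix a b assume "a \<in> J r" "b \<in> J r"
    then show "a \<oplus>\<^bsub>A\<^esub> b \<in> J r"
      by (cases a; cases b) (auto simp: J_iff D_add R1.I_add R2.I_add)
  next
    fix a x assume "a \<in> J r" "x \<in> carrier A"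
    then show "x \<otimes>\<^bsub>A\<^esub> a \<in> J r"
      using D_carr by (cases a; cases x) (auto simp: J_iff D_mult R1.I_lmult R2.I_lmult)
  qed
  show "J (Suc r) \<subseteq> J r"
    using R1.I_mono[of r "Suc r"] R2.I_mono[of r "Suc r"] by (auto simp: J_def)
next
  fix a b r k assume "a \<in> J r" "b \<in> J k"
  then show "a \<otimes>\<^bsub>A\<^esub> b \<in> J (r + k)"
    by (cases a; cases b) (auto simp: J_iff D_mult R1.I_mult R2.I_mult)
next
  show "Factorial_Ring.prime p" by (rule prime_p)
  show "[p] \<cdot>\<^bsub>A\<^esub> \<one>\<^bsub>A\<^esub> \<in> J 1"
    unfolding A_p using D_p p1_mem p2_mem e1_pos R1.I_mono[of 1 e1] R2.I_mono[of 1 e1]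
    by (auto simp: J_iff)
  show "\<one>\<^bsub>A\<^esub> \<notin> J 1"
    using R1.unit_notin_I[of "\<one>\<^bsub>R1\<^esub>" 0] by (simp add: J_iff)
next
  fix a assume a: "a \<in> carrier A" "a \<notin> J 1"
  obtain x y where xy: "a = (x, y)" "(x, y) \<in> D" using a(1) by (cases a) auto
  have "x \<notin> R1.I 1" using J_level[OF xy(2), of 1] a(2) n_ge xy(1) by auto
  then have u: "x \<in> Units R1" using R1.unit_iff D_carr[OF xy(2)] by blast
  obtain z where z: "(inv\<^bsub>R1\<^esub> x, z) \<in> D" using D_total[OF R1.Units_inv_closed[OF u]] by blast
  have "(x \<otimes>\<^bsub>R1\<^esub> inv\<^bsub>R1\<^esub> x, y \<otimes>\<^bsub>R2\<^esub> z) \<in> D" by (rule D_mult[OF xy(2) z])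
  then have "(\<one>\<^bsub>R1\<^esub>, y \<otimes>\<^bsub>R2\<^esub> z) \<in> D" using u by simp
  from D_diff[OF this D_one] have m: "(\<zero>\<^bsub>R1\<^esub>, y \<otimes>\<^bsub>R2\<^esub> z \<ominus>\<^bsub>R2\<^esub> \<one>\<^bsub>R2\<^esub>) \<in> D"
    by (simp add: R1.minus_eq R1.r_neg)
  have mJ: "(\<zero>\<^bsub>R1\<^esub>, y \<otimes>\<^bsub>R2\<^esub> z \<ominus>\<^bsub>R2\<^esub> \<one>\<^bsub>R2\<^esub>) \<in> J 1"
    using J_level[OF m, of 1] n_ge R1.I_zero by auto
  have yz: "y \<in> carrier R2" "z \<in> carrier R2" using D_carr xy(2) z by blast+
  then have "y \<otimes>\<^bsub>R2\<^esub> z = \<one>\<^bsub>R2\<^esub> \<oplus>\<^bsub>R2\<^esub> (y \<otimes>\<^bsub>R2\<^esub> z \<ominus>\<^bsub>R2\<^esub> \<one>\<^bsub>R2\<^esub>)" by algebra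
  then have "a \<otimes>\<^bsub>A\<^esub> (inv\<^bsub>R1\<^esub> x, z) = \<one>\<^bsub>A\<^esub> \<oplus>\<^bsub>A\<^esub> (\<zero>\<^bsub>R1\<^esub>, y \<otimes>\<^bsub>R2\<^esub> z \<ominus>\<^bsub>R2\<^esub> \<one>\<^bsub>R2\<^esub>)"
    using u xy(1) by simp
  then show "\<exists>b\<in>carrier A. \<exists>m\<in>J 1. a \<otimes>\<^bsub>A\<^esub> b = \<one>\<^bsub>A\<^esub> \<oplus>\<^bsub>A\<^esub> m"
    using z mJ
    by (intro bexI[of _ "(inv\<^bsub>R1\<^esub> x, z)"] bexI[of _ "(\<zero>\<^bsub>R1\<^esub>, y \<otimes>\<^bsub>R2\<^esub> z \<ominus>\<^bsub>R2\<^esub> \<one>\<^bsub>R2\<^esub>)"]) simp_all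
next
  fix s assume s: "\<And>r. s r \<in> carrier A" "\<And>r. s (Suc r) \<ominus>\<^bsub>A\<^esub> s r \<in> J (Suc r)"
  define x where "x r = fst (s r)" for r
  define y where "y r = snd (s r)" for r
  have s_eq: "s r = (x r, y r)" and xyD: "(x r, y r) \<in> D" for r using s(1)[of r] by (auto simp: x_def y_def)
  have diffJ: "(x (Suc r) \<ominus>\<^bsub>R1\<^esub> x r, y (Suc r) \<ominus>\<^bsub>R2\<^esub> y r) \<in> J (Suc r)" for r
    using s(2)[of r] A_minus[OF xyD xyD] by (simp add: s_eq)
  have xc: "x r \<in> carrier R1" and yc: "y r \<in> carrier R2" for r using xyD D_carr by blast+
  obtain l where l: "l \<in> carrier R1" "\<And>r. l \<ominus>\<^bsub>R1\<^esub> x r \<in> R1.I (Suc r)"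
    using R1.pi_complete[of x] xc diffJ by (auto simp: J_iff)
  obtain l' where l': "l' \<in> carrier R2" "\<And>r. l' \<ominus>\<^bsub>R2\<^esub> y r \<in> R2.I (Suc r)"
    using R2.pi_complete[of y] yc diffJ by (auto simp: J_iff)
  have "(l \<ominus>\<^bsub>R1\<^esub> x n, l' \<ominus>\<^bsub>R2\<^esub> y n) \<in> D"
    using l(2)[of n] l'(2)[of n] R1.I_mono[of n "Suc n"] R2.I_mono[of n "Suc n"] by (intro D_of_I) auto
  from D_add[OF this xyD[of n]] have lD: "(l, l') \<in> D"
  proof -
    assume "(l \<ominus>\<^bsub>R1\<^esub> x n \<oplus>\<^bsub>R1\<^esub> x n, l' \<ominus>\<^bsub>R2\<^esub> y n \<oplus>\<^bsub>R2\<^esub> y n) \<in> D"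
    moreover have "l \<ominus>\<^bsub>R1\<^esub> x n \<oplus>\<^bsub>R1\<^esub> x n = l"
      using l(1) xc[of n] by (simp add: R1.minus_eq R1.a_assoc R1.l_neg)
    moreover have "l' \<ominus>\<^bsub>R2\<^esub> y n \<oplus>\<^bsub>R2\<^esub> y n = l'"
      using l'(1) yc[of n] by (simp add: R2.minus_eq R2.a_assoc R2.l_neg)
    ultimately show ?thesis by simp
  qed
  have "(l, l') \<ominus>\<^bsub>A\<^esub> s r \<in> J (Suc r)" for r
    unfolding s_eq A_minus[OF lD xyD] J_iff using D_diff[OF lD xyD] l(2) l'(2) by simp
  then show "\<exists>l\<in>carrier A. \<forall>r. l \<ominus>\<^bsub>A\<^esub> s r \<in> J (Suc r)" using lD by (intro bexI[of _ "(l, l')"]) auto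
next
  fix a assume a: "a \<in> carrier A" "[p] \<cdot>\<^bsub>A\<^esub> \<one>\<^bsub>A\<^esub> \<otimes>\<^bsub>A\<^esub> a = \<zero>\<^bsub>A\<^esub>"
  obtain x y where xy: "a = (x, y)" "x \<in> carrier R1" "y \<in> carrier R2" using a(1) D_carr by (cases a) auto
  have "p1 \<noteq> \<zero>\<^bsub>R1\<^esub>" using R1.pow_unit_exact[OF u1, of e1] P1 R1.I_zero by metis
  moreover have "p2 \<noteq> \<zero>\<^bsub>R2\<^esub>" using R2.pow_unit_exact[OF u2, of e2] P2 R2.I_zero by metis
  moreover have "p1 \<otimes>\<^bsub>R1\<^esub> x = \<zero>\<^bsub>R1\<^esub>" "p2 \<otimes>\<^bsub>R2\<^esub> y = \<zero>\<^bsub>R2\<^esub>" using a(2) unfolding A_p xy(1) by auto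
  ultimately have "x = \<zero>\<^bsub>R1\<^esub>" "y = \<zero>\<^bsub>R2\<^esub>"
    using R1.integral[of p1 x] R2.integral[of p2 y] xy(2,3) by auto
  then show "a = \<zero>\<^bsub>A\<^esub>" using xy(1) by simp
next
  show "0 < e1" by (rule e1_pos)
next
  fix r b assume r: "n \<le> r" and b: "b \<in> J (r + e1)"
  obtain x y where xy: "b = (x, y)" "x \<in> R1.I (r + e1)" "y \<in> R2.I (r + e1)" using b by (auto simp: J_def)
  obtain x' where x': "x' \<in> R1.I r" "x = p1 \<otimes>\<^bsub>R1\<^esub> x'"
    using R1.mem_dvd[OF u1 xy(2)] P1 by auto
  obtain y' where y': "y' \<in> R2.I r" "y = p2 \<otimes>\<^bsub>R2\<^esub> y'"
    using R2.mem_dvd[OF u2, of y r e2] xy(3) P2 e_eq by auto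
  have "(x', y') \<in> D" using x'(1) y'(1) R1.I_mono[OF r] R2.I_mono[OF r] by (intro D_of_I) auto
  then have "(x', y') \<in> J r" using x'(1) y'(1) by (simp add: J_iff)
  moreover have "b = [p] \<cdot>\<^bsub>A\<^esub> \<one>\<^bsub>A\<^esub> \<otimes>\<^bsub>A\<^esub> (x', y')" unfolding A_p using xy(1) x'(2) y'(2) by simp
  ultimately show "\<exists>x\<in>J r. b = [p] \<cdot>\<^bsub>A\<^esub> \<one>\<^bsub>A\<^esub> \<otimes>\<^bsub>A\<^esub> x" by blast
qed

end

section \<open>Lifting a correspondence of residue rings\<close>

lemma nat_pow_subring: "x [^]\<^bsub>R\<lparr>carrier := S\<rparr>\<^esub> (k::nat) = x [^]\<^bsub>R\<^esub> k"
  by (simp add: nat_pow_def)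

lemma (in cring) add_minus_cancel_left: "a \<in> carrier R \<Longrightarrow> b \<in> carrier R \<Longrightarrow> a \<oplus> b \<ominus> a = b"
  by algebra

text \<open>A Cohen subring \<open>C\<close> of the ring of pairs: both projections make it a
  coefficient ring in the sense of \<open>cohen_dvr\<close>.\<close>

locale dvr_lift_cohen = dvr_lift +
  fixes C
  assumes C_sub: "subring C A"
    and C_surj: "a \<in> D \<Longrightarrow> \<exists>c\<in>C. \<exists>m\<in>J 1. a = c \<oplus>\<^bsub>A\<^esub> m"
    and C_dvd: "c \<in> C \<Longrightarrow> c \<in> J 1 \<Longrightarrow> \<exists>d\<in>C. c = [p] \<cdot>\<^bsub>A\<^esub> \<one>\<^bsub>A\<^esub> \<otimes>\<^bsub>A\<^esub> d"
    and C_closed: "(\<And>r. s r \<in> C) \<Longrightarrow> (\<And>r. s (Suc r) \<ominus>\<^bsub>A\<^esub> s r \<in> J (Suc r)) \<Longrightarrow>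
      \<exists>l\<in>C. \<forall>r. l \<ominus>\<^bsub>A\<^esub> s r \<in> J (Suc r)"
begin

abbreviation Cr where "Cr \<equiv> (RDirProd R1 R2)\<lparr>carrier := C\<rparr>"

lemma C_D: "c \<in> C \<Longrightarrow> c \<in> D"
  using subringE(1)[OF C_sub] by auto

lemma C_fst: "c \<in> C \<Longrightarrow> fst c \<in> carrier R1" and C_snd: "c \<in> C \<Longrightarrow> snd c \<in> carrier R2"
  using C_D D_carr by (metis prod.collapse)+

lemma C_subring: "subring C (RDirProd R1 R2)"
  by (rule RP.subring_trans[OF D_subring C_sub])

lemma Cr_cring: "cring Cr"
  using RP.subcring_iff[of C] RP.subcringI'[OF C_subring] subringE(1)[OF C_subring] by simp

lemma Cr_p: "[p] \<cdot>\<^bsub>Cr\<^esub> \<one>\<^bsub>Cr\<^esub> = (p1, p2)"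
  by (rule subring_RDirProd_nat_multiple_one)

lemma p_pow_J: "(p1, p2) [^]\<^bsub>RDirProd R1 R2\<^esub> (k::nat) \<in> J k"
proof (induction k)
  case 0
  then show ?case using D_one by (simp add: J_iff)
next
  case (Suc k)
  have "(p1, p2) \<in> J 1" using F.p_in_J A_p by simp
  then show ?case using F.J_mult[OF Suc, of "(p1, p2)" 1] by simp
qed

lemma p_pow_mult_mem:
  assumes "d \<in> C"
  shows "fst (([p] \<cdot>\<^bsub>Cr\<^esub> \<one>\<^bsub>Cr\<^esub>) [^]\<^bsub>Cr\<^esub> (k::nat) \<otimes>\<^bsub>Cr\<^esub> d) \<in> R1.I k"
    and "snd (([p] \<cdot>\<^bsub>Cr\<^esub> \<one>\<^bsub>Cr\<^esub>) [^]\<^bsub>Cr\<^esub> k \<otimes>\<^bsub>Cr\<^esub> d) \<in> R2.I k"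
proof -
  let ?q = "(p1, p2) [^]\<^bsub>RDirProd R1 R2\<^esub> k"
  have q: "?q \<in> J k" by (rule p_pow_J)
  have "?q \<otimes>\<^bsub>A\<^esub> d \<in> J k"
    using F.J_lmult[OF q, of d] A.m_comm[OF F.J_carr[OF q], of d] C_D[OF assms] by simp
  then have "([p] \<cdot>\<^bsub>Cr\<^esub> \<one>\<^bsub>Cr\<^esub>) [^]\<^bsub>Cr\<^esub> k \<otimes>\<^bsub>Cr\<^esub> d \<in> J k" unfolding Cr_p nat_pow_subring by simp
  then show "fst (([p] \<cdot>\<^bsub>Cr\<^esub> \<one>\<^bsub>Cr\<^esub>) [^]\<^bsub>Cr\<^esub> k \<otimes>\<^bsub>Cr\<^esub> d) \<in> R1.I k"
    and "snd (([p] \<cdot>\<^bsub>Cr\<^esub> \<one>\<^bsub>Cr\<^esub>) [^]\<^bsub>Cr\<^esub> k \<otimes>\<^bsub>Cr\<^esub> d) \<in> R2.I k"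
    unfolding J_def by auto
qed

lemma C_dvd_component:
  assumes "c \<in> C" "fst c \<in> R1.I 1 \<or> snd c \<in> R2.I 1"
  shows "\<exists>d\<in>C. c = [p] \<cdot>\<^bsub>Cr\<^esub> \<one>\<^bsub>Cr\<^esub> \<otimes>\<^bsub>Cr\<^esub> d"
proof -
  have "(fst c, snd c) \<in> J 1"
    using C_D[OF assms(1)] assms(2) n_ge by (intro J_level) auto
  then have "c \<in> J 1" by simp
  then show ?thesis using C_dvd[OF assms(1), unfolded A_p] unfolding Cr_p by simp
qed

lemma C_limit:
  assumes s: "\<And>r. s r \<in> C"
    "\<And>r. \<exists>d\<in>C. s (Suc r) = s r \<oplus>\<^bsub>Cr\<^esub> ([p] \<cdot>\<^bsub>Cr\<^esub> \<one>\<^bsub>Cr\<^esub>) [^]\<^bsub>Cr\<^esub> Suc r \<otimes>\<^bsub>Cr\<^esub> d"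
  shows "\<exists>l\<in>C. \<forall>r. fst l \<ominus>\<^bsub>R1\<^esub> fst (s r) \<in> R1.I (Suc r) \<and> snd l \<ominus>\<^bsub>R2\<^esub> snd (s r) \<in> R2.I (Suc r)"
proof -
  have "s (Suc r) \<ominus>\<^bsub>A\<^esub> s r \<in> J (Suc r)" for r
  proof -
    obtain d where d: "d \<in> C" "s (Suc r) = s r \<oplus>\<^bsub>Cr\<^esub> ([p] \<cdot>\<^bsub>Cr\<^esub> \<one>\<^bsub>Cr\<^esub>) [^]\<^bsub>Cr\<^esub> Suc r \<otimes>\<^bsub>Cr\<^esub> d"
      using s(2) by blast
    let ?q = "(p1, p2) [^]\<^bsub>RDirProd R1 R2\<^esub> Suc r"
    have eq: "s (Suc r) = s r \<oplus>\<^bsub>A\<^esub> ?q \<otimes>\<^bsub>A\<^esub> d" using d(2) unfolding Cr_p nat_pow_subring by simp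
    have q: "?q \<in> J (Suc r)" by (rule p_pow_J)
    have "?q \<otimes>\<^bsub>A\<^esub> d \<in> J (Suc r)"
      using F.J_lmult[OF q, of d] A.m_comm[OF F.J_carr[OF q], of d] C_D[OF d(1)] by simp
    moreover have "s r \<oplus>\<^bsub>A\<^esub> a \<ominus>\<^bsub>A\<^esub> s r = a" if "a \<in> carrier A" for a
    proof -
      have "s r \<in> carrier A" using C_D[OF s(1)] by simp
      then show ?thesis using that by (rule A.add_minus_cancel_left)
    qed
    ultimately show ?thesis using eq F.J_carr by metis
  qed
  then obtain l where l: "l \<in> C" "\<forall>r. l \<ominus>\<^bsub>A\<^esub> s r \<in> J (Suc r)" using C_closed[of s] s(1) by blast
  have "fst l \<ominus>\<^bsub>R1\<^esub> fst (s r) \<in> R1.I (Suc r) \<and> snd l \<ominus>\<^bsub>R2\<^esub> snd (s r) \<in> R2.I (Suc r)" for r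
  proof -
    have "(fst l, snd l) \<ominus>\<^bsub>A\<^esub> (fst (s r), snd (s r)) = (fst l \<ominus>\<^bsub>R1\<^esub> fst (s r), snd l \<ominus>\<^bsub>R2\<^esub> snd (s r))"
      using C_D l(1) s(1) by (intro A_minus) auto
    moreover have "l \<ominus>\<^bsub>A\<^esub> s r \<in> J (Suc r)" using l(2) by blast
    ultimately have "(fst l \<ominus>\<^bsub>R1\<^esub> fst (s r), snd l \<ominus>\<^bsub>R2\<^esub> snd (s r)) \<in> J (Suc r)" by simp
    then show ?thesis by (simp add: J_iff)
  qed
  then show ?thesis using l(1) by blast
qed

lemma cohen_fst:
  assumes \<rho>: "\<rho> \<in> R1.I 1" "\<rho> \<notin> R1.I 2"
  shows "\<exists>v. cohen_dvr R1 \<rho> Cr fst p e1 v"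
proof (rule R1.cohen_dvr_at_uniformizer[OF \<rho> Cr_cring _ e1_pos])
  show "fst \<in> ring_hom Cr R1"
  proof (rule ring_hom_memI)
    fix x y assume "x \<in> carrier Cr" "y \<in> carrier Cr"
    then show "fst (x \<otimes>\<^bsub>Cr\<^esub> y) = fst x \<otimes>\<^bsub>R1\<^esub> fst y" "fst (x \<oplus>\<^bsub>Cr\<^esub> y) = fst x \<oplus>\<^bsub>R1\<^esub> fst y"
      by (cases x; cases y; simp)+
  qed (auto intro: C_fst)
  show "fst ([p] \<cdot>\<^bsub>Cr\<^esub> \<one>\<^bsub>Cr\<^esub>) \<in> R1.I e1" "fst ([p] \<cdot>\<^bsub>Cr\<^esub> \<one>\<^bsub>Cr\<^esub>) \<notin> R1.I (Suc e1)"
    unfolding Cr_p using R1.pow_unit_exact[OF u1, of e1] P1 e_eq by auto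
  fix c assume "c \<in> carrier Cr" "fst c \<in> R1.I 1"
  then show "\<exists>d\<in>carrier Cr. c = [p] \<cdot>\<^bsub>Cr\<^esub> \<one>\<^bsub>Cr\<^esub> \<otimes>\<^bsub>Cr\<^esub> d"
    using C_dvd_component[of c] by simp
next
  fix x assume "x \<in> carrier R1"
  then obtain y where "(x, y) \<in> D" using D_total by blast
  then obtain c m where "c \<in> C" "m \<in> J 1" "(x, y) = c \<oplus>\<^bsub>A\<^esub> m" using C_surj by blast
  then show "\<exists>c\<in>carrier Cr. \<exists>m\<in>R1.I 1. x = fst c \<oplus>\<^bsub>R1\<^esub> m"
    by (cases c; cases m) (force simp: J_iff)
next
  fix s assume "\<And>r. s r \<in> carrier Cr"
    "\<And>r. \<exists>d\<in>carrier Cr. s (Suc r) = s r \<oplus>\<^bsub>Cr\<^esub> ([p] \<cdot>\<^bsub>Cr\<^esub> \<one>\<^bsub>Cr\<^esub>) [^]\<^bsub>Cr\<^esub> Suc r \<otimes>\<^bsub>Cr\<^esub> d"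
  then obtain l where "l \<in> C"
    "\<forall>r. fst l \<ominus>\<^bsub>R1\<^esub> fst (s r) \<in> R1.I (Suc r) \<and> snd l \<ominus>\<^bsub>R2\<^esub> snd (s r) \<in> R2.I (Suc r)"
    using C_limit[of s] by auto
  then show "\<exists>l\<in>carrier Cr. \<forall>r. fst l \<ominus>\<^bsub>R1\<^esub> fst (s r) \<in> R1.I (Suc r)" by auto
qed

lemma cohen_snd:
  assumes \<rho>: "\<rho> \<in> R2.I 1" "\<rho> \<notin> R2.I 2"
  shows "\<exists>v. cohen_dvr R2 \<rho> Cr snd p e1 v"
proof (rule R2.cohen_dvr_at_uniformizer[OF \<rho> Cr_cring _ e1_pos])
  show "snd \<in> ring_hom Cr R2"
  proof (rule ring_hom_memI)
    fix x y assume "x \<in> carrier Cr" "y \<in> carrier Cr"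
    then show "snd (x \<otimes>\<^bsub>Cr\<^esub> y) = snd x \<otimes>\<^bsub>R2\<^esub> snd y" "snd (x \<oplus>\<^bsub>Cr\<^esub> y) = snd x \<oplus>\<^bsub>R2\<^esub> snd y"
      by (cases x; cases y; simp)+
  qed (auto intro: C_snd)
  show "snd ([p] \<cdot>\<^bsub>Cr\<^esub> \<one>\<^bsub>Cr\<^esub>) \<in> R2.I e1" "snd ([p] \<cdot>\<^bsub>Cr\<^esub> \<one>\<^bsub>Cr\<^esub>) \<notin> R2.I (Suc e1)"
    unfolding Cr_p using R2.pow_unit_exact[OF u2, of e1] P2 e_eq by auto
  fix c assume "c \<in> carrier Cr" "snd c \<in> R2.I 1"
  then show "\<exists>d\<in>carrier Cr. c = [p] \<cdot>\<^bsub>Cr\<^esub> \<one>\<^bsub>Cr\<^esub> \<otimes>\<^bsub>Cr\<^esub> d"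
    using C_dvd_component[of c] by simp
next
  fix y assume "y \<in> carrier R2"
  then obtain x where "(x, y) \<in> D" using D_total' by blast
  then obtain c m where "c \<in> C" "m \<in> J 1" "(x, y) = c \<oplus>\<^bsub>A\<^esub> m" using C_surj by blast
  then show "\<exists>c\<in>carrier Cr. \<exists>m\<in>R2.I 1. y = snd c \<oplus>\<^bsub>R2\<^esub> m"
    by (cases c; cases m) (force simp: J_iff)
next
  fix s assume "\<And>r. s r \<in> carrier Cr"
    "\<And>r. \<exists>d\<in>carrier Cr. s (Suc r) = s r \<oplus>\<^bsub>Cr\<^esub> ([p] \<cdot>\<^bsub>Cr\<^esub> \<one>\<^bsub>Cr\<^esub>) [^]\<^bsub>Cr\<^esub> Suc r \<otimes>\<^bsub>Cr\<^esub> d"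
  then obtain l where "l \<in> C"
    "\<forall>r. fst l \<ominus>\<^bsub>R1\<^esub> fst (s r) \<in> R1.I (Suc r) \<and> snd l \<ominus>\<^bsub>R2\<^esub> snd (s r) \<in> R2.I (Suc r)"
    using C_limit[of s] by auto
  then show "\<exists>l\<in>carrier Cr. \<forall>r. snd l \<ominus>\<^bsub>R2\<^esub> snd (s r) \<in> R2.I (Suc r)" by auto
qed

text \<open>The uniformizer \<open>\<pi>1\<close> generates \<open>R1\<close> over
  \<open>C\<close>; its minimal polynomial has a root \<open>\<sigma>\<close> in
  \<open>R2\<close>, again a uniformizer. Then \<open>C[(\<pi>1, \<sigma>)]\<close> is a ring, it
  projects onto both factors because \<open>\<pi>1\<close> and \<open>\<sigma>\<close> generate
  them, and it is a graph because a combination vanishes in one factor only if all its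
  coefficients are divisible by every power of \<open>p\<close>.\<close>

theorem iso_of_cohen_graph: "ring_iso R1 R2 \<noteq> {}"
proof -
  let ?e = "e1"
  have pi1: "\<pi>1 \<in> R1.I 1" "\<pi>1 \<notin> R1.I 2"
    using R1.pow_unit_exact[of "\<one>\<^bsub>R1\<^esub>" 1] by (auto simp: numeral_2_eq_2)
  obtain v1 where "cohen_dvr R1 \<pi>1 Cr fst p ?e v1" using cohen_fst[OF pi1] by blast
  then interpret K1: cohen_dvr R1 \<pi>1 Cr fst p ?e v1 .
  obtain \<rho> where \<rho>D: "(\<pi>1, \<rho>) \<in> D" using D_total[OF R1.pi_carr] by blast
  have \<rho>: "\<rho> \<in> R2.I 1" "\<rho> \<notin> R2.I 2"
    using D_level_iff[OF \<rho>D, of 1] D_level_iff[OF \<rho>D, of 2] pi1 n_ge by auto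
  have \<rho>c: "\<rho> \<in> carrier R2" using D_carr \<rho>D by blast
  obtain v2 where "cohen_dvr R2 \<rho> Cr snd p ?e v2" using cohen_snd[OF \<rho>] by blast
  then interpret K2: cohen_dvr R2 \<rho> Cr snd p ?e v2 .
  note I_eq = R2.other_uniformizer(1)[OF \<rho>]
  obtain c where c: "\<And>i. c i \<in> C"
    "\<pi>1 [^]\<^bsub>R1\<^esub> ?e = horner R1 ?e (\<lambda>i. fst (c i)) \<pi>1"
    using K1.expand[of "\<pi>1 [^]\<^bsub>R1\<^esub> ?e"] by auto
  note CE = subringE[OF C_subring]
  \<comment> \<open>The monic polynomial of degree \<open>e\<close> over \<open>C\<close> that
    kills \<open>\<pi>1\<close>.\<close>
  define g where "g i = (if i < ?e then \<ominus>\<^bsub>Cr\<^esub> c i else \<one>\<^bsub>Cr\<^esub>)" for i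
  have gC: "g i \<in> C" for i
    using K1.C.a_inv_closed[of "c i"] K1.C.one_closed c(1) by (simp add: g_def)
  have g1: "fst (g i) \<in> carrier R1" and g2: "snd (g i) \<in> carrier R2" for i using gC C_fst C_snd by auto
  have cCr: "c i \<in> carrier Cr" for i using c(1) by simp
  note g_val1 = K1.monic_value[where c = c and d = ?e, OF _ cCr, folded g_def]
    and g_val2 = K2.monic_value[where c = c and d = ?e, OF _ cCr, folded g_def]
  \<comment> \<open>Evaluated at the pair \<open>(\<pi>1, \<rho>)\<close> it gives a pair in
    \<open>D\<close> with first component zero.\<close>
  have root0: "horner R2 (Suc ?e) (\<lambda>i. snd (g i)) \<rho> \<in> R2.I n"
  proof -
    have "horner A (Suc ?e) g (\<pi>1, \<rho>) \<in> D"
      using A.horner_closed[of "(\<pi>1, \<rho>)" g] \<rho>D C_D[OF gC] by (simp del: horner.simps)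
    then have "(horner R1 (Suc ?e) (\<lambda>i. fst (g i)) \<pi>1, horner R2 (Suc ?e) (\<lambda>i. snd (g i)) \<rho>) \<in> D"
      by (simp add: horner_subring RDirProd_horner del: horner.simps)
    moreover have "horner R1 (Suc ?e) (\<lambda>i. fst (g i)) \<pi>1 = \<zero>\<^bsub>R1\<^esub>"
      unfolding g_val1[OF R1.pi_carr] c(2)[symmetric] by (simp add: R1.minus_eq R1.r_neg)
    ultimately show ?thesis using D_zero D_carr by metis
  qed
  let ?\<Delta> = "horner_deriv R2 (Suc ?e) (\<lambda>i. snd (g i)) \<rho>"
  have \<Delta>c: "?\<Delta> \<in> carrier R2" by (rule R2.horner_deriv_closed[where f = "\<lambda>i. snd (g i)", OF \<rho>c g2])
  have g_mult: "[k] \<cdot>\<^bsub>Cr\<^esub> g i \<in> carrier Cr" for k i :: nat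
    using RP.subring_nat_multiple[OF C_subring gC, of k i] by (simp add: nat_multiple_subring)
  \<comment> \<open>Otherwise \<open>p\<^sup>e\<close> would divide the leading coefficient
    \<open>e\<close> of the derivative, but \<open>e < 2\<^sup>e \<le> p\<^sup>e\<close>.\<close>
  have deriv: "?\<Delta> \<notin> R2.I (?e * ?e)"
  proof
    assume "?\<Delta> \<in> R2.I (?e * ?e)"
    moreover have "?\<Delta> = horner R2 ?e (\<lambda>i. snd ([Suc i] \<cdot>\<^bsub>Cr\<^esub> g (Suc i))) \<rho>"
    proof -
      have *: "snd ([k] \<cdot>\<^bsub>Cr\<^esub> a) = [k] \<cdot>\<^bsub>R2\<^esub> snd a" for k :: nat and a
        by (cases a) (simp add: nat_multiple_subring RDirProd_nat_multiple)
      show ?thesis unfolding * by (rule R2.horner_deriv_Suc[where f = "\<lambda>i. snd (g i)", OF \<rho>c g2])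
    qed
    ultimately have "horner R2 ?e (\<lambda>i. snd ([Suc i] \<cdot>\<^bsub>Cr\<^esub> g (Suc i))) \<rho> \<in> K2.I (?e * ?e)"
      unfolding I_eq by simp
    then have "\<forall>i<?e. \<exists>d\<in>carrier Cr. [Suc i] \<cdot>\<^bsub>Cr\<^esub> g (Suc i) = K2.P [^]\<^bsub>Cr\<^esub> ?e \<otimes>\<^bsub>Cr\<^esub> d"
      by (rule K2.horner_p_pow_dvd[rotated]) (rule g_mult)
    moreover have "?e - 1 < ?e" using e1_pos by simp
    ultimately have "\<exists>d\<in>carrier Cr. [Suc (?e - 1)] \<cdot>\<^bsub>Cr\<^esub> g (Suc (?e - 1)) = K2.P [^]\<^bsub>Cr\<^esub> ?e \<otimes>\<^bsub>Cr\<^esub> d"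
      by blast
    then obtain d where d: "d \<in> carrier Cr"
      "[Suc (?e - 1)] \<cdot>\<^bsub>Cr\<^esub> g (Suc (?e - 1)) = K2.P [^]\<^bsub>Cr\<^esub> ?e \<otimes>\<^bsub>Cr\<^esub> d"
      by (elim bexE) (rule that)
    have dC: "d \<in> C" using d(1) by simp
    have "[?e] \<cdot>\<^bsub>Cr\<^esub> \<one>\<^bsub>Cr\<^esub> = K2.P [^]\<^bsub>Cr\<^esub> ?e \<otimes>\<^bsub>Cr\<^esub> d"
    proof -
      have "Suc (?e - 1) = ?e" "g ?e = \<one>\<^bsub>Cr\<^esub>" using e1_pos by (simp_all add: g_def)
      then show ?thesis using d(2) by (simp only:)
    qed
    then have "[?e] \<cdot>\<^bsub>R2\<^esub> \<one>\<^bsub>R2\<^esub> = snd (K2.P [^]\<^bsub>Cr\<^esub> ?e \<otimes>\<^bsub>Cr\<^esub> d)"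
      by (metis subring_RDirProd_nat_multiple_one snd_conv)
    also have "\<dots> = (\<rho> [^]\<^bsub>R2\<^esub> ?e \<otimes>\<^bsub>R2\<^esub> v2) [^]\<^bsub>R2\<^esub> ?e \<otimes>\<^bsub>R2\<^esub> snd d"
      using K2.h.hom_mult[OF K1.C.nat_pow_closed[OF K2.P_closed, of ?e] d(1)] K2.hom_pow[OF K2.P_closed, of ?e] K2.alpha_p by simp
    also have "\<dots> \<in> R2.I (?e * ?e)"
    proof -
      have "(\<rho> [^]\<^bsub>R2\<^esub> ?e \<otimes>\<^bsub>R2\<^esub> v2) [^]\<^bsub>R2\<^esub> k \<in> K2.I (k * ?e)" for k :: nat
      proof (induction k)
        case (Suc k)
        have "\<rho> [^]\<^bsub>R2\<^esub> ?e \<otimes>\<^bsub>R2\<^esub> v2 \<in> K2.I ?e" using K2.I_memI R2.Units_closed[OF K2.v_unit] by blast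
        then show ?case using K2.I_mult[OF Suc] by (simp add: add.commute)
      qed simp
      then show ?thesis using K2.I_rmult[of _ "?e * ?e" "snd d"] C_snd[OF dC] I_eq by simp
    qed
    finally have "p ^ ?e dvd ?e"
      using R2.p_power_dvd_of_mem[OF prime_p P2 u2 e2_pos, of ?e ?e] e_eq by simp
    then have "p ^ ?e \<le> ?e" using e1_pos by (rule dvd_imp_le)
    moreover have "2 ^ ?e \<le> p ^ ?e" using prime_ge_2_nat[OF prime_p] by (rule power_mono) simp
    moreover have "?e < 2 ^ ?e" by (rule less_exp)
    ultimately show False by simp
  qed
  \<comment> \<open>The exact valuation of the derivative at \<open>\<rho>\<close>.\<close>
  define \<delta> where "\<delta> = (LEAST k. ?\<Delta> \<notin> R2.I (Suc k))"
  have e_sq: "?e * ?e = Suc (?e * ?e - 1)" using e1_pos by simp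
  have ex_k: "?\<Delta> \<notin> R2.I (Suc (?e * ?e - 1))" using deriv e_sq by simp
  have \<delta>2: "?\<Delta> \<notin> R2.I (Suc \<delta>)" unfolding \<delta>_def by (rule LeastI[of "\<lambda>k. ?\<Delta> \<notin> R2.I (Suc k)", OF ex_k])
  have \<delta>_le: "\<delta> \<le> ?e * ?e - 1" unfolding \<delta>_def by (rule Least_le[of "\<lambda>k. ?\<Delta> \<notin> R2.I (Suc k)", OF ex_k])
  have \<delta>1: "?\<Delta> \<in> R2.I \<delta>"
  proof (cases \<delta>)
    case (Suc k)
    then have "k < \<delta>" by simp
    then have "\<not> ?\<Delta> \<notin> R2.I (Suc k)" unfolding \<delta>_def by (rule not_less_Least)
    then show ?thesis using Suc by simp
  qed (use \<Delta>c in simp)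
  have \<delta>n: "2 * \<delta> < n"
  proof -
    \<comment> \<open>For \<open>e \<ge> 2\<close> already
      \<open>2 e\<^sup>2 \<le> e\<^sup>3\<close>; the summand 1 is for \<open>e = 1\<close>.\<close>
    have "2 * (?e * ?e) \<le> ?e * (1 + ?e\<^sup>2) + 1"
    proof (cases "?e = 1")
      case False
      then have "2 * ?e \<le> ?e * ?e" using e1_pos by (intro mult_le_mono1) simp
      then have "?e * (2 * ?e) \<le> ?e * (?e * ?e)" by (rule mult_le_mono2)
      moreover have "?e * (1 + ?e\<^sup>2) = ?e + ?e * (?e * ?e)" "2 * (?e * ?e) = ?e * (2 * ?e)"
        by (simp_all add: power2_eq_square algebra_simps)
      ultimately show ?thesis by linarith
    qed simp
    moreover have "2 * \<delta> + 2 \<le> 2 * (?e * ?e)" using \<delta>_le e_sq by linarith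
    ultimately show ?thesis using n_bound e_eq by simp
  qed
  obtain \<sigma> where \<sigma>: "\<sigma> \<in> carrier R2" "horner R2 (Suc ?e) (\<lambda>i. snd (g i)) \<sigma> = \<zero>\<^bsub>R2\<^esub>"
    "\<sigma> \<ominus>\<^bsub>R2\<^esub> \<rho> \<in> R2.I (n - \<delta>)"
    using R2.newton_root[where f = "\<lambda>i. snd (g i)", OF g2 \<rho>c root0 \<delta>1 \<delta>2 \<delta>n] by blast
  have "2 \<le> n - \<delta>" using \<delta>n n_ge by linarith
  then have near: "\<sigma> \<ominus>\<^bsub>R2\<^esub> \<rho> \<in> R2.I 2" using \<sigma>(3) R2.I_mono by blast
  \<comment> \<open>The root is congruent to the uniformizer \<open>\<rho>\<close> modulo
    \<open>I 2\<close>.\<close>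
  have \<sigma>_unif: "\<sigma> \<in> R2.I 1" "\<sigma> \<notin> R2.I 2"
  proof -
    have "\<sigma> \<ominus>\<^bsub>R2\<^esub> \<rho> \<in> R2.I 1" using near R2.I_mono[of 1 2] by auto
    then show "\<sigma> \<in> R2.I 1" using R2.I_cancel_minus \<rho>(1) \<sigma>(1) by blast
    show "\<sigma> \<notin> R2.I 2"
    proof
      assume "\<sigma> \<in> R2.I 2"
      then have "\<sigma> \<ominus>\<^bsub>R2\<^esub> (\<sigma> \<ominus>\<^bsub>R2\<^esub> \<rho>) \<in> R2.I 2" using near R2.I_minus by blast
      moreover have "\<sigma> \<ominus>\<^bsub>R2\<^esub> (\<sigma> \<ominus>\<^bsub>R2\<^esub> \<rho>) = \<rho>" using \<sigma>(1) \<rho>c by algebra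
      ultimately show False using \<rho>(2) by simp
    qed
  qed
  obtain v3 where "cohen_dvr R2 \<sigma> Cr snd p ?e v3" using cohen_snd[OF \<sigma>_unif] by blast
  then interpret K3: cohen_dvr R2 \<sigma> Cr snd p ?e v3 .
  have \<sigma>_pow: "\<sigma> [^]\<^bsub>R2\<^esub> ?e = horner R2 ?e (\<lambda>i. snd (c i)) \<sigma>"
  proof -
    have c1: "snd (c i) \<in> carrier R2" for i using C_snd[OF c(1)] .
    have "horner R2 ?e (\<lambda>i. snd (c i)) \<sigma> \<in> carrier R2"
      by (rule R2.horner_closed[where f = "\<lambda>i. snd (c i)", OF \<sigma>(1) c1])
    moreover have "\<sigma> [^]\<^bsub>R2\<^esub> ?e \<ominus>\<^bsub>R2\<^esub> horner R2 ?e (\<lambda>i. snd (c i)) \<sigma> = \<zero>\<^bsub>R2\<^esub>"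
      using \<sigma>(2) g_val2[OF \<sigma>(1)] by metis
    ultimately show ?thesis using \<sigma>(1) R2.r_right_minus_eq by blast
  qed
  let ?z = "(\<pi>1, \<sigma>)"
  have z_pow: "?z [^]\<^bsub>RDirProd R1 R2\<^esub> k = (\<pi>1 [^]\<^bsub>R1\<^esub> k, \<sigma> [^]\<^bsub>R2\<^esub> k)" for k :: nat
    by (induction k) auto
  have "?z [^]\<^bsub>RDirProd R1 R2\<^esub> ?e = horner (RDirProd R1 R2) ?e c ?z"
    unfolding RDirProd_horner z_pow using c(2) \<sigma>_pow by simp
  then have root: "?z [^]\<^bsub>RDirProd R1 R2\<^esub> ?e \<in> RP.poly_values C ?e ?z"
    unfolding RP.poly_values_def using c(1) by blast
  define G where "G = RP.poly_values C ?e ?z"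
  have G: "subring G (RDirProd R1 R2)"
    unfolding G_def using RP.poly_values_subring(1)[OF C_subring _ e1_pos root] \<sigma>(1) by simp
  have G_iff: "(x, y) \<in> G \<longleftrightarrow> (\<exists>f. (\<forall>i. f i \<in> C) \<and> x = horner R1 ?e (\<lambda>i. fst (f i)) \<pi>1 \<and>
      y = horner R2 ?e (\<lambda>i. snd (f i)) \<sigma>)" for x y
    unfolding G_def RP.poly_values_def RDirProd_horner by (auto simp: image_subset_iff)
  have zero1: "y = \<zero>\<^bsub>R2\<^esub>" if y: "(\<zero>\<^bsub>R1\<^esub>, y) \<in> G" for y
  proof -
    obtain f where f: "\<And>i. f i \<in> C" "\<zero>\<^bsub>R1\<^esub> = horner R1 ?e (\<lambda>i. fst (f i)) \<pi>1"
      "y = horner R2 ?e (\<lambda>i. snd (f i)) \<sigma>" using y unfolding G_iff by blast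
    have "y \<in> R2.I k" for k
    proof -
      have "\<forall>i<?e. \<exists>d\<in>carrier Cr. f i = K1.P [^]\<^bsub>Cr\<^esub> k \<otimes>\<^bsub>Cr\<^esub> d"
        by (rule K1.horner_p_pow_dvd) (use f R1.I_zero in auto)
      then have mem: "snd (f i) \<in> R2.I k" if "i < ?e" for i using p_pow_mult_mem(2) that by auto
      have "y = horner R2 ?e (\<lambda>i. if i < ?e then snd (f i) else \<zero>\<^bsub>R2\<^esub>) \<sigma>"
        unfolding f(3) by (rule horner_cong) simp
      also have "\<dots> \<in> R2.I k"
        by (rule R2.horner_in_ideal[OF R2.I_ideal \<sigma>(1)]) (use mem R2.I_zero in simp)
      finally show ?thesis .
    qed
    then show ?thesis using R2.I_separated R2.I_carr by blast
  qed
  have zero2: "x = \<zero>\<^bsub>R1\<^esub>" if x: "(x, \<zero>\<^bsub>R2\<^esub>) \<in> G" for x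
  proof -
    obtain f where f: "\<And>i. f i \<in> C" "\<zero>\<^bsub>R2\<^esub> = horner R2 ?e (\<lambda>i. snd (f i)) \<sigma>"
      "x = horner R1 ?e (\<lambda>i. fst (f i)) \<pi>1" using x unfolding G_iff by blast
    have "x \<in> R1.I k" for k
    proof -
      have "\<forall>i<?e. \<exists>d\<in>carrier Cr. f i = K3.P [^]\<^bsub>Cr\<^esub> k \<otimes>\<^bsub>Cr\<^esub> d"
        by (rule K3.horner_p_pow_dvd) (use f K3.I_zero in auto)
      then have mem: "fst (f i) \<in> R1.I k" if "i < ?e" for i using p_pow_mult_mem(1) that by auto
      have "x = horner R1 ?e (\<lambda>i. if i < ?e then fst (f i) else \<zero>\<^bsub>R1\<^esub>) \<pi>1"
        unfolding f(3) by (rule horner_cong) simp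
      also have "\<dots> \<in> R1.I k"
        by (rule R1.horner_in_ideal[OF R1.I_ideal R1.pi_carr]) (use mem R1.I_zero in simp)
      finally show ?thesis .
    qed
    then show ?thesis using R1.I_separated R1.I_carr by blast
  qed
  have "\<exists>f\<in>ring_iso R1 R2. \<forall>x\<in>carrier R1. (x, f x) \<in> G"
  proof (rule ring_iso_of_graph[OF R1.is_cring R2.is_cring G _ _ zero1 zero2])
    have G_carr: "G \<subseteq> carrier R1 \<times> carrier R2" using subringE(1)[OF G] by simp
    show "fst ` G = carrier R1"
    proof (intro equalityI subsetI)
      fix x assume "x \<in> carrier R1"
      then obtain f where "\<forall>i. f i \<in> C" "x = horner R1 ?e (\<lambda>i. fst (f i)) \<pi>1" using K1.expand by auto
      then have "(x, horner R2 ?e (\<lambda>i. snd (f i)) \<sigma>) \<in> G" unfolding G_iff by blast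
      then show "x \<in> fst ` G" by force
    qed (use G_carr in auto)
    show "snd ` G = carrier R2"
    proof (intro equalityI subsetI)
      fix y assume "y \<in> carrier R2"
      then obtain f where "\<forall>i. f i \<in> C" "y = horner R2 ?e (\<lambda>i. snd (f i)) \<sigma>" using K3.expand by auto
      then have "(horner R1 ?e (\<lambda>i. fst (f i)) \<pi>1, y) \<in> G" unfolding G_iff by blast
      then show "y \<in> snd ` G" by force
    qed (use G_carr in auto)
  qed
  then show ?thesis by blast
qed

end

theorem (in dvr_lift) residue_correspondence_lifts: "ring_iso R1 R2 \<noteq> {}"
proof -
  obtain C where C: "subring C A" "\<forall>x\<in>carrier A. \<exists>c\<in>C. \<exists>m\<in>J 1. x = c \<oplus>\<^bsub>A\<^esub> m"
    "\<forall>c\<in>C \<inter> J 1. \<exists>d\<in>C. c = F.P \<otimes>\<^bsub>A\<^esub> d"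
    "\<forall>s. (\<forall>r. s r \<in> C \<and> s (Suc r) \<ominus>\<^bsub>A\<^esub> s r \<in> J (Suc r)) \<longrightarrow>
        (\<exists>l\<in>C. \<forall>r. l \<ominus>\<^bsub>A\<^esub> s r \<in> J (Suc r))"
    using F.cohen_subring by (elim exE conjE) (rule that)
  interpret dvr_lift_cohen R1 \<pi>1 R2 \<pi>2 D n p e1 e2 u1 u2 C
    by (intro dvr_lift_cohen.intro dvr_lift_axioms dvr_lift_cohen_axioms.intro)
      (use C in auto)
  show ?thesis by (rule iso_of_cohen_graph)
qed

section \<open>Valuation rings of finitely ramified fields\<close>

lemma (in ring) subring_minus:
  assumes "subring S R" "x \<in> S" "y \<in> S"
  shows "x \<ominus>\<^bsub>R\<lparr>carrier := S\<rparr>\<^esub> y = x \<ominus> y"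
proof -
  interpret S: ring "R\<lparr>carrier := S\<rparr>" by (rule subring_is_ring[OF assms(1)])
  note E = subringE[OF assms(1)]
  have "\<ominus>\<^bsub>R\<lparr>carrier := S\<rparr>\<^esub> y = \<ominus> y"
    by (rule S.minus_equality) (use assms E in \<open>auto simp: l_neg subset_iff\<close>)
  then show ?thesis by (simp add: S.minus_eq minus_eq)
qed

context valued_field
begin

lemma val_zero [simp]: "\<nu> \<zero> = Pinf"
  using val_eq_Pinf_iff by simp

lemma val_Fin:
  assumes "x \<in> carrier K" "x \<noteq> \<zero>" obtains g where "\<nu> x = Fin g"
  using val_not_Minf[OF assms(1)] val_eq_Pinf_iff[OF assms(1)] assms(2) by (cases "\<nu> x") auto

lemma val_one [simp]: "\<nu> \<one> = 0"
proof -
  obtain g where g: "\<nu> \<one> = Fin g" using val_Fin[of \<one>] by auto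
  have "\<nu> (\<one> \<otimes> \<one>) = \<nu> \<one> + \<nu> \<one>" by (rule val_mult) auto
  then show ?thesis using g by (simp add: zero_extended_def)
qed

lemma val_neg [simp]: "x \<in> carrier K \<Longrightarrow> \<nu> (\<ominus> x) = \<nu> x"
proof -
  assume x: "x \<in> carrier K"
  have "\<ominus> \<one> \<noteq> \<zero>" by (metis l_minus l_one local.minus_minus minus_zero one_closed one_not_zero zero_closed)
  then obtain g where g: "\<nu> (\<ominus> \<one>) = Fin g" using val_Fin[of "\<ominus> \<one>"] by auto
  have "\<nu> (\<ominus> \<one> \<otimes> \<ominus> \<one>) = \<nu> (\<ominus> \<one>) + \<nu> (\<ominus> \<one>)" by (rule val_mult) auto
  moreover have "\<ominus> \<one> \<otimes> \<ominus> \<one> = \<one>" by algebra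
  ultimately have "g + g = 0" using g by (simp add: zero_extended_def)
  then have "\<nu> (\<ominus> \<one>) = 0" using g by (simp add: zero_extended_def)
  moreover have "\<nu> (\<ominus> x) = \<nu> (\<ominus> \<one> \<otimes> x)" using x by (simp add: l_minus)
  ultimately show ?thesis using val_mult[of "\<ominus> \<one>" x] x by simp
qed

lemma val_minus: "x \<in> carrier K \<Longrightarrow> y \<in> carrier K \<Longrightarrow> min (\<nu> x) (\<nu> y) \<le> \<nu> (x \<ominus> y)"
  using val_add[of x "\<ominus> y"] by (simp add: minus_eq)

lemma val_minus_ge: "x \<in> carrier K \<Longrightarrow> y \<in> carrier K \<Longrightarrow> c \<le> \<nu> x \<Longrightarrow> c \<le> \<nu> y \<Longrightarrow> c \<le> \<nu> (x \<ominus> y)"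
  using val_minus[of x y] by (meson min.boundedI order_trans)

lemma val_add_ge: "x \<in> carrier K \<Longrightarrow> y \<in> carrier K \<Longrightarrow> c \<le> \<nu> x \<Longrightarrow> c \<le> \<nu> y \<Longrightarrow> c \<le> \<nu> (x \<oplus> y)"
  using val_add[of x y] by (meson min.boundedI order_trans)

lemma nonzero_inv: "x \<in> carrier K \<Longrightarrow> x \<noteq> \<zero> \<Longrightarrow> inv x \<in> carrier K \<and> inv x \<otimes> x = \<one> \<and> x \<otimes> inv x = \<one> \<and> inv x \<noteq> \<zero>"
  using field_Units by (metis DiffI Units_inv_closed Units_l_inv Units_r_inv l_null one_not_zero singletonD)

lemma val_div_le:
  assumes "x \<in> carrier K" "y \<in> carrier K" "y \<noteq> \<zero>"
  shows "\<nu> y \<le> \<nu> x \<longleftrightarrow> 0 \<le> \<nu> (x \<otimes> inv y)" and "\<nu> y < \<nu> x \<longleftrightarrow> 0 < \<nu> (x \<otimes> inv y)"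
proof -
  note i = nonzero_inv[OF assms(2,3)]
  obtain g where g: "\<nu> y = Fin g" using val_Fin assms by blast
  have "x = (x \<otimes> inv y) \<otimes> y" using i assms by (simp add: m_assoc)
  then have eq: "\<nu> x = \<nu> (x \<otimes> inv y) + Fin g" using val_mult[of "x \<otimes> inv y" y] i assms g by simp
  show "\<nu> y \<le> \<nu> x \<longleftrightarrow> 0 \<le> \<nu> (x \<otimes> inv y)" "\<nu> y < \<nu> x \<longleftrightarrow> 0 < \<nu> (x \<otimes> inv y)"
    unfolding eq g by (cases "\<nu> (x \<otimes> inv y)"; simp add: zero_extended_def)+
qed

lemma val_cases:
  assumes x: "x \<in> carrier K"
  shows "0 \<le> \<nu> x \<or> x \<noteq> \<zero> \<and> 0 \<le> \<nu> (inv x)"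
proof (cases "0 \<le> \<nu> x")
  case False
  then have nz: "x \<noteq> \<zero>" by auto
  have "\<nu> x \<le> \<nu> \<one>" using False by simp
  then have "0 \<le> \<nu> (\<one> \<otimes> inv x)" using val_div_le(1)[OF one_closed x nz] by simp
  then show ?thesis using nonzero_inv[OF x nz] nz by simp
qed simp

definition O_set where "O_set = {x \<in> carrier K. 0 \<le> \<nu> x}"

lemma valuation_ring_eq: "valuation_ring K \<nu> = K\<lparr>carrier := O_set\<rparr>"
  by (simp add: valuation_ring_def O_set_def)

lemma O_mem: "x \<in> O_set \<longleftrightarrow> x \<in> carrier K \<and> 0 \<le> \<nu> x"
  by (simp add: O_set_def)

lemma val_mult_ge0: "x \<in> carrier K \<Longrightarrow> y \<in> carrier K \<Longrightarrow> 0 \<le> \<nu> x \<Longrightarrow> \<nu> y \<le> \<nu> (x \<otimes> y)"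
  unfolding val_mult by (cases "\<nu> x"; cases "\<nu> y") (auto simp: zero_extended_def)

lemma O_subring: "subring O_set K"
proof (rule subringI)
  fix x y assume "x \<in> O_set" "y \<in> O_set"
  then show "x \<otimes> y \<in> O_set" "x \<oplus> y \<in> O_set"
    using val_mult_ge0[of x y] val_add_ge[of x y 0] by (auto simp: O_mem)
qed (auto simp: O_mem)

lemma O_domain: "domain (valuation_ring K \<nu>)"
  unfolding valuation_ring_eq by (rule subring_is_domain[OF O_subring])

lemma O_Units: "x \<in> Units (valuation_ring K \<nu>) \<longleftrightarrow> x \<in> carrier K \<and> \<nu> x = 0"
proof
  assume "x \<in> Units (valuation_ring K \<nu>)"
  then obtain y where y: "x \<in> O_set" "y \<in> O_set" "x \<otimes> y = \<one>"
    unfolding Units_def valuation_ring_eq by auto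
  have "\<nu> x + \<nu> y = 0" using val_mult[of x y] y by (simp add: O_mem)
  moreover have "0 \<le> \<nu> x" "0 \<le> \<nu> y" using y by (auto simp: O_mem)
  ultimately have "\<nu> x = 0"
    by (cases "\<nu> x"; cases "\<nu> y") (auto simp: zero_extended_def add_nonneg_eq_0_iff)
  then show "x \<in> carrier K \<and> \<nu> x = 0" using y by (simp add: O_mem)
next
  assume x: "x \<in> carrier K \<and> \<nu> x = 0"
  then have "x \<noteq> \<zero>" by (auto simp: zero_extended_def)
  note i = nonzero_inv[OF x[THEN conjunct1] this]
  have "\<nu> (inv x \<otimes> x) = \<nu> (inv x) + \<nu> x" using val_mult i x by blast
  then have "\<nu> (inv x) = 0" using i x by simp
  then show "x \<in> Units (valuation_ring K \<nu>)"
    unfolding Units_def valuation_ring_eq using x i by (auto simp: O_mem intro!: bexI[of _ "inv x"])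
qed

lemma max_ideal_ideal: "ideal (max_ideal K \<nu>) (valuation_ring K \<nu>)"
proof -
  interpret O: domain "valuation_ring K \<nu>" by (rule O_domain)
  show ?thesis
  proof (rule O.cring_idealI)
    show "max_ideal K \<nu> \<subseteq> carrier (valuation_ring K \<nu>)"
      by (auto simp: max_ideal_def valuation_ring_def)
    show "\<zero>\<^bsub>valuation_ring K \<nu>\<^esub> \<in> max_ideal K \<nu>"
      by (simp add: max_ideal_def valuation_ring_def zero_extended_def)
  next
    fix a b assume "a \<in> max_ideal K \<nu>" "b \<in> max_ideal K \<nu>"
    then show "a \<oplus>\<^bsub>valuation_ring K \<nu>\<^esub> b \<in> max_ideal K \<nu>"
      using val_add[of a b] by (auto simp: max_ideal_def valuation_ring_def min_def split: if_splits)
  next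
    fix a x assume "a \<in> max_ideal K \<nu>" "x \<in> carrier (valuation_ring K \<nu>)"
    then show "x \<otimes>\<^bsub>valuation_ring K \<nu>\<^esub> a \<in> max_ideal K \<nu>"
      using val_mult_ge0[of x a] by (auto simp: max_ideal_def valuation_ring_def)
  qed
qed

end

text \<open>Finite ramification and rank one together make the valuation discrete, with the least
  element of the finite set of ramification values as the value of a uniformizer.\<close>

locale ramified_field = complete_valued_field K \<nu> for K (structure) and \<nu> +
  fixes p :: nat
  assumes mixed: "mixed_characteristic K \<nu> p" and fin_ram: "finitely_ramified K \<nu> p"
begin

abbreviation \<O> where "\<O> \<equiv> valuation_ring K \<nu>"
abbreviation \<pi> where "\<pi> \<equiv> uniformizer K \<nu>"
abbreviation e where "e \<equiv> ramification_index K \<nu> p"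

lemma p_nonzero: "[p] \<cdot> \<one> \<noteq> \<zero>"
proof -
  have "0 < p" using mixed by (auto simp: mixed_characteristic_def prime_gt_0_nat)
  moreover have "ring_char K = 0" using mixed by (simp add: mixed_characteristic_def)
  then have "\<not> (\<exists>k::nat. 0 < k \<and> [k] \<cdot> \<one> = \<zero>)"
    unfolding ring_char_def using LeastI_ex[of "\<lambda>k::nat. 0 < k \<and> [k] \<cdot> \<one> = \<zero>"]
    by (metis (mono_tags, lifting) less_numeral_extra(3))
  ultimately show ?thesis by blast
qed

lemma p_positive: "0 < \<nu> ([p] \<cdot> \<one>)"
proof -
  interpret M: ideal "max_ideal K \<nu>" \<O> by (rule max_ideal_ideal)
  interpret h: ring_hom_ring \<O> "\<O> Quot max_ideal K \<nu>" "(+>\<^bsub>\<O>\<^esub>) (max_ideal K \<nu>)"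
    by (rule M.rcos_ring_hom_ring)
  let ?Q = "\<O> Quot max_ideal K \<nu>"
  have "ring_char ?Q = p" "p \<noteq> 0"
    using mixed by (auto simp: mixed_characteristic_def prime_gt_0_nat)
  define Z where "Z k \<longleftrightarrow> 0 < k \<and> [k] \<cdot>\<^bsub>?Q\<^esub> \<one>\<^bsub>?Q\<^esub> = \<zero>\<^bsub>?Q\<^esub>" for k :: nat
  have "ring_char ?Q = (if \<exists>k. Z k then LEAST k. Z k else 0)" unfolding ring_char_def Z_def ..
  then have "\<exists>k. Z k" "p = (LEAST k. Z k)"
    using \<open>ring_char ?Q = p\<close> \<open>p \<noteq> 0\<close> by (auto split: if_splits)
  then have "Z p" using LeastI_ex[of Z] by simp
  then have "[p] \<cdot>\<^bsub>?Q\<^esub> \<one>\<^bsub>?Q\<^esub> = \<zero>\<^bsub>?Q\<^esub>" by (simp only: Z_def)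
  moreover have "\<zero>\<^bsub>?Q\<^esub> = max_ideal K \<nu>" unfolding FactRing_def by simp
  ultimately have "max_ideal K \<nu> +>\<^bsub>\<O>\<^esub> ([p] \<cdot>\<^bsub>\<O>\<^esub> \<one>\<^bsub>\<O>\<^esub>) = max_ideal K \<nu>"
    using h.hom_nat_multiple_one[of p] by (simp only:)
  then have "[p] \<cdot>\<^bsub>\<O>\<^esub> \<one>\<^bsub>\<O>\<^esub> \<in> max_ideal K \<nu>"
    by (rule M.rcos_const_imp_mem[rotated]) simp
  then show ?thesis by (simp add: valuation_ring_def nat_multiple_subring max_ideal_def)
qed

lemma uniformizer: "is_uniformizer K \<nu> \<pi>"
proof -
  let ?V = "ramification_values K \<nu> p"
  obtain g where g: "\<nu> ([p] \<cdot> \<one>) = Fin g" using val_Fin[OF _ p_nonzero] by auto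
  have "g \<in> ?V" using g p_positive
    unfolding ramification_values_def value_group_def by (auto simp: zero_extended_def)
  moreover have fin: "finite ?V" using fin_ram by (simp add: finitely_ramified_def)
  ultimately have m: "Min ?V \<in> ?V" "Min ?V \<le> g" by (auto intro: Min_in)
  then obtain x where x: "x \<in> carrier K" "\<nu> x = Fin (Min ?V)" "0 < Min ?V"
    unfolding ramification_values_def value_group_def by auto
  have "is_uniformizer K \<nu> x"
    unfolding is_uniformizer_def
  proof (intro conjI ballI impI)
    show "x \<noteq> \<zero>" using x by auto
    show "0 < \<nu> x" using x by (simp add: zero_extended_def)
    fix y assume y: "y \<in> carrier K" "0 < \<nu> y"
    show "\<nu> x \<le> \<nu> y"
    proof (cases "\<nu> y \<le> Fin g")
      case True
      then obtain h where h: "\<nu> y = Fin h" using y(2) by (cases "\<nu> y") (auto simp: zero_extended_def)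
      then have "h \<in> ?V" using y True g
        unfolding ramification_values_def value_group_def by (auto simp: zero_extended_def)
      then show ?thesis using x h fin by simp
    next
      case False
      then show ?thesis using m(2) x(2) by (metis less_eq_extended.simps(1) linear order_trans)
    qed
  qed (use x in simp)
  then show ?thesis unfolding uniformizer_def by (rule someI)
qed

lemma pi_facts: "\<pi> \<in> carrier K" "\<pi> \<noteq> \<zero>" "0 < \<nu> \<pi>" "x \<in> carrier K \<Longrightarrow> 0 < \<nu> x \<Longrightarrow> \<nu> \<pi> \<le> \<nu> x"
  using uniformizer by (auto simp: is_uniformizer_def)

lemma pi_pow: "\<pi> [^] (k::nat) \<in> carrier K" "\<pi> [^] k \<noteq> \<zero>"
  using pi_facts by (induction k) (auto simp: integral_iff)

lemma val_pi_Suc: "\<nu> (\<pi> [^] (k::nat)) < \<nu> (\<pi> [^] Suc k)"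
proof -
  obtain a b where "\<nu> (\<pi> [^] k) = Fin a" "\<nu> \<pi> = Fin b"
    using val_Fin[OF pi_pow(1) pi_pow(2)] val_Fin[OF pi_facts(1,2)] by metis
  then show ?thesis using pi_facts(3) val_mult[OF pi_pow(1) pi_facts(1), of k]
    by (simp add: zero_extended_def)
qed

lemma val_pi_strict: "k < l \<Longrightarrow> \<nu> (\<pi> [^] (k::nat)) < \<nu> (\<pi> [^] l)"
  by (rule lift_Suc_mono_less[of "\<lambda>k. \<nu> (\<pi> [^] (k::nat))", OF val_pi_Suc])

lemma val_pi_le_iff: "\<nu> (\<pi> [^] (k::nat)) \<le> \<nu> (\<pi> [^] l) \<longleftrightarrow> k \<le> l"
  using val_pi_strict[of k l] val_pi_strict[of l k] by (metis leD le_less linorder_le_less_linear)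

text \<open>If the value of \<open>x / \<pi>\<^sup>k\<close> is positive, it is at least that of
  \<open>\<pi>\<close>.\<close>

lemma gt_pi_pow_iff:
  assumes x: "x \<in> carrier K"
  shows "\<nu> (\<pi> [^] (k::nat)) < \<nu> x \<longleftrightarrow> \<nu> (\<pi> [^] Suc k) \<le> \<nu> x"
proof
  assume "\<nu> (\<pi> [^] k) < \<nu> x"
  let ?y = "x \<otimes> inv (\<pi> [^] k)"
  note i = nonzero_inv[OF pi_pow[of k]]
  have "0 < \<nu> ?y" using val_div_le(2)[OF x pi_pow[of k]] \<open>\<nu> (\<pi> [^] k) < \<nu> x\<close> by simp
  then have y: "\<nu> \<pi> \<le> \<nu> ?y" using pi_facts(4) x i by simp
  have "\<nu> (\<pi> [^] Suc k) = \<nu> \<pi> + \<nu> (\<pi> [^] k)"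
    using val_mult[OF pi_pow(1) pi_facts(1), of k] by (simp add: add.commute)
  also have "\<dots> \<le> \<nu> ?y + \<nu> (\<pi> [^] k)" using y by (rule add_right_mono)
  also have "\<dots> = \<nu> (?y \<otimes> \<pi> [^] k)" using val_mult[of ?y "\<pi> [^] k"] x i pi_pow by simp
  also have "?y \<otimes> \<pi> [^] k = x" using x i pi_pow by (simp add: m_assoc)
  finally show "\<nu> (\<pi> [^] Suc k) \<le> \<nu> x" .
qed (use val_pi_Suc[of k] in \<open>rule less_le_trans\<close>)

lemma mpow_iff: "x \<in> mpow \<O> \<pi> k \<longleftrightarrow> x \<in> carrier K \<and> \<nu> (\<pi> [^] k) \<le> \<nu> x"
proof
  assume "x \<in> mpow \<O> \<pi> k"
  then obtain y where y: "y \<in> O_set" "x = \<pi> [^] k \<otimes> y"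
    unfolding mpow_def valuation_ring_eq nat_pow_subring by auto
  then show "x \<in> carrier K \<and> \<nu> (\<pi> [^] k) \<le> \<nu> x"
    using pi_pow val_mult_ge0[of y "\<pi> [^] k"] by (auto simp: O_mem m_comm)
next
  assume x: "x \<in> carrier K \<and> \<nu> (\<pi> [^] k) \<le> \<nu> x"
  note i = nonzero_inv[OF pi_pow[of k]]
  let ?y = "x \<otimes> inv (\<pi> [^] k)"
  have "?y \<in> O_set" using val_div_le(1)[of x "\<pi> [^] k"] x pi_pow i by (simp add: O_mem)
  moreover have "x = \<pi> [^] k \<otimes> ?y" using x i pi_pow by (metis m_assoc m_comm m_closed r_one)
  ultimately show "x \<in> mpow \<O> \<pi> k"
    unfolding mpow_def valuation_ring_eq nat_pow_subring by auto
qed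

lemma max_ideal_pow_eq: "0 < n \<Longrightarrow> max_ideal_pow K \<nu> n = mpow \<O> \<pi> n"
  using gt_pi_pow_iff[of _ "n - 1"] by (auto simp: max_ideal_pow_def mpow_iff)

lemma archimedean: "y \<in> carrier K \<Longrightarrow> y \<noteq> \<zero> \<Longrightarrow> \<exists>k::nat. \<nu> y \<le> \<nu> (\<pi> [^] k)"
  using rank_le_one pi_facts unfolding rank_le_one_def by blast

text \<open>By rank one some power of \<open>\<pi>\<close> has value at least that of
  \<open>x\<close>; the first such power has the same value.\<close>

lemma decomp:
  assumes x: "x \<in> carrier K" "x \<noteq> \<zero>" "0 \<le> \<nu> x"
  shows "\<exists>k::nat. \<exists>u\<in>Units \<O>. x = \<pi> [^] k \<otimes> u"
proof -
  define k where "k = (LEAST k. \<nu> x \<le> \<nu> (\<pi> [^] (k::nat)))"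
  have k: "\<nu> x \<le> \<nu> (\<pi> [^] k)" unfolding k_def using archimedean[OF x(1,2)] by (rule LeastI_ex)
  have "\<nu> (\<pi> [^] k) \<le> \<nu> x"
  proof (cases k)
    case 0
    then show ?thesis using x(3) by simp
  next
    case (Suc l)
    then have "\<not> \<nu> x \<le> \<nu> (\<pi> [^] l)" unfolding k_def by (metis lessI not_less_Least)
    then show ?thesis using gt_pi_pow_iff[OF x(1), of l] Suc by (simp add: not_le)
  qed
  then have eq: "\<nu> x = \<nu> (\<pi> [^] k)" using k by simp
  note i = nonzero_inv[OF pi_pow[of k]]
  let ?u = "x \<otimes> inv (\<pi> [^] k)"
  have "0 \<le> \<nu> ?u" "\<not> 0 < \<nu> ?u"
    using val_div_le[OF x(1) pi_pow[of k]] eq by auto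
  then have "?u \<in> Units \<O>" using O_Units x(1) i by auto
  moreover have "x = \<pi> [^] k \<otimes> ?u" using x i pi_pow by (metis m_assoc m_comm m_closed r_one)
  ultimately show ?thesis by blast
qed

text \<open>A sequence converging at the rate of the powers of \<open>\<pi>\<close> is Cauchy,
  because by rank one these powers exhaust the value group.\<close>

lemma valuation_ring_dvr: "complete_dvr \<O> \<pi>"
proof (intro complete_dvr.intro complete_dvr_axioms.intro O_domain)
  show "\<pi> \<in> carrier \<O>" using pi_facts by (simp add: valuation_ring_def)
  show "\<pi> \<noteq> \<zero>\<^bsub>\<O>\<^esub>" using pi_facts by (simp add: valuation_ring_def)
  show "\<pi> \<notin> Units \<O>" using pi_facts O_Units by auto
  fix x assume "x \<in> carrier \<O>" "x \<noteq> \<zero>\<^bsub>\<O>\<^esub>"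
  then show "\<exists>k::nat. \<exists>u\<in>Units \<O>. x = \<pi> [^]\<^bsub>\<O>\<^esub> k \<otimes>\<^bsub>\<O>\<^esub> u"
    using decomp[of x] by (simp add: valuation_ring_eq nat_pow_subring O_mem)
next
  fix s assume "\<And>r. s r \<in> carrier \<O>" and diff: "\<And>r. s (Suc r) \<ominus>\<^bsub>\<O>\<^esub> s r \<in> mpow \<O> \<pi> (Suc r)"
  then have s: "s r \<in> O_set" for r by (simp add: valuation_ring_eq)
  then have sc: "s r \<in> carrier K" for r by (simp add: O_mem)
  have minus: "x \<ominus>\<^bsub>\<O>\<^esub> y = x \<ominus> y" if "x \<in> O_set" "y \<in> O_set" for x y
    unfolding valuation_ring_eq by (rule subring_minus[OF O_subring that])
  have step: "\<nu> (\<pi> [^] Suc r) \<le> \<nu> (s (Suc r) \<ominus> s r)" for r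
    using diff[of r] unfolding mpow_iff minus[OF s s] by simp
  have id: "a \<ominus> c = (a \<ominus> b) \<oplus> (b \<ominus> c)" if "a \<in> carrier K" "b \<in> carrier K" "c \<in> carrier K" for a b c
    using that by algebra
  have far: "\<nu> (\<pi> [^] Suc N) \<le> \<nu> (s (N + k) \<ominus> s N)" for N k
  proof (induction k)
    case 0
    then show ?case using sc[of N] by (simp add: minus_eq r_neg)
  next
    case (Suc k)
    have "\<nu> (\<pi> [^] Suc N) \<le> \<nu> (\<pi> [^] Suc (N + k))" unfolding val_pi_le_iff by simp
    then have "\<nu> (\<pi> [^] Suc N) \<le> \<nu> (s (Suc (N + k)) \<ominus> s (N + k))" using step by (rule order_trans)
    then have "\<nu> (\<pi> [^] Suc N) \<le> \<nu> ((s (Suc (N + k)) \<ominus> s (N + k)) \<oplus> (s (N + k) \<ominus> s N))"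
      using Suc sc by (intro val_add_ge) auto
    then show ?case using id[OF sc sc sc] by simp
  qed
  have "val_Cauchy K \<nu> s"
    unfolding val_Cauchy_def
  proof
    fix g assume "g \<in> value_group K \<nu>"
    then obtain y where y: "y \<in> carrier K" "\<nu> y = Fin g" unfolding value_group_def by blast
    then have "y \<noteq> \<zero>" by auto
    then obtain k where k: "Fin g \<le> \<nu> (\<pi> [^] (k::nat))" using archimedean y by metis
    have "Fin g < \<nu> (s i \<ominus> s j)" if "k \<le> i" "k \<le> j" for i j
    proof -
      have a: "\<nu> (\<pi> [^] Suc k) \<le> \<nu> (s i \<ominus> s k)" "\<nu> (\<pi> [^] Suc k) \<le> \<nu> (s j \<ominus> s k)"
        using far[of k "i - k"] far[of k "j - k"] that by simp_all
      have "a \<ominus> b = (a \<ominus> c) \<ominus> (b \<ominus> c)" if "a \<in> carrier K" "b \<in> carrier K" "c \<in> carrier K" for a b c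
        using that by algebra
      then have "s i \<ominus> s j = (s i \<ominus> s k) \<ominus> (s j \<ominus> s k)" using sc by blast
      then have "\<nu> (\<pi> [^] Suc k) \<le> \<nu> (s i \<ominus> s j)"
        using val_minus_ge[OF _ _ a] sc by simp
      then show ?thesis using k val_pi_Suc[of k] by (meson le_less_trans less_le_trans)
    qed
    then show "\<exists>N. \<forall>i\<ge>N. \<forall>j\<ge>N. Fin g < \<nu> (s i \<ominus> s j)" by blast
  qed
  then obtain l where l: "l \<in> carrier K" "val_converges_to K \<nu> s l"
    using Cauchy_converges[of s] sc by blast
  have lim: "\<nu> (\<pi> [^] Suc r) \<le> \<nu> (l \<ominus> s r)" for r
  proof -
    obtain g where g: "\<nu> (\<pi> [^] Suc r) = Fin g" using val_Fin[OF pi_pow] by metis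
    then have "g \<in> value_group K \<nu>" unfolding value_group_def using pi_pow(1)[of "Suc r"] by blast
    then obtain N where N: "\<And>i. i \<ge> N \<Longrightarrow> Fin g < \<nu> (s i \<ominus> l)"
      using l(2) unfolding val_converges_to_def by blast
    let ?i = "r + N"
    have "\<nu> (\<pi> [^] Suc r) \<le> \<nu> (s ?i \<ominus> l)" using N[of ?i] g by simp
    moreover have "\<nu> (\<pi> [^] Suc r) \<le> \<nu> (s ?i \<ominus> s r)" by (rule far)
    ultimately have "\<nu> (\<pi> [^] Suc r) \<le> \<nu> ((s ?i \<ominus> s r) \<ominus> (s ?i \<ominus> l))"
      using val_minus_ge[of "s ?i \<ominus> s r" "s ?i \<ominus> l"] sc l(1) by simp
    moreover have "(a \<ominus> b) \<ominus> (a \<ominus> l) = l \<ominus> b" if "a \<in> carrier K" "b \<in> carrier K" for a b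
      using that l(1) by algebra
    ultimately show ?thesis using sc by simp
  qed
  have "0 \<le> \<nu> (l \<ominus> s 0)" using lim[of 0] pi_facts by (auto intro: order_trans)
  then have "0 \<le> \<nu> ((l \<ominus> s 0) \<oplus> s 0)" using s[of 0] l(1) by (intro val_add_ge) (auto simp: O_mem)
  moreover have "(l \<ominus> a) \<oplus> a = l" if "a \<in> carrier K" for a using that l(1) by algebra
  ultimately have lO: "l \<in> O_set" using sc l(1) by (simp add: O_mem)
  have "l \<ominus>\<^bsub>\<O>\<^esub> s r \<in> mpow \<O> \<pi> (Suc r)" for r
    unfolding mpow_iff minus[OF lO s] using lim l(1) sc by simp
  then show "\<exists>l\<in>carrier \<O>. \<forall>r. l \<ominus>\<^bsub>\<O>\<^esub> s r \<in> mpow \<O> \<pi> (Suc r)"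
    using lO by (auto simp: valuation_ring_eq)
qed

text \<open>The ramification values are those of \<open>\<pi>, \<dots>, \<pi>\<^sup>k\<close> when
  \<open>p\<close> is a unit times \<open>\<pi>\<^sup>k\<close>.\<close>

lemma p_decomp: "\<exists>u\<in>Units \<O>. [p] \<cdot>\<^bsub>\<O>\<^esub> \<one>\<^bsub>\<O>\<^esub> = \<pi> [^]\<^bsub>\<O>\<^esub> e \<otimes>\<^bsub>\<O>\<^esub> u" and e_pos: "0 < e"
proof -
  obtain k u where u: "u \<in> Units \<O>" "[p] \<cdot> \<one> = \<pi> [^] (k::nat) \<otimes> u"
    using decomp[OF _ p_nonzero less_imp_le[OF p_positive]] by auto
  have uc: "u \<in> carrier K" "\<nu> u = 0" using u(1) O_Units by auto
  have vp: "\<nu> ([p] \<cdot> \<one>) = \<nu> (\<pi> [^] k)" using val_mult[OF pi_pow(1) uc(1), of k] u(2) uc(2) by simp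
  have "k \<noteq> 0"
  proof
    assume "k = 0"
    then show False using vp p_positive by simp
  qed
  define v where "v i = (THE g. \<nu> (\<pi> [^] (i::nat)) = Fin g)" for i
  have v: "\<nu> (\<pi> [^] i) = Fin (v i)" for i
  proof -
    obtain g where "\<nu> (\<pi> [^] i) = Fin g" using val_Fin[OF pi_pow] by metis
    then show ?thesis unfolding v_def by simp
  qed
  have v_le: "v i \<le> v j \<longleftrightarrow> i \<le> j" for i j using val_pi_le_iff[of i j] by (simp add: v)
  have v_0: "v 0 = 0" using v[of 0] by (simp add: zero_extended_def)
  have "ramification_values K \<nu> p = v ` {1..k}"
  proof (intro equalityI subsetI)
    fix g assume "g \<in> ramification_values K \<nu> p"
    then obtain x where x: "x \<in> carrier K" "\<nu> x = Fin g" "0 < g" "\<nu> x \<le> \<nu> (\<pi> [^] k)"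
      unfolding ramification_values_def value_group_def vp by auto
    then have "x \<noteq> \<zero>" "0 \<le> \<nu> x" by (auto simp: zero_extended_def)
    then obtain i w where w: "w \<in> Units \<O>" "x = \<pi> [^] (i::nat) \<otimes> w" using decomp[OF x(1)] by blast
    then have "\<nu> x = Fin (v i)" using O_Units[of w] val_mult[OF pi_pow(1), of w i] v by simp
    then have g: "g = v i" using x(2) by simp
    have "i \<le> k" using x(2,4) g v_le v by simp
    moreover have "i \<noteq> 0" using x(3) g v_0 by (metis less_irrefl)
    ultimately show "g \<in> v ` {1..k}" using g by auto
  next
    fix g assume "g \<in> v ` {1..k}"
    then obtain i where i: "1 \<le> i" "i \<le> k" "g = v i" by auto
    have "g \<in> value_group K \<nu>" unfolding value_group_def using v[of i] i(3) pi_pow(1)[of i] by auto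
    moreover have "0 < g" using v_le[of i 0] v_0 i by simp
    moreover have "Fin g \<le> \<nu> ([p] \<cdot> \<one>)" using v_le[of i k] i vp v by simp
    ultimately show "g \<in> ramification_values K \<nu> p" unfolding ramification_values_def by simp
  qed
  moreover have "inj_on v {1..k}" using v_le by (intro inj_onI) (metis eq_iff)
  ultimately have e: "e = k" unfolding ramification_index_def by (simp add: card_image)
  show "0 < e" using e \<open>k \<noteq> 0\<close> by simp
  show "\<exists>u\<in>Units \<O>. [p] \<cdot>\<^bsub>\<O>\<^esub> \<one>\<^bsub>\<O>\<^esub> = \<pi> [^]\<^bsub>\<O>\<^esub> e \<otimes>\<^bsub>\<O>\<^esub> u"
    using u unfolding e by (auto simp: valuation_ring_eq nat_pow_subring nat_multiple_subring)
qed

end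

section \<open>Residue rings and valued field isomorphisms\<close>

lemma bij_betw_ex: "bij_betw f A B \<Longrightarrow> y \<in> B \<Longrightarrow> \<exists>x\<in>A. f x = y"
  by (metis bij_betw_imp_surj_on imageE)

lemma quotient_iso_of_surj:
  assumes R: "ring R" and S: "ring S" and h: "h \<in> ring_hom R S"
    and surj: "h ` carrier R = carrier S" and ker: "\<And>x. x \<in> carrier R \<Longrightarrow> h x = \<zero>\<^bsub>S\<^esub> \<longleftrightarrow> x \<in> I"
    and I: "I \<subseteq> carrier R"
  shows "ring_iso (R Quot I) S \<noteq> {}"
proof -
  interpret h: ring_hom_ring R S h by (rule ring_hom_ringI2[OF R S h])
  have "a_kernel R S h = I" unfolding a_kernel_def'
  proof (intro equalityI subsetI CollectI conjI)
    fix x assume "x \<in> {x \<in> carrier R. h x = \<zero>\<^bsub>S\<^esub>}"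
    then show "x \<in> I" using ker[of x] by simp
  next
    fix x assume x: "x \<in> I"
    then show "x \<in> carrier R" using I by blast
    then show "h x = \<zero>\<^bsub>S\<^esub>" using ker[of x] x by simp
  qed
  then have "(\<lambda>X. the_elem (h ` X)) \<in> ring_iso (R Quot I) S"
    using h.FactRing_iso_set[OF surj] by simp
  then show ?thesis by blast
qed

lemma quotient_iso_correspondence:
  assumes R1: "complete_dvr R1 \<pi>1" and R2: "complete_dvr R2 \<pi>2" and n: "2 \<le> n"
    and f: "f \<in> ring_iso (R1 Quot mpow R1 \<pi>1 n) (R2 Quot mpow R2 \<pi>2 n)"
  shows "dvr_correspondence R1 \<pi>1 R2 \<pi>2 {(x, y). x \<in> carrier R1 \<and> y \<in> carrier R2 \<and>
     f (mpow R1 \<pi>1 n +>\<^bsub>R1\<^esub> x) = mpow R2 \<pi>2 n +>\<^bsub>R2\<^esub> y} n"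
proof -
  interpret R1: complete_dvr R1 \<pi>1 by (rule R1)
  interpret R2: complete_dvr R2 \<pi>2 by (rule R2)
  interpret I1: ideal "R1.I n" R1 by (rule R1.I_ideal)
  interpret I2: ideal "R2.I n" R2 by (rule R2.I_ideal)
  let ?Q1 = "R1 Quot R1.I n" and ?Q2 = "R2 Quot R2.I n"
  interpret h1: ring_hom_ring R1 ?Q1 "(+>\<^bsub>R1\<^esub>) (R1.I n)" by (rule I1.rcos_ring_hom_ring)
  interpret h2: ring_hom_ring R2 ?Q2 "(+>\<^bsub>R2\<^esub>) (R2.I n)" by (rule I2.rcos_ring_hom_ring)
  define h2 where "h2 = (+>\<^bsub>R2\<^esub>) (R2.I n)"
  define h1 where "h1 = (+>\<^bsub>R1\<^esub>) (R1.I n)"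
  have h2_hom: "h2 \<in> ring_hom R2 ?Q2" unfolding h2_def by (rule h2.homh)
  have h1_hom: "h1 \<in> ring_hom R1 ?Q1" unfolding h1_def by (rule h1.homh)
  have f_hom: "f \<in> ring_hom ?Q1 ?Q2" and f_bij: "bij_betw f (carrier ?Q1) (carrier ?Q2)"
    using f by (auto simp: ring_iso_def)
  define F where "F = f \<circ> h1"
  have F_hom: "F \<in> ring_hom R1 ?Q2" unfolding F_def by (rule ring_hom_trans[OF h1_hom f_hom])
  interpret F: ring_hom_ring R1 ?Q2 F
    by (rule ring_hom_ringI2[OF R1.ring_axioms I2.quotient_is_ring F_hom])
  interpret H: ring_hom_ring R2 ?Q2 h2
    by (rule ring_hom_ringI2[OF R2.ring_axioms I2.quotient_is_ring h2_hom])
  have h2_zero: "h2 y = \<zero>\<^bsub>?Q2\<^esub> \<longleftrightarrow> y \<in> R2.I n" if "y \<in> carrier R2" for y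
    unfolding h2_def by (rule I2.coset_eq_zero_iff[OF that])
  have F_zero: "F x = \<zero>\<^bsub>?Q2\<^esub> \<longleftrightarrow> x \<in> R1.I n" if x: "x \<in> carrier R1" for x
  proof -
    have "f \<zero>\<^bsub>?Q1\<^esub> = \<zero>\<^bsub>?Q2\<^esub>"
      using ring_hom_zero[OF f_hom I1.quotient_is_ring I2.quotient_is_ring] .
    moreover have "h1 x \<in> carrier ?Q1" "\<zero>\<^bsub>?Q1\<^esub> \<in> carrier ?Q1"
      using ring_hom_closed[OF h1_hom x] ring.ring_simprules(2)[OF I1.quotient_is_ring] by auto
    ultimately have "F x = \<zero>\<^bsub>?Q2\<^esub> \<longleftrightarrow> h1 x = \<zero>\<^bsub>?Q1\<^esub>"
      using f_bij unfolding F_def bij_betw_def inj_on_def by (metis comp_apply)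
    also have "\<dots> \<longleftrightarrow> x \<in> R1.I n" unfolding h1_def by (rule I1.coset_eq_zero_iff[OF x])
    finally show ?thesis .
  qed
  have F_surj: "\<exists>x\<in>carrier R1. F x = q" if q: "q \<in> carrier ?Q2" for q
  proof -
    obtain r where "r \<in> carrier ?Q1" "q = f r" using bij_betw_ex[OF f_bij q] by auto
    then show ?thesis using I1.coset_surj unfolding F_def h1_def by fastforce
  qed
  have h2_surj: "\<exists>y\<in>carrier R2. h2 y = q" if "q \<in> carrier ?Q2" for q
    using I2.coset_surj[OF that] unfolding h2_def by metis
  define D where "D = {(x, y). x \<in> carrier R1 \<and> y \<in> carrier R2 \<and> F x = h2 y}"
  have D: "(x, y) \<in> D \<longleftrightarrow> x \<in> carrier R1 \<and> y \<in> carrier R2 \<and> F x = h2 y" for x y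
    by (simp add: D_def)
  have "dvr_correspondence R1 \<pi>1 R2 \<pi>2 D n"
  proof (intro dvr_correspondence.intro dvr_correspondence_axioms.intro R1 R2 n)
    show "(\<one>\<^bsub>R1\<^esub>, \<one>\<^bsub>R2\<^esub>) \<in> D" unfolding D using F.hom_one H.hom_one by simp
    fix x y assume xy: "(x, y) \<in> D"
    then show "x \<in> carrier R1 \<and> y \<in> carrier R2" unfolding D by simp
    show "(\<ominus>\<^bsub>R1\<^esub> x, \<ominus>\<^bsub>R2\<^esub> y) \<in> D" using xy unfolding D by simp
    fix x' y' assume "(x', y') \<in> D"
    then show "(x \<oplus>\<^bsub>R1\<^esub> x', y \<oplus>\<^bsub>R2\<^esub> y') \<in> D" "(x \<otimes>\<^bsub>R1\<^esub> x', y \<otimes>\<^bsub>R2\<^esub> y') \<in> D"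
      using xy unfolding D by simp_all
  next
    fix x assume x: "x \<in> carrier R1"
    then show "\<exists>y. (x, y) \<in> D" using h2_surj[of "F x"] F.hom_closed[OF x] unfolding D by metis
    show "((x, \<zero>\<^bsub>R2\<^esub>) \<in> D) = (x \<in> R1.I n)" unfolding D using x F_zero H.hom_zero by simp
  next
    fix y assume y: "y \<in> carrier R2"
    then show "\<exists>x. (x, y) \<in> D" using F_surj[of "h2 y"] H.hom_closed[OF y] unfolding D by metis
    show "((\<zero>\<^bsub>R1\<^esub>, y) \<in> D) = (y \<in> R2.I n)" unfolding D using y h2_zero F.hom_zero by auto
  qed
  moreover have "D = {(x, y). x \<in> carrier R1 \<and> y \<in> carrier R2 \<and>
     f (R1.I n +>\<^bsub>R1\<^esub> x) = R2.I n +>\<^bsub>R2\<^esub> y}"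
    unfolding D_def F_def h1_def h2_def by simp
  ultimately show ?thesis by simp
qed

lemma dvr_iso_mpow:
  assumes R1: "complete_dvr R1 \<pi>1" and R2: "complete_dvr R2 \<pi>2" and f: "f \<in> ring_iso R1 R2"
    and x: "x \<in> mpow R1 \<pi>1 n"
  shows "f x \<in> mpow R2 \<pi>2 n"
proof -
  interpret R1: complete_dvr R1 \<pi>1 by (rule R1)
  interpret R2: complete_dvr R2 \<pi>2 by (rule R2)
  have hom: "f \<in> ring_hom R1 R2" and bij: "bij_betw f (carrier R1) (carrier R2)"
    using f by (auto simp: ring_iso_def)
  interpret f: ring_hom_ring R1 R2 f by (rule ring_hom_ringI2[OF R1.ring_axioms R2.ring_axioms hom])
  have "f \<pi>1 \<notin> Units R2"
  proof
    assume u: "f \<pi>1 \<in> Units R2"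
    obtain y where y: "y \<in> carrier R1" "f y = inv\<^bsub>R2\<^esub> (f \<pi>1)"
      using bij R2.Units_inv_closed[OF u] unfolding bij_betw_def by (metis imageE)
    have "f (\<pi>1 \<otimes>\<^bsub>R1\<^esub> y) = f \<one>\<^bsub>R1\<^esub>" using y u by simp
    then have "\<pi>1 \<otimes>\<^bsub>R1\<^esub> y = \<one>\<^bsub>R1\<^esub>" using bij y(1) by (simp add: bij_betw_def inj_on_def)
    then show False using R1.Units_if_inverse[OF R1.pi_carr y(1)] R1.pi_nonunit by simp
  qed
  then have p: "f \<pi>1 \<in> R2.I 1" using R2.unit_iff[of "f \<pi>1"] by simp
  have pow: "f (\<pi>1 [^]\<^bsub>R1\<^esub> k) \<in> R2.I k" for k :: nat
  proof (induction k)
    case (Suc k)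
    then show ?case using R2.I_mult[OF Suc p] by simp
  qed simp
  obtain y where "y \<in> carrier R1" "x = \<pi>1 [^]\<^bsub>R1\<^esub> n \<otimes>\<^bsub>R1\<^esub> y" using R1.I_memE[OF x] by blast
  then show ?thesis using R2.I_rmult[OF pow[of n], of "f y"] by simp
qed

lemma dvr_iso_mpow_iff:
  assumes R1: "complete_dvr R1 \<pi>1" and R2: "complete_dvr R2 \<pi>2" and f: "f \<in> ring_iso R1 R2"
    and x: "x \<in> carrier R1"
  shows "f x \<in> mpow R2 \<pi>2 n \<longleftrightarrow> x \<in> mpow R1 \<pi>1 n"
proof -
  interpret R1: complete_dvr R1 \<pi>1 by (rule R1)
  have bij: "bij_betw f (carrier R1) (carrier R2)" using f by (auto simp: ring_iso_def)
  have inv: "inv_into (carrier R1) f \<in> ring_iso R2 R1" by (rule ring_iso_set_sym[OF R1.ring_axioms f])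
  show ?thesis
    using dvr_iso_mpow[OF R1 R2 f, of x n] dvr_iso_mpow[OF R2 R1 inv, of "f x" n]
      inv_into_f_f[OF bij_betw_imp_inj_on[OF bij] x] by auto
qed

lemma dvr_iso_quotient_iso:
  assumes R1: "complete_dvr R1 \<pi>1" and R2: "complete_dvr R2 \<pi>2" and f: "f \<in> ring_iso R1 R2"
  shows "ring_iso (R1 Quot mpow R1 \<pi>1 n) (R2 Quot mpow R2 \<pi>2 n) \<noteq> {}"
proof -
  interpret R1: complete_dvr R1 \<pi>1 by (rule R1)
  interpret R2: complete_dvr R2 \<pi>2 by (rule R2)
  have hom: "f \<in> ring_hom R1 R2" and bij: "bij_betw f (carrier R1) (carrier R2)"
    using f by (auto simp: ring_iso_def)
  interpret I2: ideal "R2.I n" R2 by (rule R2.I_ideal)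
  let ?h = "(+>\<^bsub>R2\<^esub>) (R2.I n) \<circ> f"
  note mem = dvr_iso_mpow_iff[OF R1 R2 f]
  have fc: "f x \<in> carrier R2" if "x \<in> carrier R1" for x using ring_hom_closed[OF hom that] .
  show ?thesis
  proof (rule quotient_iso_of_surj[OF R1.ring_axioms I2.quotient_is_ring])
    show h: "?h \<in> ring_hom R1 (R2 Quot R2.I n)" by (rule ring_hom_trans[OF hom I2.rcos_ring_hom])
    have "?h ` carrier R1 \<subseteq> carrier (R2 Quot R2.I n)"
    proof
      fix q assume "q \<in> ?h ` carrier R1"
      then obtain x where "x \<in> carrier R1" "q = ?h x" by (rule imageE)
      then show "q \<in> carrier (R2 Quot R2.I n)" using ring_hom_closed[OF h] by (simp only:)
    qed
    moreover have "carrier (R2 Quot R2.I n) \<subseteq> ?h ` carrier R1"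
    proof
      fix q assume "q \<in> carrier (R2 Quot R2.I n)"
      then obtain y where y: "y \<in> carrier R2" "q = R2.I n +>\<^bsub>R2\<^esub> y" using I2.coset_surj[of q] by auto
      then have "y \<in> f ` carrier R1" using bij by (simp add: bij_betw_def)
      then obtain x where x: "x \<in> carrier R1" "y = f x" by (rule imageE)
      show "q \<in> ?h ` carrier R1" by (rule image_eqI[OF _ x(1)]) (simp only: y(2) x(2) comp_apply)
    qed
    ultimately show "?h ` carrier R1 = carrier (R2 Quot R2.I n)" by blast
    fix x assume x: "x \<in> carrier R1"
    show "(?h x = \<zero>\<^bsub>R2 Quot R2.I n\<^esub>) = (x \<in> R1.I n)"
      unfolding comp_apply I2.coset_eq_zero_iff[OF fc[OF x]] by (rule mem[OF x])
  qed (use R1.I_carr in blast)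
qed

text \<open>The extension to the fraction fields is again constructed as a graph: \<open>x\<close>
  and \<open>y\<close> correspond if some nonzero \<open>b\<close> of the valuation ring clears
  the denominator of \<open>x\<close> and \<open>y f(b) = f(x b)\<close>. The extension respects
  the valuations because these are determined by the valuation rings.\<close>

theorem field_iso_of_valuation_ring_iso:
  assumes K: "valued_field K \<nu>" and L: "valued_field L \<mu>"
    and f: "f \<in> ring_iso (valuation_ring K \<nu>) (valuation_ring L \<mu>)"
  shows "valued_field_iso K \<nu> L \<mu> \<noteq> {}"
proof -
  interpret K: valued_field K \<nu> by (rule K)
  interpret L: valued_field L \<mu> by (rule L)
  note vr = K.valuation_ring_eq L.valuation_ring_eq
  have bij: "bij_betw f K.O_set L.O_set" and hom: "f \<in> ring_hom (valuation_ring K \<nu>) (valuation_ring L \<mu>)"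
    using f by (auto simp: ring_iso_def vr)
  have f_mult: "f (a \<otimes>\<^bsub>K\<^esub> b) = f a \<otimes>\<^bsub>L\<^esub> f b" and f_add: "f (a \<oplus>\<^bsub>K\<^esub> b) = f a \<oplus>\<^bsub>L\<^esub> f b"
    if "a \<in> K.O_set" "b \<in> K.O_set" for a b
    using ring_hom_mult[OF hom] ring_hom_add[OF hom] that by (auto simp: vr)
  have f_one: "f \<one>\<^bsub>K\<^esub> = \<one>\<^bsub>L\<^esub>" using ring_hom_one[OF hom] by (simp add: vr)
  have f_zero: "f \<zero>\<^bsub>K\<^esub> = \<zero>\<^bsub>L\<^esub>"
    using ring_hom_zero[OF hom] K.O_domain L.O_domain
    by (simp add: vr domain.axioms(1) cring.axioms(1))
  have f_inj: "f a = f b \<longleftrightarrow> a = b" if "a \<in> K.O_set" "b \<in> K.O_set" for a b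
    using bij that by (auto simp: bij_betw_def inj_on_def)
  have f_O: "f a \<in> L.O_set" if "a \<in> K.O_set" for a using bij that by (auto simp: bij_betw_def)
  have f_surj: "\<exists>a\<in>K.O_set. f a = y" if "y \<in> L.O_set" for y using bij_betw_ex[OF bij that] .
  have f_carr: "f a \<in> carrier L" if "a \<in> K.O_set" for a using f_O[OF that] by (simp add: L.O_mem)
  note OE = subringE[OF K.O_subring]
  have f_nz: "f a \<noteq> \<zero>\<^bsub>L\<^esub>" if "a \<in> K.O_set" "a \<noteq> \<zero>\<^bsub>K\<^esub>" for a
    using f_inj[OF that(1) OE(2)] that(2) f_zero by simp
  define G where "G = {(x, y). x \<in> carrier K \<and> y \<in> carrier L \<and>
      (\<exists>b\<in>K.O_set. b \<noteq> \<zero>\<^bsub>K\<^esub> \<and> x \<otimes>\<^bsub>K\<^esub> b \<in> K.O_set \<and> y \<otimes>\<^bsub>L\<^esub> f b = f (x \<otimes>\<^bsub>K\<^esub> b))}"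
  have G_I: "(x, y) \<in> G" if "x \<in> carrier K" "y \<in> carrier L" "b \<in> K.O_set" "b \<noteq> \<zero>\<^bsub>K\<^esub>"
    "x \<otimes>\<^bsub>K\<^esub> b \<in> K.O_set" "y \<otimes>\<^bsub>L\<^esub> f b = f (x \<otimes>\<^bsub>K\<^esub> b)" for x y b
    using that unfolding G_def by blast
  have G_O: "(a, f a) \<in> G" if "a \<in> K.O_set" for a
    using that f_carr[OF that] OE(3) f_one by (intro G_I[of _ _ "\<one>\<^bsub>K\<^esub>"]) (auto simp: K.O_mem)
  have G_E: "\<exists>b\<in>K.O_set. b \<noteq> \<zero>\<^bsub>K\<^esub> \<and> x \<otimes>\<^bsub>K\<^esub> b \<in> K.O_set \<and> y \<otimes>\<^bsub>L\<^esub> f b = f (x \<otimes>\<^bsub>K\<^esub> b) \<and>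
      b \<in> carrier K \<and> f b \<in> carrier L \<and> f b \<noteq> \<zero>\<^bsub>L\<^esub>" and G_carr: "x \<in> carrier K" "y \<in> carrier L"
    if "(x, y) \<in> G" for x y
    using that f_carr f_nz unfolding G_def by (auto simp: K.O_mem)
  interpret P: cring "RDirProd K L" by (rule RDirProd_cring[OF K.is_cring L.is_cring])
  have G_mult: "(x \<otimes>\<^bsub>K\<^esub> x', y \<otimes>\<^bsub>L\<^esub> y') \<in> G" and G_add: "(x \<oplus>\<^bsub>K\<^esub> x', y \<oplus>\<^bsub>L\<^esub> y') \<in> G"
    if xy: "(x, y) \<in> G" "(x', y') \<in> G" for x y x' y'
  proof -
    note c = G_carr[OF xy(1)] G_carr[OF xy(2)]
    obtain b where b: "b \<in> K.O_set" "b \<noteq> \<zero>\<^bsub>K\<^esub>" "x \<otimes>\<^bsub>K\<^esub> b \<in> K.O_set" "y \<otimes>\<^bsub>L\<^esub> f b = f (x \<otimes>\<^bsub>K\<^esub> b)"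
      "b \<in> carrier K" "f b \<in> carrier L" using G_E[OF xy(1)] by blast
    obtain b' where b': "b' \<in> K.O_set" "b' \<noteq> \<zero>\<^bsub>K\<^esub>" "x' \<otimes>\<^bsub>K\<^esub> b' \<in> K.O_set" "y' \<otimes>\<^bsub>L\<^esub> f b' = f (x' \<otimes>\<^bsub>K\<^esub> b')"
      "b' \<in> carrier K" "f b' \<in> carrier L" using G_E[OF xy(2)] by blast
    have bb: "b \<otimes>\<^bsub>K\<^esub> b' \<in> K.O_set" "b \<otimes>\<^bsub>K\<^esub> b' \<noteq> \<zero>\<^bsub>K\<^esub>"
      using OE(6)[OF b(1) b'(1)] K.integral_iff[of b b'] b b' by auto
    have k1: "(x \<otimes>\<^bsub>K\<^esub> x') \<otimes>\<^bsub>K\<^esub> (b \<otimes>\<^bsub>K\<^esub> b') = (x \<otimes>\<^bsub>K\<^esub> b) \<otimes>\<^bsub>K\<^esub> (x' \<otimes>\<^bsub>K\<^esub> b')"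
      "(x \<oplus>\<^bsub>K\<^esub> x') \<otimes>\<^bsub>K\<^esub> (b \<otimes>\<^bsub>K\<^esub> b') = (x \<otimes>\<^bsub>K\<^esub> b) \<otimes>\<^bsub>K\<^esub> b' \<oplus>\<^bsub>K\<^esub> (x' \<otimes>\<^bsub>K\<^esub> b') \<otimes>\<^bsub>K\<^esub> b"
      using c(1,3) b(5) b'(5) by algebra+
    have l1: "(y \<otimes>\<^bsub>L\<^esub> y') \<otimes>\<^bsub>L\<^esub> (s \<otimes>\<^bsub>L\<^esub> t) = (y \<otimes>\<^bsub>L\<^esub> s) \<otimes>\<^bsub>L\<^esub> (y' \<otimes>\<^bsub>L\<^esub> t)"
      "(y \<oplus>\<^bsub>L\<^esub> y') \<otimes>\<^bsub>L\<^esub> (s \<otimes>\<^bsub>L\<^esub> t) = (y \<otimes>\<^bsub>L\<^esub> s) \<otimes>\<^bsub>L\<^esub> t \<oplus>\<^bsub>L\<^esub> (y' \<otimes>\<^bsub>L\<^esub> t) \<otimes>\<^bsub>L\<^esub> s"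
      if "s \<in> carrier L" "t \<in> carrier L" for s t
      using c(2,4) that by algebra+
    note xb = OE(6)[OF b(3) b'(1)] OE(6)[OF b'(3) b(1)]
    show "(x \<otimes>\<^bsub>K\<^esub> x', y \<otimes>\<^bsub>L\<^esub> y') \<in> G"
      using c bb OE(6)[OF b(3) b'(3)] f_mult[OF b(1) b'(1)] f_mult[OF b(3) b'(3)] l1(1)[OF b(6) b'(6)] b(4) b'(4) k1(1)
      by (intro G_I[of _ _ "b \<otimes>\<^bsub>K\<^esub> b'"]) auto
    show "(x \<oplus>\<^bsub>K\<^esub> x', y \<oplus>\<^bsub>L\<^esub> y') \<in> G"
      using c bb xb OE(7)[OF xb] f_mult[OF b(1) b'(1)] f_mult[OF b(3) b'(1)] f_mult[OF b'(3) b(1)] f_add[OF xb]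
        l1(2)[OF b(6) b'(6)] b(4) b'(4) k1(2)
      by (intro G_I[of _ _ "b \<otimes>\<^bsub>K\<^esub> b'"]) auto
  qed
  have f_neg_one: "f (\<ominus>\<^bsub>K\<^esub> \<one>\<^bsub>K\<^esub>) = \<ominus>\<^bsub>L\<^esub> \<one>\<^bsub>L\<^esub>"
  proof -
    have o: "\<ominus>\<^bsub>K\<^esub> \<one>\<^bsub>K\<^esub> \<in> K.O_set" using OE(3,5) by blast
    have "f (\<ominus>\<^bsub>K\<^esub> \<one>\<^bsub>K\<^esub>) \<oplus>\<^bsub>L\<^esub> \<one>\<^bsub>L\<^esub> = \<zero>\<^bsub>L\<^esub>"
      using f_add[OF o OE(3)] f_one f_zero by (simp add: K.l_neg)
    then show ?thesis using f_carr[OF o] by (metis L.minus_equality L.one_closed)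
  qed
  have G_sub: "subring G (RDirProd K L)"
  proof (rule P.subringI)
    show "G \<subseteq> carrier (RDirProd K L)" using G_carr by auto
    show "\<one>\<^bsub>RDirProd K L\<^esub> \<in> G" using G_O[OF OE(3)] f_one by simp
    fix a assume a: "a \<in> G"
    obtain x y where xy: "a = (x, y)" by (cases a)
    have "(\<ominus>\<^bsub>K\<^esub> \<one>\<^bsub>K\<^esub> \<otimes>\<^bsub>K\<^esub> x, \<ominus>\<^bsub>L\<^esub> \<one>\<^bsub>L\<^esub> \<otimes>\<^bsub>L\<^esub> y) \<in> G"
      using G_mult[OF G_O[OF OE(5)[OF OE(3)]], of x y] a xy f_neg_one by simp
    then show "\<ominus>\<^bsub>RDirProd K L\<^esub> a \<in> G"
      using G_carr[of x y] a RDirProd_a_inv[OF K.is_cring L.is_cring] unfolding xy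
      by (simp add: K.l_minus L.l_minus)
  next
    fix a b assume "a \<in> G" "b \<in> G"
    then show "a \<otimes>\<^bsub>RDirProd K L\<^esub> b \<in> G" "a \<oplus>\<^bsub>RDirProd K L\<^esub> b \<in> G"
      using G_mult G_add by (cases a; cases b; auto)+
  qed
  have K_cases: "x \<in> K.O_set \<or> x \<noteq> \<zero>\<^bsub>K\<^esub> \<and> inv\<^bsub>K\<^esub> x \<in> K.O_set" if x: "x \<in> carrier K" for x
    using K.val_cases[OF x] K.nonzero_inv[OF x] x by (auto simp: K.O_mem)
  have L_cases: "x \<in> L.O_set \<or> x \<noteq> \<zero>\<^bsub>L\<^esub> \<and> inv\<^bsub>L\<^esub> x \<in> L.O_set" if x: "x \<in> carrier L" for x
    using L.val_cases[OF x] L.nonzero_inv[OF x] x by (auto simp: L.O_mem)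
  have "\<exists>F\<in>ring_iso K L. \<forall>x\<in>carrier K. (x, F x) \<in> G"
  proof (rule ring_iso_of_graph[OF K.is_cring L.is_cring G_sub])
    show "fst ` G = carrier K"
    proof (intro equalityI subsetI)
      fix x assume x: "x \<in> carrier K"
      consider "x \<in> K.O_set" | "x \<noteq> \<zero>\<^bsub>K\<^esub>" "inv\<^bsub>K\<^esub> x \<in> K.O_set" using K_cases[OF x] by blast
      then show "x \<in> fst ` G"
      proof cases
        case 1
        then show ?thesis using G_O by force
      next
        case 2
        note i = K.nonzero_inv[OF x 2(1)]
        note j = L.nonzero_inv[OF f_carr[OF 2(2)] f_nz[OF 2(2)]]
        have "(x, inv\<^bsub>L\<^esub> (f (inv\<^bsub>K\<^esub> x))) \<in> G"
          using x i j 2 OE(3) f_one by (intro G_I[of _ _ "inv\<^bsub>K\<^esub> x"]) auto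
        then show ?thesis by force
      qed
    qed (use G_carr in auto)
    show "snd ` G = carrier L"
    proof (intro equalityI subsetI)
      fix y assume y: "y \<in> carrier L"
      consider "y \<in> L.O_set" | "y \<noteq> \<zero>\<^bsub>L\<^esub>" "inv\<^bsub>L\<^esub> y \<in> L.O_set" using L_cases[OF y] by blast
      then show "y \<in> snd ` G"
      proof cases
        case 1
        then obtain a where "a \<in> K.O_set" "f a = y" using f_surj by blast
        then show ?thesis using G_O by force
      next
        case 2
        obtain b where b: "b \<in> K.O_set" "f b = inv\<^bsub>L\<^esub> y" using f_surj[OF 2(2)] by blast
        note j = L.nonzero_inv[OF y 2(1)]
        have nz: "b \<noteq> \<zero>\<^bsub>K\<^esub>" using b j f_zero by auto
        have bc: "b \<in> carrier K" using b by (simp add: K.O_mem)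
        note i = K.nonzero_inv[OF bc nz]
        have "(inv\<^bsub>K\<^esub> b, y) \<in> G"
          using y i j b nz OE(3) f_one by (intro G_I[of _ _ b]) auto
        then show ?thesis by force
      qed
    qed (use G_carr in auto)
    fix y assume y: "(\<zero>\<^bsub>K\<^esub>, y) \<in> G"
    obtain b where b: "b \<in> carrier K" "y \<otimes>\<^bsub>L\<^esub> f b = f (\<zero>\<^bsub>K\<^esub> \<otimes>\<^bsub>K\<^esub> b)" "f b \<in> carrier L" "f b \<noteq> \<zero>\<^bsub>L\<^esub>"
      using G_E[OF y] by blast
    then show "y = \<zero>\<^bsub>L\<^esub>" using f_zero L.integral_iff[of y "f b"] G_carr[OF y] by simp
  next
    fix x assume x: "(x, \<zero>\<^bsub>L\<^esub>) \<in> G"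
    obtain b where b: "b \<in> carrier K" "b \<noteq> \<zero>\<^bsub>K\<^esub>" "x \<otimes>\<^bsub>K\<^esub> b \<in> K.O_set"
      "\<zero>\<^bsub>L\<^esub> \<otimes>\<^bsub>L\<^esub> f b = f (x \<otimes>\<^bsub>K\<^esub> b)" "f b \<in> carrier L"
      using G_E[OF x] by blast
    then have "x \<otimes>\<^bsub>K\<^esub> b = \<zero>\<^bsub>K\<^esub>" using f_nz[OF b(3)] by auto
    then show "x = \<zero>\<^bsub>K\<^esub>" using K.integral_iff[of x b] G_carr[OF x] b by simp
  qed
  then obtain F where F: "F \<in> ring_iso K L" "\<And>x. x \<in> carrier K \<Longrightarrow> (x, F x) \<in> G" by blast
  have F_carr: "F x \<in> carrier L" if "x \<in> carrier K" for x using G_carr[OF F(2)[OF that]] by simp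
  have F_hom: "F \<in> ring_hom K L" and F_bij: "bij_betw F (carrier K) (carrier L)"
    using F(1) by (auto simp: ring_iso_def)
  have F_zero: "F \<zero>\<^bsub>K\<^esub> = \<zero>\<^bsub>L\<^esub>" using ring_hom_zero[OF F_hom K.ring_axioms L.ring_axioms] .
  have F_zero_iff: "F x = \<zero>\<^bsub>L\<^esub> \<longleftrightarrow> x = \<zero>\<^bsub>K\<^esub>" if "x \<in> carrier K" for x
    using F_bij that F_zero unfolding bij_betw_def inj_on_def by (metis K.zero_closed)
  have sign: "0 \<le> \<nu> x \<longleftrightarrow> 0 \<le> \<mu> (F x)" if x: "x \<in> carrier K" for x
  proof -
    obtain b where b: "b \<in> K.O_set" "b \<noteq> \<zero>\<^bsub>K\<^esub>" "x \<otimes>\<^bsub>K\<^esub> b \<in> K.O_set" "F x \<otimes>\<^bsub>L\<^esub> f b = f (x \<otimes>\<^bsub>K\<^esub> b)"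
      "b \<in> carrier K" "f b \<in> carrier L" "f b \<noteq> \<zero>\<^bsub>L\<^esub>" using G_E[OF F(2)[OF x]] by blast
    show ?thesis
    proof
      assume "0 \<le> \<nu> x"
      then have xO: "x \<in> K.O_set" using x by (simp add: K.O_mem)
      have "F x \<otimes>\<^bsub>L\<^esub> f b = f x \<otimes>\<^bsub>L\<^esub> f b" using b(4) f_mult[OF xO b(1)] by simp
      then have "F x = f x" using L.m_rcancel[OF b(7,6) F_carr[OF x] f_carr[OF xO]] by simp
      then show "0 \<le> \<mu> (F x)" using f_O[OF xO] by (simp add: L.O_mem)
    next
      assume "0 \<le> \<mu> (F x)"
      then have "F x \<in> L.O_set" using F_carr[OF x] by (simp add: L.O_mem)
      then obtain a where a: "a \<in> K.O_set" "f a = F x" using f_surj by blast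
      have "f (a \<otimes>\<^bsub>K\<^esub> b) = f (x \<otimes>\<^bsub>K\<^esub> b)" using f_mult[OF a(1) b(1)] a(2) b(4) by simp
      then have "a \<otimes>\<^bsub>K\<^esub> b = x \<otimes>\<^bsub>K\<^esub> b" using f_inj[OF OE(6)[OF a(1) b(1)] b(3)] by simp
      then have "a = x" using K.m_rcancel[OF b(2,5) _ x, of a] a(1) by (simp add: K.O_mem)
      then show "0 \<le> \<nu> x" using a(1) by (simp add: K.O_mem)
    qed
  qed
  have le: "\<nu> a \<le> \<nu> b \<longleftrightarrow> \<mu> (F a) \<le> \<mu> (F b)" if a: "a \<in> carrier K" and b: "b \<in> carrier K" for a b
  proof (cases "a = \<zero>\<^bsub>K\<^esub>")
    case True
    then show ?thesis
      using F_zero K.val_eq_Pinf_iff[OF b] L.val_eq_Pinf_iff[OF F_carr[OF b]] F_zero_iff[OF b] by simp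
  next
    case False
    have Fa: "F a \<noteq> \<zero>\<^bsub>L\<^esub>" using F_zero_iff[OF a] False by simp
    note i = K.nonzero_inv[OF a False] and j = L.nonzero_inv[OF F_carr[OF a] Fa]
    have ic: "inv\<^bsub>K\<^esub> a \<in> carrier K" using i by simp
    have "F (inv\<^bsub>K\<^esub> a) \<otimes>\<^bsub>L\<^esub> F a = \<one>\<^bsub>L\<^esub>"
      using ring_hom_mult[OF F_hom ic a] ring_hom_one[OF F_hom] i by simp
    moreover have "inv\<^bsub>L\<^esub> (F a) \<otimes>\<^bsub>L\<^esub> F a = \<one>\<^bsub>L\<^esub>" using j by simp
    ultimately have "F (inv\<^bsub>K\<^esub> a) = inv\<^bsub>L\<^esub> (F a)"
      using L.m_rcancel[OF Fa F_carr[OF a] F_carr[OF ic], of "inv\<^bsub>L\<^esub> (F a)"] j by simp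
    then have "F (b \<otimes>\<^bsub>K\<^esub> inv\<^bsub>K\<^esub> a) = F b \<otimes>\<^bsub>L\<^esub> inv\<^bsub>L\<^esub> (F a)"
      using ring_hom_mult[OF F_hom b ic] by simp
    then show ?thesis
      using K.val_div_le(1)[OF b a False] L.val_div_le(1)[OF F_carr[OF b] F_carr[OF a] Fa]
        sign[of "b \<otimes>\<^bsub>K\<^esub> inv\<^bsub>K\<^esub> a"] b ic by simp
  qed
  have "F \<in> valued_field_iso K \<nu> L \<mu>"
    unfolding valued_field_iso_def using F(1) le by (auto simp: not_le[symmetric])
  then show ?thesis by blast
qed

lemma valuation_ring_iso_of_field_iso:
  assumes K: "valued_field K \<nu>" and L: "valued_field L \<mu>" and F: "F \<in> valued_field_iso K \<nu> L \<mu>"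
  shows "F \<in> ring_iso (valuation_ring K \<nu>) (valuation_ring L \<mu>)"
proof -
  interpret K: valued_field K \<nu> by (rule K)
  interpret L: valued_field L \<mu> by (rule L)
  have iso: "F \<in> ring_iso K L" and less: "\<And>a b. a \<in> carrier K \<Longrightarrow> b \<in> carrier K \<Longrightarrow> \<nu> a < \<nu> b \<longleftrightarrow> \<mu> (F a) < \<mu> (F b)"
    using F by (auto simp: valued_field_iso_def)
  have hom: "F \<in> ring_hom K L" and bij: "bij_betw F (carrier K) (carrier L)"
    using iso by (auto simp: ring_iso_def)
  have sign: "0 \<le> \<nu> x \<longleftrightarrow> 0 \<le> \<mu> (F x)" if "x \<in> carrier K" for x
    using less[OF that K.one_closed] ring_hom_one[OF hom] by (simp add: not_less[symmetric])
  show ?thesis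
  proof (rule ring_iso_memI)
    have "F ` {x \<in> carrier K. 0 \<le> \<nu> x} = {y \<in> carrier L. 0 \<le> \<mu> y}"
    proof (intro equalityI subsetI)
      fix y assume y: "y \<in> {y \<in> carrier L. 0 \<le> \<mu> y}"
      then obtain x where "x \<in> carrier K" "F x = y" using bij_betw_ex[OF bij, of y] by auto
      then show "y \<in> F ` {x \<in> carrier K. 0 \<le> \<nu> x}" using y sign[of x] by auto
    next
      fix y assume "y \<in> F ` {x \<in> carrier K. 0 \<le> \<nu> x}"
      then show "y \<in> {y \<in> carrier L. 0 \<le> \<mu> y}" using sign ring_hom_closed[OF hom] by auto
    qed
    moreover have "inj_on F {x \<in> carrier K. 0 \<le> \<nu> x}"
      using bij unfolding bij_betw_def by (auto intro: inj_on_subset)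
    ultimately show b: "bij_betw F (carrier (valuation_ring K \<nu>)) (carrier (valuation_ring L \<mu>))"
      by (simp add: bij_betw_def valuation_ring_def)
    fix x assume "x \<in> carrier (valuation_ring K \<nu>)"
    then show "F x \<in> carrier (valuation_ring L \<mu>)" using b by (auto simp: bij_betw_def)
  qed (use ring_hom_mult[OF hom] ring_hom_add[OF hom] ring_hom_one[OF hom] in
      \<open>auto simp: valuation_ring_def\<close>)
qed

section \<open>Valued hyperfields\<close>

text \<open>For a bijection that maps hypersums onto hypersums the inverse is automatically a
  homomorphism.\<close>

lemma hyperfield_isoI:
  assumes bij: "bij_betw f (carrier H) (carrier H')"
    and closed: "hzero H \<in> carrier H" "\<one>\<^bsub>H\<^esub> \<in> carrier H"
      "\<And>a b. a \<in> carrier H \<Longrightarrow> b \<in> carrier H \<Longrightarrow> a \<otimes>\<^bsub>H\<^esub> b \<in> carrier H"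
      "\<And>a b. a \<in> carrier H \<Longrightarrow> b \<in> carrier H \<Longrightarrow> hadd H a b \<subseteq> carrier H"
    and zero: "f (hzero H) = hzero H'" and one: "f \<one>\<^bsub>H\<^esub> = \<one>\<^bsub>H'\<^esub>"
    and mult: "\<And>a b. a \<in> carrier H \<Longrightarrow> b \<in> carrier H \<Longrightarrow> f (a \<otimes>\<^bsub>H\<^esub> b) = f a \<otimes>\<^bsub>H'\<^esub> f b"
    and add: "\<And>a b. a \<in> carrier H \<Longrightarrow> b \<in> carrier H \<Longrightarrow> f ` hadd H a b = hadd H' (f a) (f b)"
    and val: "\<And>a b. a \<in> carrier H \<Longrightarrow> b \<in> carrier H \<Longrightarrow> hval H a \<le> hval H b \<longleftrightarrow> hval H' (f a) \<le> hval H' (f b)"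
  shows "f \<in> hyperfield_iso H H'"
proof -
  let ?g = "inv_into (carrier H) f"
  have inj: "inj_on f (carrier H)" using bij by (rule bij_betw_imp_inj_on)
  have gf: "?g (f a) = a" if "a \<in> carrier H" for a using inv_into_f_f[OF inj that] .
  have f_hom: "f \<in> hyperfield_hom H H'"
    unfolding hyperfield_hom_def using bij zero one mult add val by (auto simp: bij_betw_def)
  have "?g \<in> hyperfield_hom H' H"
    unfolding hyperfield_hom_def
  proof (intro CollectI conjI ballI)
    show "?g \<in> carrier H' \<rightarrow> carrier H" using bij by (auto simp: bij_betw_def inv_into_into)
    show "?g (hzero H') = hzero H" using gf[OF closed(1)] zero by simp
    show "?g \<one>\<^bsub>H'\<^esub> = \<one>\<^bsub>H\<^esub>" using gf[OF closed(2)] one by simp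
    fix x y assume "x \<in> carrier H'" "y \<in> carrier H'"
    then obtain a b where ab: "a \<in> carrier H" "b \<in> carrier H" "x = f a" "y = f b"
      using bij_betw_ex[OF bij] by metis
    show "?g (x \<otimes>\<^bsub>H'\<^esub> y) = ?g x \<otimes>\<^bsub>H\<^esub> ?g y"
      using ab gf mult[OF ab(1,2), symmetric] closed(3)[OF ab(1,2)] by simp
    show "?g ` hadd H' x y \<subseteq> hadd H (?g x) (?g y)"
    proof
      fix c assume "c \<in> ?g ` hadd H' x y"
      then obtain d where "d \<in> hadd H a b" "c = ?g (f d)"
        unfolding ab(3,4) add[OF ab(1,2), symmetric] by blast
      then show "c \<in> hadd H (?g x) (?g y)"
        using gf[of d] closed(4)[OF ab(1,2)] gf[OF ab(1)] gf[OF ab(2)] unfolding ab(3,4) by auto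
    qed
    show "(hval H' x \<le> hval H' y) = (hval H (?g x) \<le> hval H (?g y))"
      using val[OF ab(1,2)] gf[OF ab(1)] gf[OF ab(2)] unfolding ab(3,4) by simp
  qed
  then show ?thesis unfolding hyperfield_iso_def using f_hom bij by simp
qed

context ramified_field
begin

context
  fixes n :: nat
  assumes n: "0 < n"
begin

abbreviation M where "M \<equiv> max_ideal_pow K \<nu> n"

lemma M_iff: "x \<in> M \<longleftrightarrow> x \<in> carrier K \<and> \<nu> (\<pi> [^] n) \<le> \<nu> x"
  unfolding max_ideal_pow_eq[OF n] mpow_iff by simp

lemma M_pos: "m \<in> M \<Longrightarrow> 0 < \<nu> m"
proof -
  assume "m \<in> M"
  then have "\<nu> (\<pi> [^] n) \<le> \<nu> m" by (simp add: M_iff)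
  moreover have "\<nu> (\<pi> [^] (0::nat)) < \<nu> (\<pi> [^] n)" by (rule val_pi_strict[OF n])
  ultimately show ?thesis by simp
qed

lemma val_one_plus_M: "m \<in> M \<Longrightarrow> \<nu> (\<one> \<oplus> m) = 0"
proof -
  assume m: "m \<in> M"
  have mc: "m \<in> carrier K" using m by (simp add: M_iff)
  have "0 \<le> \<nu> (\<one> \<oplus> m)" using val_add_ge[of \<one> m 0] mc M_pos[OF m] by simp
  moreover have "\<not> 0 < \<nu> (\<one> \<oplus> m)"
  proof
    assume a: "0 < \<nu> (\<one> \<oplus> m)"
    have "min (\<nu> (\<one> \<oplus> m)) (\<nu> m) \<le> \<nu> ((\<one> \<oplus> m) \<ominus> m)" using mc by (intro val_minus) auto
    moreover have "(\<one> \<oplus> m) \<ominus> m = \<one>" using mc by algebra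
    ultimately show False using a M_pos[OF m] by (simp add: min_def split: if_splits)
  qed
  ultimately show ?thesis by simp
qed

lemma M_mult: "m \<in> M \<Longrightarrow> a \<in> carrier K \<Longrightarrow> 0 \<le> \<nu> a \<Longrightarrow> a \<otimes> m \<in> M"
  using val_mult_ge0[of a m] by (auto simp: M_iff)

lemma M_add: "a \<in> M \<Longrightarrow> b \<in> M \<Longrightarrow> a \<oplus> b \<in> M"
  using val_add_ge by (auto simp: M_iff)

lemma M_neg: "a \<in> M \<Longrightarrow> \<ominus> a \<in> M"
  by (auto simp: M_iff)

lemma M_zero: "\<zero> \<in> M" by (simp add: M_iff)

lemma hclass_E:
  assumes "y \<in> hclass K \<nu> n x" obtains m where "m \<in> M" "y = x \<otimes> (\<one> \<oplus> m)"
  using assms unfolding hclass_def by blast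

lemma hclass_I: "m \<in> M \<Longrightarrow> x \<otimes> (\<one> \<oplus> m) \<in> hclass K \<nu> n x"
  unfolding hclass_def by blast

lemma hclass_self: "x \<in> carrier K \<Longrightarrow> x \<in> hclass K \<nu> n x"
  using hclass_I[OF M_zero, of x] by simp

lemma hclass_carr: "x \<in> carrier K \<Longrightarrow> y \<in> hclass K \<nu> n x \<Longrightarrow> y \<in> carrier K"
  by (erule hclass_E) (auto simp: M_iff)

lemma hclass_val: "x \<in> carrier K \<Longrightarrow> y \<in> hclass K \<nu> n x \<Longrightarrow> \<nu> y = \<nu> x"
proof (erule hclass_E)
  fix m assume "x \<in> carrier K" "m \<in> M" "y = x \<otimes> (\<one> \<oplus> m)"
  then show "\<nu> y = \<nu> x" using val_mult[of x "\<one> \<oplus> m"] val_one_plus_M[of m] by (simp add: M_iff)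
qed

text \<open>The class of \<open>x\<close> is contained in \<open>x + x m\<^sup>n\<close>, and
  \<open>x m\<^sup>n \<subseteq> m\<^sup>n\<close> for integral \<open>x\<close>.\<close>

lemma hclass_diff: "x \<in> carrier K \<Longrightarrow> 0 \<le> \<nu> x \<Longrightarrow> y \<in> hclass K \<nu> n x \<Longrightarrow> y \<ominus> x \<in> M"
proof (erule hclass_E)
  fix m assume x: "x \<in> carrier K" "0 \<le> \<nu> x" and m: "m \<in> M" "y = x \<otimes> (\<one> \<oplus> m)"
  have mc: "m \<in> carrier K" using m by (simp add: M_iff)
  have "x \<otimes> (\<one> \<oplus> m) \<ominus> x = x \<otimes> m" using x(1) mc by algebra
  then show "y \<ominus> x \<in> M" using M_mult[OF m(1) x] m(2) by simp
qed

lemma one_plus_M_mult: "m \<in> M \<Longrightarrow> m' \<in> M \<Longrightarrow> \<exists>k\<in>M. (\<one> \<oplus> m) \<otimes> (\<one> \<oplus> m') = \<one> \<oplus> k"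
proof -
  assume m: "m \<in> M" "m' \<in> M"
  have c: "m \<in> carrier K" "m' \<in> carrier K" using m by (auto simp: M_iff)
  have "(\<one> \<oplus> m) \<otimes> (\<one> \<oplus> m') = \<one> \<oplus> (m \<oplus> (\<one> \<oplus> m) \<otimes> m')" using c by algebra
  moreover have "m \<oplus> (\<one> \<oplus> m) \<otimes> m' \<in> M"
    using M_add[OF m(1) M_mult[OF m(2), of "\<one> \<oplus> m"]] c val_one_plus_M[OF m(1)] by simp
  ultimately show ?thesis by blast
qed

lemma one_plus_M_inv: "m \<in> M \<Longrightarrow> \<exists>k\<in>M. (\<one> \<oplus> m) \<otimes> (\<one> \<oplus> k) = \<one>"
proof -
  assume m: "m \<in> M"
  have c: "m \<in> carrier K" using m by (simp add: M_iff)
  have v: "\<nu> (\<one> \<oplus> m) = 0" by (rule val_one_plus_M[OF m])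
  then have nz: "\<one> \<oplus> m \<noteq> \<zero>" by (auto simp: zero_extended_def)
  note i = nonzero_inv[OF _ nz]
  have ic: "inv (\<one> \<oplus> m) \<in> carrier K" "inv (\<one> \<oplus> m) \<otimes> (\<one> \<oplus> m) = \<one>" using i c by auto
  have vi: "\<nu> (inv (\<one> \<oplus> m)) = 0" using val_mult[of "inv (\<one> \<oplus> m)" "\<one> \<oplus> m"] ic c v by simp
  let ?k = "\<ominus> (inv (\<one> \<oplus> m) \<otimes> m)"
  have "?k \<in> M" using M_neg[OF M_mult[OF m ic(1)]] vi by simp
  moreover have "(\<one> \<oplus> m) \<otimes> (\<one> \<oplus> ?k) = \<one>"
  proof -
    have "(\<one> \<oplus> m) \<otimes> (\<one> \<oplus> \<ominus> (a \<otimes> m)) = (\<one> \<oplus> m) \<ominus> (a \<otimes> (\<one> \<oplus> m)) \<otimes> m" if "a \<in> carrier K" for a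
      using that c by algebra
    then have "(\<one> \<oplus> m) \<otimes> (\<one> \<oplus> ?k) = (\<one> \<oplus> m) \<ominus> \<one> \<otimes> m" using ic by simp
    also have "\<dots> = \<one>" using c by algebra
    finally show ?thesis .
  qed
  ultimately show ?thesis by blast
qed

text \<open>The set \<open>1 + m\<^sup>n\<close> is a group.\<close>

lemma hclass_trans:
  assumes x: "x \<in> carrier K" and y: "y \<in> hclass K \<nu> n x"
  shows "hclass K \<nu> n y = hclass K \<nu> n x"
proof -
  obtain m where m: "m \<in> M" "y = x \<otimes> (\<one> \<oplus> m)" using y by (rule hclass_E)
  have mc: "m \<in> carrier K" using m by (simp add: M_iff)
  obtain k where k: "k \<in> M" "(\<one> \<oplus> m) \<otimes> (\<one> \<oplus> k) = \<one>" using one_plus_M_inv[OF m(1)] by blast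
  have kc: "k \<in> carrier K" using k by (simp add: M_iff)
  show ?thesis
  proof (intro equalityI subsetI)
    fix z assume "z \<in> hclass K \<nu> n y"
    then obtain l where l: "l \<in> M" "z = y \<otimes> (\<one> \<oplus> l)" by (rule hclass_E)
    have lc: "l \<in> carrier K" using l by (simp add: M_iff)
    obtain j where "j \<in> M" "(\<one> \<oplus> m) \<otimes> (\<one> \<oplus> l) = \<one> \<oplus> j" using one_plus_M_mult[OF m(1) l(1)] by blast
    then show "z \<in> hclass K \<nu> n x" using hclass_I[of j x] l(2) m(2) x mc lc by (simp add: m_assoc)
  next
    fix z assume "z \<in> hclass K \<nu> n x"
    then obtain l where l: "l \<in> M" "z = x \<otimes> (\<one> \<oplus> l)" by (rule hclass_E)
    have lc: "l \<in> carrier K" using l by (simp add: M_iff)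
    obtain j where j: "j \<in> M" "(\<one> \<oplus> k) \<otimes> (\<one> \<oplus> l) = \<one> \<oplus> j" using one_plus_M_mult[OF k(1) l(1)] by blast
    have id: "x \<otimes> a \<otimes> (b \<otimes> c) = x \<otimes> ((a \<otimes> b) \<otimes> c)" if "a \<in> carrier K" "b \<in> carrier K" "c \<in> carrier K" for a b c
      using that x by algebra
    have "y \<otimes> (\<one> \<oplus> j) = x \<otimes> (\<one> \<oplus> m) \<otimes> ((\<one> \<oplus> k) \<otimes> (\<one> \<oplus> l))" using m(2) j(2) by simp
    also have "\<dots> = z" using id[of "\<one> \<oplus> m" "\<one> \<oplus> k" "\<one> \<oplus> l"] mc kc lc k(2) l(2) x by simp
    finally show "z \<in> hclass K \<nu> n y" using hclass_I[OF j(1), of y] by simp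
  qed
qed

lemma hclass_mult_mem:
  assumes "x \<in> carrier K" "y \<in> carrier K" "x' \<in> hclass K \<nu> n x" "y' \<in> hclass K \<nu> n y"
  shows "x' \<otimes> y' \<in> hclass K \<nu> n (x \<otimes> y)"
proof -
  obtain m m' where m: "m \<in> M" "x' = x \<otimes> (\<one> \<oplus> m)" "m' \<in> M" "y' = y \<otimes> (\<one> \<oplus> m')"
    using assms(3,4) hclass_E by metis
  have c: "m \<in> carrier K" "m' \<in> carrier K" using m by (auto simp: M_iff)
  obtain k where k: "k \<in> M" "(\<one> \<oplus> m) \<otimes> (\<one> \<oplus> m') = \<one> \<oplus> k" using one_plus_M_mult[OF m(1,3)] by blast
  have "x \<otimes> a \<otimes> (y \<otimes> b) = (x \<otimes> y) \<otimes> (a \<otimes> b)" if "a \<in> carrier K" "b \<in> carrier K" for a b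
    using that assms(1,2) by algebra
  then have "x' \<otimes> y' = (x \<otimes> y) \<otimes> (\<one> \<oplus> k)" using m k(2) c by simp
  then show ?thesis using hclass_I[OF k(1)] by simp
qed

abbreviation H where "H \<equiv> nth_hyperfield K \<nu> n"

lemma H_carrier: "carrier H = hclass K \<nu> n ` carrier K" and H_one: "\<one>\<^bsub>H\<^esub> = hclass K \<nu> n \<one>"
  and H_zero: "hzero H = hclass K \<nu> n \<zero>"
  and H_add: "hadd H a b = {hclass K \<nu> n (x \<oplus> y) | x y. x \<in> a \<and> y \<in> b}"
  and H_mult': "a \<otimes>\<^bsub>H\<^esub> b = (\<Union>x\<in>a. \<Union>y\<in>b. hclass K \<nu> n (x \<otimes> y))"
  by (simp_all add: nth_hyperfield_def)

lemma H_mult: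
  assumes "x \<in> carrier K" "y \<in> carrier K"
  shows "hclass K \<nu> n x \<otimes>\<^bsub>H\<^esub> hclass K \<nu> n y = hclass K \<nu> n (x \<otimes> y)"
proof -
  have "hclass K \<nu> n (x' \<otimes> y') = hclass K \<nu> n (x \<otimes> y)"
    if "x' \<in> hclass K \<nu> n x" "y' \<in> hclass K \<nu> n y" for x' y'
    using hclass_trans[OF _ hclass_mult_mem[OF assms that]] assms by simp
  then have "hclass K \<nu> n x \<otimes>\<^bsub>H\<^esub> hclass K \<nu> n y
      = (\<Union>x'\<in>hclass K \<nu> n x. \<Union>y'\<in>hclass K \<nu> n y. hclass K \<nu> n (x \<otimes> y))"
    unfolding H_mult' by simp
  then show ?thesis using hclass_self[OF assms(1)] hclass_self[OF assms(2)] by auto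
qed

lemma H_val:
  assumes "x \<in> carrier K" shows "hval H (hclass K \<nu> n x) = \<nu> x"
proof -
  have "\<nu> ` hclass K \<nu> n x = {\<nu> x}"
  proof (intro equalityI subsetI)
    fix g assume "g \<in> \<nu> ` hclass K \<nu> n x"
    then obtain y where "y \<in> hclass K \<nu> n x" "g = \<nu> y" by (rule imageE)
    then show "g \<in> {\<nu> x}" using hclass_val[OF assms, of y] by simp
  next
    fix g assume "g \<in> {\<nu> x}"
    then show "g \<in> \<nu> ` hclass K \<nu> n x" using imageI[OF hclass_self[OF assms], of \<nu>] by simp
  qed
  then show ?thesis by (simp add: nth_hyperfield_def)
qed

end

end

section \<open>The equivalence\<close>

locale ramified_field_pair = K1: ramified_field K1 \<nu>1 p + K2: ramified_field K2 \<nu>2 p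
  for K1 :: "('a, 'm) ring_scheme" and \<nu>1 :: "'a \<Rightarrow> 'g::linordered_ab_group_add extended"
    and K2 :: "('b, 'l) ring_scheme" and \<nu>2 :: "'b \<Rightarrow> 'h::linordered_ab_group_add extended"
    and p :: nat +
  fixes n :: nat
  assumes n_pos: "0 < n"
begin

abbreviation H1 where "H1 \<equiv> nth_hyperfield K1 \<nu>1 n"
abbreviation H2 where "H2 \<equiv> nth_hyperfield K2 \<nu>2 n"
abbreviation cl1 where "cl1 \<equiv> hclass K1 \<nu>1 n"
abbreviation cl2 where "cl2 \<equiv> hclass K2 \<nu>2 n"
abbreviation M1 where "M1 \<equiv> max_ideal_pow K1 \<nu>1 n"
abbreviation M2 where "M2 \<equiv> max_ideal_pow K2 \<nu>2 n"

lemma residue_ring_eq1: "nth_residue_ring K1 \<nu>1 n = K1.\<O> Quot mpow K1.\<O> K1.\<pi> n"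
  and residue_ring_eq2: "nth_residue_ring K2 \<nu>2 n = K2.\<O> Quot mpow K2.\<O> K2.\<pi> n"
  unfolding nth_residue_ring_def K1.max_ideal_pow_eq[OF n_pos] K2.max_ideal_pow_eq[OF n_pos] by simp_all

theorem residue_ring_iso_of_field_iso:
  assumes "valued_field_iso K1 \<nu>1 K2 \<nu>2 \<noteq> {}"
  shows "ring_iso (nth_residue_ring K1 \<nu>1 n) (nth_residue_ring K2 \<nu>2 n) \<noteq> {}"
proof -
  obtain F where "F \<in> valued_field_iso K1 \<nu>1 K2 \<nu>2" using assms by blast
  then have "F \<in> ring_iso K1.\<O> K2.\<O>"
    by (rule valuation_ring_iso_of_field_iso[OF K1.valued_field_axioms K2.valued_field_axioms])
  then show ?thesis unfolding residue_ring_eq1 residue_ring_eq2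
    by (rule dvr_iso_quotient_iso[OF K1.valuation_ring_dvr K2.valuation_ring_dvr])
qed

text \<open>The isomorphism maps each class onto a class, so the hyperfield isomorphism is the
  image map.\<close>

theorem hyperfield_iso_of_field_iso:
  assumes "valued_field_iso K1 \<nu>1 K2 \<nu>2 \<noteq> {}"
  shows "\<exists>f\<in>hyperfield_iso H1 H2. f (cl1 ([p] \<cdot>\<^bsub>K1\<^esub> \<one>\<^bsub>K1\<^esub>)) = cl2 ([p] \<cdot>\<^bsub>K2\<^esub> \<one>\<^bsub>K2\<^esub>)"
proof -
  obtain F where F: "F \<in> valued_field_iso K1 \<nu>1 K2 \<nu>2" using assms by blast
  have F_iso: "F \<in> ring_iso K1 K2"
    and less: "\<And>a b. a \<in> carrier K1 \<Longrightarrow> b \<in> carrier K1 \<Longrightarrow> \<nu>1 a < \<nu>1 b \<longleftrightarrow> \<nu>2 (F a) < \<nu>2 (F b)"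
    using F by (auto simp: valued_field_iso_def)
  have hom: "F \<in> ring_hom K1 K2" and bij: "bij_betw F (carrier K1) (carrier K2)"
    using F_iso by (auto simp: ring_iso_def)
  interpret F: ring_hom_ring K1 K2 F by (rule ring_hom_ringI2[OF K1.ring_axioms K2.ring_axioms hom])
  have F_O: "F \<in> ring_iso K1.\<O> K2.\<O>"
    by (rule valuation_ring_iso_of_field_iso[OF K1.valued_field_axioms K2.valued_field_axioms F])
  have M1_O: "m \<in> carrier K1.\<O>" if "m \<in> M1" for m
    using K1.M_pos[OF n_pos that] that by (auto simp: valuation_ring_def K1.M_iff[OF n_pos])
  have M2_O: "m \<in> carrier K2.\<O>" if "m \<in> M2" for m
    using K2.M_pos[OF n_pos that] that by (auto simp: valuation_ring_def K2.M_iff[OF n_pos])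
  have M_iff: "F m \<in> M2 \<longleftrightarrow> m \<in> M1" if "m \<in> carrier K1.\<O>" for m
    unfolding K1.max_ideal_pow_eq[OF n_pos] K2.max_ideal_pow_eq[OF n_pos]
    by (rule dvr_iso_mpow_iff[OF K1.valuation_ring_dvr K2.valuation_ring_dvr F_O that])
  have M1_carr: "m \<in> carrier K1" if "m \<in> M1" for m using that by (simp add: K1.M_iff[OF n_pos])
  have class_image: "F ` cl1 x = cl2 (F x)" if x: "x \<in> carrier K1" for x
  proof (intro equalityI subsetI)
    fix y assume "y \<in> F ` cl1 x"
    then obtain z where z: "z \<in> cl1 x" "y = F z" by (rule imageE)
    obtain m where m: "m \<in> M1" "z = x \<otimes>\<^bsub>K1\<^esub> (\<one>\<^bsub>K1\<^esub> \<oplus>\<^bsub>K1\<^esub> m)" using K1.hclass_E[OF n_pos z(1)] .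
    have "y = F x \<otimes>\<^bsub>K2\<^esub> (\<one>\<^bsub>K2\<^esub> \<oplus>\<^bsub>K2\<^esub> F m)" using z m x M1_carr[OF m(1)] by simp
    moreover have "F m \<in> M2" using M_iff[OF M1_O[OF m(1)]] m(1) by simp
    ultimately show "y \<in> cl2 (F x)" using K2.hclass_I[OF n_pos] by simp
  next
    fix y assume "y \<in> cl2 (F x)"
    then obtain m where m: "m \<in> M2" "y = F x \<otimes>\<^bsub>K2\<^esub> (\<one>\<^bsub>K2\<^esub> \<oplus>\<^bsub>K2\<^esub> m)" by (rule K2.hclass_E[OF n_pos])
    have "bij_betw F (carrier K1.\<O>) (carrier K2.\<O>)" using F_O by (simp add: ring_iso_def)
    then obtain m' where m': "m' \<in> carrier K1.\<O>" "F m' = m" using bij_betw_ex M2_O[OF m(1)] by metis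
    then have mM: "m' \<in> M1" using M_iff[OF m'(1)] m(1) by simp
    have "y = F (x \<otimes>\<^bsub>K1\<^esub> (\<one>\<^bsub>K1\<^esub> \<oplus>\<^bsub>K1\<^esub> m'))" using m(2) m'(2) x M1_carr[OF mM] by simp
    then show "y \<in> F ` cl1 x" using K1.hclass_I[OF n_pos mM, of x] by blast
  qed
  have cl_mem: "c \<subseteq> carrier K1" if "c \<in> carrier H1" for c
    using that K1.hclass_carr[OF n_pos] unfolding K1.H_carrier[OF n_pos] by blast
  have F_carr: "F x \<in> carrier K2" if "x \<in> carrier K1" for x using F.hom_closed[OF that] .
  have "(`) F \<in> hyperfield_iso H1 H2"
  proof (rule hyperfield_isoI)
    show "bij_betw ((`) F) (carrier H1) (carrier H2)"
      unfolding bij_betw_def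
    proof
      show "inj_on ((`) F) (carrier H1)"
        using bij_betw_imp_inj_on[OF bij] cl_mem by (intro inj_onI) (simp add: inj_on_image_eq_iff)
      have "(`) F ` carrier H1 = (\<lambda>x. cl2 (F x)) ` carrier K1"
        unfolding K1.H_carrier[OF n_pos] image_image using class_image by (intro image_cong) auto
      also have "\<dots> = cl2 ` carrier K2"
        using bij_betw_imp_surj_on[OF bij] by (metis image_image)
      finally show "(`) F ` carrier H1 = carrier H2" unfolding K2.H_carrier[OF n_pos] .
    qed
    show "hzero H1 \<in> carrier H1" "\<one>\<^bsub>H1\<^esub> \<in> carrier H1"
      unfolding K1.H_carrier[OF n_pos] K1.H_zero[OF n_pos] K1.H_one[OF n_pos] by simp_all
    show "F ` hzero H1 = hzero H2"
      unfolding K1.H_zero[OF n_pos] K2.H_zero[OF n_pos] class_image[OF K1.zero_closed] by simp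
    show "F ` \<one>\<^bsub>H1\<^esub> = \<one>\<^bsub>H2\<^esub>"
      unfolding K1.H_one[OF n_pos] K2.H_one[OF n_pos] class_image[OF K1.one_closed] by simp
    fix a b assume "a \<in> carrier H1" "b \<in> carrier H1"
    then obtain x y where xy: "x \<in> carrier K1" "y \<in> carrier K1" "a = cl1 x" "b = cl1 y"
      unfolding K1.H_carrier[OF n_pos] by blast
    note ab = cl_mem[OF \<open>a \<in> carrier H1\<close>] cl_mem[OF \<open>b \<in> carrier H1\<close>]
    show "a \<otimes>\<^bsub>H1\<^esub> b \<in> carrier H1"
      unfolding xy(3,4) K1.H_mult[OF n_pos xy(1,2)] K1.H_carrier[OF n_pos] using xy by simp
    show "hadd H1 a b \<subseteq> carrier H1"
      unfolding K1.H_add[OF n_pos] K1.H_carrier[OF n_pos] using ab by blast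
    show "F ` (a \<otimes>\<^bsub>H1\<^esub> b) = F ` a \<otimes>\<^bsub>H2\<^esub> F ` b"
      unfolding xy(3,4) K1.H_mult[OF n_pos xy(1,2)] class_image[OF xy(1)] class_image[OF xy(2)]
        K2.H_mult[OF n_pos F_carr[OF xy(1)] F_carr[OF xy(2)]]
        class_image[OF K1.m_closed[OF xy(1,2)]] using xy by simp
    show "(`) F ` hadd H1 a b = hadd H2 (F ` a) (F ` b)"
    proof (intro equalityI subsetI)
      fix c assume "c \<in> (`) F ` hadd H1 a b"
      then obtain s t where st: "s \<in> a" "t \<in> b" "c = F ` cl1 (s \<oplus>\<^bsub>K1\<^esub> t)"
        unfolding K1.H_add[OF n_pos] by blast
      then have "s \<in> carrier K1" "t \<in> carrier K1" using ab by auto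
      then have "c = cl2 (F s \<oplus>\<^bsub>K2\<^esub> F t)" using st(3) class_image by simp
      then show "c \<in> hadd H2 (F ` a) (F ` b)" unfolding K2.H_add[OF n_pos] using st(1,2) by blast
    next
      fix c assume "c \<in> hadd H2 (F ` a) (F ` b)"
      then obtain s t where st: "s \<in> a" "t \<in> b" "c = cl2 (F s \<oplus>\<^bsub>K2\<^esub> F t)"
        unfolding K2.H_add[OF n_pos] by blast
      then have "s \<in> carrier K1" "t \<in> carrier K1" using ab by auto
      then have "c = F ` cl1 (s \<oplus>\<^bsub>K1\<^esub> t)" using st(3) class_image by simp
      then show "c \<in> (`) F ` hadd H1 a b" unfolding K1.H_add[OF n_pos] using st(1,2) by blast
    qed
    show "(hval H1 a \<le> hval H1 b) = (hval H2 (F ` a) \<le> hval H2 (F ` b))"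
      unfolding xy(3,4) class_image[OF xy(1)] class_image[OF xy(2)]
        K1.H_val[OF n_pos xy(1)] K1.H_val[OF n_pos xy(2)]
        K2.H_val[OF n_pos F_carr[OF xy(1)]] K2.H_val[OF n_pos F_carr[OF xy(2)]]
      using less[OF xy(2,1)] by (simp add: not_less[symmetric])
  qed
  moreover have "F ` cl1 ([p] \<cdot>\<^bsub>K1\<^esub> \<one>\<^bsub>K1\<^esub>) = cl2 ([p] \<cdot>\<^bsub>K2\<^esub> \<one>\<^bsub>K2\<^esub>)"
    using class_image[of "[p] \<cdot>\<^bsub>K1\<^esub> \<one>\<^bsub>K1\<^esub>"] F.hom_nat_multiple_one[of p] by simp
  ultimately show ?thesis by blast
qed

text \<open>Choose \<open>\<phi> x\<close> in the image of the class of \<open>x\<close>. For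
  integral \<open>x\<close>, \<open>y\<close> the class of \<open>\<phi> (x + y)\<close> occurs in
  the hypersum of the classes of \<open>\<phi> x\<close> and \<open>\<phi> y\<close>, all of whose
  members agree modulo \<open>m\<^sup>n\<close>. So \<open>\<phi>\<close> induces a ring
  homomorphism onto the residue ring. Its kernel is found from the order: \<open>\<phi>\<close>
  takes least positive values to least positive values, hence \<open>m\<^sup>n\<close> to
  \<open>m\<^sup>n\<close>.\<close>

theorem residue_ring_iso_of_hyperfield_iso:
  assumes \<Phi>: "\<Phi> \<in> hyperfield_iso H1 H2"
  shows "ring_iso (nth_residue_ring K1 \<nu>1 n) (nth_residue_ring K2 \<nu>2 n) \<noteq> {}"
proof -
  have hom: "\<Phi> \<in> hyperfield_hom H1 H2" and bij: "bij_betw \<Phi> (carrier H1) (carrier H2)"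
    using \<Phi> by (auto simp: hyperfield_iso_def)
  have H1_mem: "cl1 x \<in> carrier H1" if "x \<in> carrier K1" for x
    using that unfolding K1.H_carrier[OF n_pos] by simp
  have one: "\<Phi> (cl1 \<one>\<^bsub>K1\<^esub>) = cl2 \<one>\<^bsub>K2\<^esub>"
    using hom unfolding hyperfield_hom_def K1.H_one[OF n_pos] K2.H_one[OF n_pos] by simp
  have mult: "\<Phi> (cl1 x \<otimes>\<^bsub>H1\<^esub> cl1 y) = \<Phi> (cl1 x) \<otimes>\<^bsub>H2\<^esub> \<Phi> (cl1 y)"
    and add: "\<Phi> ` hadd H1 (cl1 x) (cl1 y) \<subseteq> hadd H2 (\<Phi> (cl1 x)) (\<Phi> (cl1 y))"
    and val: "hval H1 (cl1 x) \<le> hval H1 (cl1 y) \<longleftrightarrow> hval H2 (\<Phi> (cl1 x)) \<le> hval H2 (\<Phi> (cl1 y))"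
    if "x \<in> carrier K1" "y \<in> carrier K1" for x y
    using hom H1_mem[OF that(1)] H1_mem[OF that(2)] unfolding hyperfield_hom_def by auto
  have "\<exists>y\<in>carrier K2. \<Phi> (cl1 x) = cl2 y" if "x \<in> carrier K1" for x
  proof -
    have "\<Phi> (cl1 x) \<in> carrier H2" using bij H1_mem[OF that] by (auto simp: bij_betw_def)
    then show ?thesis unfolding K2.H_carrier[OF n_pos] by blast
  qed
  then obtain \<phi> where \<phi>: "\<And>x. x \<in> carrier K1 \<Longrightarrow> \<phi> x \<in> carrier K2"
    and \<phi>_cl: "\<And>x. x \<in> carrier K1 \<Longrightarrow> \<Phi> (cl1 x) = cl2 (\<phi> x)" by metis
  have same_cl: "y \<in> cl2 z" if "cl2 y = cl2 z" "y \<in> carrier K2" for y z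
    using K2.hclass_self[OF n_pos that(2)] that(1) by simp
  have le: "\<nu>1 x \<le> \<nu>1 y \<longleftrightarrow> \<nu>2 (\<phi> x) \<le> \<nu>2 (\<phi> y)" if "x \<in> carrier K1" "y \<in> carrier K1" for x y
    using val[OF that] K1.H_val[OF n_pos that(1)] K1.H_val[OF n_pos that(2)]
      K2.H_val[OF n_pos \<phi>[OF that(1)]] K2.H_val[OF n_pos \<phi>[OF that(2)]] \<phi>_cl that by simp
  have less: "\<nu>1 x < \<nu>1 y \<longleftrightarrow> \<nu>2 (\<phi> x) < \<nu>2 (\<phi> y)" if "x \<in> carrier K1" "y \<in> carrier K1" for x y
    using le[OF that(2,1)] by (simp add: not_le[symmetric])
  have \<phi>_one: "\<phi> \<one>\<^bsub>K1\<^esub> \<in> cl2 \<one>\<^bsub>K2\<^esub>"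
    using same_cl \<phi>_cl[OF K1.one_closed] one \<phi>[OF K1.one_closed] by simp
  have val_\<phi>_one: "\<nu>2 (\<phi> \<one>\<^bsub>K1\<^esub>) = 0"
    using K2.hclass_val[OF n_pos K2.one_closed \<phi>_one] by simp
  have nonneg: "0 \<le> \<nu>1 x \<longleftrightarrow> 0 \<le> \<nu>2 (\<phi> x)" and pos: "0 < \<nu>1 x \<longleftrightarrow> 0 < \<nu>2 (\<phi> x)" if "x \<in> carrier K1" for x
    using le[OF K1.one_closed that] less[OF K1.one_closed that] val_\<phi>_one by simp_all
  have \<phi>_mult: "\<phi> (x \<otimes>\<^bsub>K1\<^esub> y) \<in> cl2 (\<phi> x \<otimes>\<^bsub>K2\<^esub> \<phi> y)" if xy: "x \<in> carrier K1" "y \<in> carrier K1" for x y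
  proof -
    have "cl2 (\<phi> (x \<otimes>\<^bsub>K1\<^esub> y)) = cl2 (\<phi> x \<otimes>\<^bsub>K2\<^esub> \<phi> y)"
      using mult[OF xy] \<phi>_cl xy K1.H_mult[OF n_pos xy] K2.H_mult[OF n_pos \<phi>[OF xy(1)] \<phi>[OF xy(2)]] by simp
    then show ?thesis using same_cl \<phi> xy by simp
  qed
  have \<phi>_surj: "\<exists>x\<in>carrier K1. \<phi> x \<in> cl2 y" if y: "y \<in> carrier K2" for y
  proof -
    have "cl2 y \<in> carrier H2" using y unfolding K2.H_carrier[OF n_pos] by simp
    then obtain c where c: "c \<in> carrier H1" "\<Phi> c = cl2 y" using bij_betw_ex[OF bij] by blast
    then obtain x where x: "x \<in> carrier K1" "c = cl1 x" unfolding K1.H_carrier[OF n_pos] by blast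
    then show ?thesis using c(2) \<phi>_cl[OF x(1)] same_cl \<phi>[OF x(1)] by auto
  qed
  have val_\<phi>_pi: "\<nu>2 (\<phi> K1.\<pi>) = \<nu>2 K2.\<pi>"
  proof (rule antisym)
    show "\<nu>2 K2.\<pi> \<le> \<nu>2 (\<phi> K1.\<pi>)"
      using K2.pi_facts(4)[OF \<phi>[OF K1.pi_facts(1)]] pos[OF K1.pi_facts(1)] K1.pi_facts(3) by simp
    obtain x where x: "x \<in> carrier K1" "\<phi> x \<in> cl2 K2.\<pi>" using \<phi>_surj[OF K2.pi_facts(1)] by blast
    have v: "\<nu>2 (\<phi> x) = \<nu>2 K2.\<pi>" by (rule K2.hclass_val[OF n_pos K2.pi_facts(1) x(2)])
    then have "0 < \<nu>1 x" using pos[OF x(1)] K2.pi_facts(3) by simp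
    then have "\<nu>1 K1.\<pi> \<le> \<nu>1 x" by (rule K1.pi_facts(4)[OF x(1)])
    then show "\<nu>2 (\<phi> K1.\<pi>) \<le> \<nu>2 K2.\<pi>" using le[OF K1.pi_facts(1) x(1)] v by simp
  qed
  have val_\<phi>_pow: "\<nu>2 (\<phi> (K1.\<pi> [^]\<^bsub>K1\<^esub> k)) = \<nu>2 (K2.\<pi> [^]\<^bsub>K2\<^esub> k)" for k :: nat
  proof (induction k)
    case 0
    then show ?case using val_\<phi>_one by simp
  next
    case (Suc k)
    note c = K1.pi_pow(1)[of k] K1.pi_facts(1)
    have "\<nu>2 (\<phi> (K1.\<pi> [^]\<^bsub>K1\<^esub> Suc k)) = \<nu>2 (\<phi> (K1.\<pi> [^]\<^bsub>K1\<^esub> k) \<otimes>\<^bsub>K2\<^esub> \<phi> K1.\<pi>)"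
      using K2.hclass_val[OF n_pos _ \<phi>_mult[OF c]] \<phi> c by simp
    also have "\<dots> = \<nu>2 (K2.\<pi> [^]\<^bsub>K2\<^esub> k) + \<nu>2 K2.\<pi>"
      using K2.val_mult \<phi> c Suc val_\<phi>_pi by simp
    also have "\<dots> = \<nu>2 (K2.\<pi> [^]\<^bsub>K2\<^esub> Suc k)"
      using K2.val_mult[OF K2.pi_pow(1) K2.pi_facts(1)] by simp
    finally show ?case .
  qed
  have mem: "\<phi> x \<in> M2 \<longleftrightarrow> x \<in> M1" if x: "x \<in> carrier K1" for x
    unfolding K1.M_iff[OF n_pos] K2.M_iff[OF n_pos]
    using x \<phi>[OF x] le[OF K1.pi_pow(1) x, of n] val_\<phi>_pow by simp
  let ?R2 = "K2.\<O> Quot M2"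
  interpret O1: complete_dvr K1.\<O> K1.\<pi> by (rule K1.valuation_ring_dvr)
  interpret O2: complete_dvr K2.\<O> K2.\<pi> by (rule K2.valuation_ring_dvr)
  have M2_eq: "M2 = O2.I n" and M1_eq: "M1 = O1.I n"
    using K1.max_ideal_pow_eq[OF n_pos] K2.max_ideal_pow_eq[OF n_pos] by simp_all
  have "ideal M2 K2.\<O>" unfolding M2_eq by (rule O2.I_ideal)
  then interpret M2: ideal M2 K2.\<O> .
  have O1: "x \<in> carrier K1.\<O> \<longleftrightarrow> x \<in> carrier K1 \<and> 0 \<le> \<nu>1 x" for x by (simp add: valuation_ring_def)
  have O2: "x \<in> carrier K2.\<O> \<longleftrightarrow> x \<in> carrier K2 \<and> 0 \<le> \<nu>2 x" for x by (simp add: valuation_ring_def)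
  have \<phi>_O: "\<phi> x \<in> carrier K2.\<O>" if "x \<in> carrier K1.\<O>" for x
    using that \<phi>[of x] nonneg[of x] unfolding O1 O2 by blast
  have minus: "x \<ominus>\<^bsub>K2.\<O>\<^esub> y = x \<ominus>\<^bsub>K2\<^esub> y" if "x \<in> carrier K2.\<O>" "y \<in> carrier K2.\<O>" for x y
    using that unfolding K2.valuation_ring_eq by (intro K2.subring_minus[OF K2.O_subring]) simp_all
  define h where "h x = M2 +>\<^bsub>K2.\<O>\<^esub> \<phi> x" for x
  have coset_eq: "M2 +>\<^bsub>K2.\<O>\<^esub> y = M2 +>\<^bsub>K2.\<O>\<^esub> z" if "y \<in> carrier K2.\<O>" "z \<in> carrier K2.\<O>" "y \<in> cl2 z" for y z
    using M2.coset_eq_iff[OF that(1,2)] minus[OF that(1,2)] K2.hclass_diff[OF n_pos _ _ that(3)] that(2)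
    unfolding O2 by simp
  have rep_O: "y \<in> carrier K2.\<O>" if "y \<in> cl2 z" "z \<in> carrier K2.\<O>" for y z
    using K2.hclass_carr[OF n_pos _ that(1)] K2.hclass_val[OF n_pos _ that(1)] that(2) unfolding O2 by simp
  have coset_add: "M2 +>\<^bsub>K2.\<O>\<^esub> (y \<oplus>\<^bsub>K2.\<O>\<^esub> z) = (M2 +>\<^bsub>K2.\<O>\<^esub> y) \<oplus>\<^bsub>?R2\<^esub> (M2 +>\<^bsub>K2.\<O>\<^esub> z)"
    and coset_mult: "M2 +>\<^bsub>K2.\<O>\<^esub> (y \<otimes>\<^bsub>K2.\<O>\<^esub> z) = (M2 +>\<^bsub>K2.\<O>\<^esub> y) \<otimes>\<^bsub>?R2\<^esub> (M2 +>\<^bsub>K2.\<O>\<^esub> z)"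
    if "y \<in> carrier K2.\<O>" "z \<in> carrier K2.\<O>" for y z
    using ring_hom_add[OF M2.rcos_ring_hom that] ring_hom_mult[OF M2.rcos_ring_hom that] by auto
  have h_hom: "h \<in> ring_hom K1.\<O> ?R2"
  proof (rule ring_hom_memI)
    fix x assume "x \<in> carrier K1.\<O>"
    then show "h x \<in> carrier ?R2"
      unfolding h_def by (intro ring_hom_closed[OF M2.rcos_ring_hom] \<phi>_O)
  next
    have "h \<one>\<^bsub>K1.\<O>\<^esub> = M2 +>\<^bsub>K2.\<O>\<^esub> \<one>\<^bsub>K2.\<O>\<^esub>"
      unfolding h_def using \<phi>_one \<phi>_O[OF O1.one_closed]
      by (intro coset_eq \<phi>_O O1.one_closed O2.one_closed) (simp add: valuation_ring_def)
    then show "h \<one>\<^bsub>K1.\<O>\<^esub> = \<one>\<^bsub>?R2\<^esub>" using ring_hom_one[OF M2.rcos_ring_hom] by simp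
  next
    fix x y assume xyO: "x \<in> carrier K1.\<O>" "y \<in> carrier K1.\<O>"
    then have xy: "x \<in> carrier K1" "y \<in> carrier K1" unfolding O1 by auto
    note \<phi>xy = \<phi>_O[OF xyO(1)] \<phi>_O[OF xyO(2)]
    have "h (x \<otimes>\<^bsub>K1.\<O>\<^esub> y) = M2 +>\<^bsub>K2.\<O>\<^esub> (\<phi> x \<otimes>\<^bsub>K2.\<O>\<^esub> \<phi> y)"
      unfolding h_def using \<phi>_mult[OF xy]
      by (intro coset_eq \<phi>_O O1.m_closed O2.m_closed xyO \<phi>xy) (simp add: valuation_ring_def)
    then show "h (x \<otimes>\<^bsub>K1.\<O>\<^esub> y) = h x \<otimes>\<^bsub>?R2\<^esub> h y" using coset_mult[OF \<phi>xy] by (simp add: h_def)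
    have "cl1 (x \<oplus>\<^bsub>K1\<^esub> y) \<in> hadd H1 (cl1 x) (cl1 y)"
      unfolding K1.H_add[OF n_pos] using K1.hclass_self[OF n_pos xy(1)] K1.hclass_self[OF n_pos xy(2)] by blast
    then have "\<Phi> (cl1 (x \<oplus>\<^bsub>K1\<^esub> y)) \<in> hadd H2 (\<Phi> (cl1 x)) (\<Phi> (cl1 y))" using add[OF xy] by blast
    then have "cl2 (\<phi> (x \<oplus>\<^bsub>K1\<^esub> y)) \<in> hadd H2 (cl2 (\<phi> x)) (cl2 (\<phi> y))"
      using \<phi>_cl xy K1.a_closed[OF xy] by simp
    then obtain s t where st: "s \<in> cl2 (\<phi> x)" "t \<in> cl2 (\<phi> y)" "cl2 (\<phi> (x \<oplus>\<^bsub>K1\<^esub> y)) = cl2 (s \<oplus>\<^bsub>K2\<^esub> t)"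
      unfolding K2.H_add[OF n_pos] by blast
    note stO = rep_O[OF st(1) \<phi>xy(1)] rep_O[OF st(2) \<phi>xy(2)]
    have "\<phi> (x \<oplus>\<^bsub>K1\<^esub> y) \<in> cl2 (s \<oplus>\<^bsub>K2\<^esub> t)"
      using same_cl[OF st(3)] \<phi>[OF K1.a_closed[OF xy]] by simp
    then have "h (x \<oplus>\<^bsub>K1.\<O>\<^esub> y) = M2 +>\<^bsub>K2.\<O>\<^esub> (s \<oplus>\<^bsub>K2.\<O>\<^esub> t)"
      unfolding h_def
      by (intro coset_eq \<phi>_O O1.a_closed O2.a_closed xyO stO) (simp add: valuation_ring_def)
    also have "\<dots> = (M2 +>\<^bsub>K2.\<O>\<^esub> s) \<oplus>\<^bsub>?R2\<^esub> (M2 +>\<^bsub>K2.\<O>\<^esub> t)" by (rule coset_add[OF stO])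
    also have "M2 +>\<^bsub>K2.\<O>\<^esub> s = h x" unfolding h_def by (rule coset_eq[OF stO(1) \<phi>xy(1) st(1)])
    also have "M2 +>\<^bsub>K2.\<O>\<^esub> t = h y" unfolding h_def by (rule coset_eq[OF stO(2) \<phi>xy(2) st(2)])
    finally show "h (x \<oplus>\<^bsub>K1.\<O>\<^esub> y) = h x \<oplus>\<^bsub>?R2\<^esub> h y" .
  qed
  have "ring_iso (K1.\<O> Quot M1) ?R2 \<noteq> {}"
  proof (rule quotient_iso_of_surj[OF O1.ring_axioms M2.quotient_is_ring h_hom])
    show "h ` carrier K1.\<O> = carrier ?R2"
    proof (intro equalityI subsetI)
      fix q assume "q \<in> h ` carrier K1.\<O>"
      then obtain x where "x \<in> carrier K1.\<O>" "q = h x" by (rule imageE)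
      then show "q \<in> carrier ?R2" using ring_hom_closed[OF h_hom] by simp
    next
      fix q assume "q \<in> carrier ?R2"
      then obtain y where y: "y \<in> carrier K2.\<O>" "q = M2 +>\<^bsub>K2.\<O>\<^esub> y" using M2.coset_surj[of q] by auto
      then have yK: "y \<in> carrier K2" unfolding O2 by simp
      obtain x where x: "x \<in> carrier K1" "\<phi> x \<in> cl2 y" using \<phi>_surj[OF yK] by blast
      have xO: "x \<in> carrier K1.\<O>"
        using rep_O[OF x(2) y(1)] nonneg[OF x(1)] x(1) unfolding O1 O2 by simp
      have "h x = q" unfolding h_def y(2) by (rule coset_eq[OF \<phi>_O[OF xO] y(1) x(2)])
      then show "q \<in> h ` carrier K1.\<O>" using xO by blast
    qed
    fix x assume x: "x \<in> carrier K1.\<O>"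
    then have "x \<in> carrier K1" unfolding O1 by simp
    then show "(h x = \<zero>\<^bsub>?R2\<^esub>) = (x \<in> M1)"
      unfolding h_def M2.coset_eq_zero_iff[OF \<phi>_O[OF x]] by (rule mem)
  qed (use O1.I_carr in \<open>auto simp: M1_eq\<close>)
  then show ?thesis by (simp add: nth_residue_ring_def)
qed

theorem field_iso_of_residue_ring_iso:
  assumes bound: "K2.e * (1 + K1.e\<^sup>2) < n"
    and iso: "ring_iso (nth_residue_ring K1 \<nu>1 n) (nth_residue_ring K2 \<nu>2 n) \<noteq> {}"
  shows "valued_field_iso K1 \<nu>1 K2 \<nu>2 \<noteq> {}"
proof -
  obtain f where f: "f \<in> ring_iso (K1.\<O> Quot mpow K1.\<O> K1.\<pi> n) (K2.\<O> Quot mpow K2.\<O> K2.\<pi> n)"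
    using iso unfolding residue_ring_eq1 residue_ring_eq2 by blast
  have "1 * 1 \<le> K2.e * (1 + K1.e\<^sup>2)" using K2.e_pos by (intro mult_le_mono) auto
  then have n2: "2 \<le> n" using bound by linarith
  obtain u1 where u1: "u1 \<in> Units K1.\<O>" "[p] \<cdot>\<^bsub>K1.\<O>\<^esub> \<one>\<^bsub>K1.\<O>\<^esub> = K1.\<pi> [^]\<^bsub>K1.\<O>\<^esub> K1.e \<otimes>\<^bsub>K1.\<O>\<^esub> u1"
    using K1.p_decomp by blast
  obtain u2 where u2: "u2 \<in> Units K2.\<O>" "[p] \<cdot>\<^bsub>K2.\<O>\<^esub> \<one>\<^bsub>K2.\<O>\<^esub> = K2.\<pi> [^]\<^bsub>K2.\<O>\<^esub> K2.e \<otimes>\<^bsub>K2.\<O>\<^esub> u2"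
    using K2.p_decomp by blast
  have p: "Factorial_Ring.prime p" using K1.mixed by (simp add: mixed_characteristic_def)
  note corr = quotient_iso_correspondence[OF K1.valuation_ring_dvr K2.valuation_ring_dvr n2 f]
  have "ring_iso K1.\<O> K2.\<O> \<noteq> {}"
    by (rule dvr_lift.residue_correspondence_lifts[OF dvr_lift.intro[OF corr dvr_lift_axioms.intro[OF
            p u1(2,1) u2(2,1) K1.e_pos K2.e_pos bound]]])
  then obtain g where "g \<in> ring_iso K1.\<O> K2.\<O>" by blast
  then show ?thesis
    by (rule field_iso_of_valuation_ring_iso[OF K1.valued_field_axioms K2.valued_field_axioms])
qed

end

theorem corollary3p19:
  fixes K1 :: "('a, 'm) ring_scheme" and K2 :: "('b, 'l) ring_scheme"
    and \<nu>1 :: "'a \<Rightarrow> 'g::linordered_ab_group_add extended"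
    and \<nu>2 :: "'b \<Rightarrow> 'h::linordered_ab_group_add extended"
    and p n :: nat
  assumes "complete_valued_field K1 \<nu>1" and "complete_valued_field K2 \<nu>2"
    and "mixed_characteristic K1 \<nu>1 p" and "mixed_characteristic K2 \<nu>2 p"
    and "finitely_ramified K1 \<nu>1 p" and "finitely_ramified K2 \<nu>2 p"
    and "n > ramification_index K2 \<nu>2 p * (1 + (ramification_index K1 \<nu>1 p)\<^sup>2)"
  shows
    "(valued_field_iso K1 \<nu>1 K2 \<nu>2 \<noteq> {} \<longleftrightarrow>
        ring_iso (nth_residue_ring K1 \<nu>1 n) (nth_residue_ring K2 \<nu>2 n) \<noteq> {}) \<and>
     (ring_iso (nth_residue_ring K1 \<nu>1 n) (nth_residue_ring K2 \<nu>2 n) \<noteq> {} \<longleftrightarrow>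
        (\<exists>f \<in> hyperfield_iso (nth_hyperfield K1 \<nu>1 n) (nth_hyperfield K2 \<nu>2 n).
           f (hclass K1 \<nu>1 n ([p] \<cdot>\<^bsub>K1\<^esub> \<one>\<^bsub>K1\<^esub>)) = hclass K2 \<nu>2 n ([p] \<cdot>\<^bsub>K2\<^esub> \<one>\<^bsub>K2\<^esub>)))"
proof -
  interpret ramified_field_pair K1 \<nu>1 K2 \<nu>2 p n
    using assms by (intro ramified_field_pair.intro ramified_field.intro ramified_field_axioms.intro
        ramified_field_pair_axioms.intro) auto
  show ?thesis
    using residue_ring_iso_of_field_iso field_iso_of_residue_ring_iso[OF assms(7)]
      hyperfield_iso_of_field_iso residue_ring_iso_of_hyperfield_iso by blast
qed

end
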